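(* Let $R=k[x,y,z]$ be a polynomial ring over an infinite field $k$ and let $$I=(x^n,y^n,z^n,\{x^{n-k_i}y^{k_i}\},\{x^{n-\ell_i}z^{\ell_i}\},\{y^{n-m_i}z^{m_i}\})\neq R.$$ Write $a=\gcd(n,k_i\text{'s},\ell_i\text{'s})$, $b=\gcd(n,k_i\text{'s},m_i\text{'s})$, $c=\gcd(n,\ell_i\text{'s},m_i\text{'s})$, and $S=k[x^a,y^b,z^c]$. Assume that $\gcd(a,b,c)=1$ (hence $a,b,c$ are pairwise relatively prime) and $a\le b\le c$. Let $K$ be the $R$-ideal generated by the monomials in $S$ of degree $n$, and $L$ the $R$-ideal generated by $S_{\ge n}$. If $a=1$, then $$\mathrm{core}(I)=\mathrm{core}(K)=\mathrm{core}(L)=(S_{\ge 3n-b-c})R.$$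
   Context: The families $\{k_i\}$, $\{\ell_i\}$, $\{m_i\}$ are finite (possibly empty) families of integers between $0$ and $n$. The ring $S$ is graded by the standard total degree of $R$ (so $x^a,y^b,z^c$ have degrees $a,b,c$), and $S_{\ge j}=\bigoplus_{\ell\ge j}S_\ell$. A subideal $J$ of an ideal $I$ is a reduction of $I$ if $I^{r+1}=JI^r$ for some integer $r\ge0$. $\mathrm{core}(I)$ is the intersection of all reductions of $I$ (cores are taken in $R$). *)

theory Defs
  imports
    Complex_Main
    "HOL-Library.Poly_Mapping"
    "HOL-Library.Product_Plus"
begin

text \<open>Ideals of a commutative ring are the submodules of the ring, regarded as a module over
  itself: \<open>ideal.subspace J\<close> says that \<open>J\<close> is an ideal, and \<open>ideal.span B\<close> is the ideal
  generated by \<open>B\<close>.\<close>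

global_interpretation ideal: module "(*) :: 'a::comm_ring_1 \<Rightarrow> 'a \<Rightarrow> 'a"
  by standard (simp_all add: algebra_simps)

definition ideal_prod :: "'a::comm_ring_1 set \<Rightarrow> 'a set \<Rightarrow> 'a set" where
  "ideal_prod I J = ideal.span {f * g | f g. f \<in> I \<and> g \<in> J}"

primrec ideal_pow :: "'a::comm_ring_1 set \<Rightarrow> nat \<Rightarrow> 'a set" where
  "ideal_pow I 0 = UNIV"
| "ideal_pow I (Suc r) = ideal_prod I (ideal_pow I r)"

definition is_reduction :: "'a::comm_ring_1 set \<Rightarrow> 'a set \<Rightarrow> bool" where
  "is_reduction J I \<longleftrightarrow> ideal.subspace J \<and> J \<subseteq> I \<and>
     (\<exists>r. ideal_pow I (r + 1) = ideal_prod J (ideal_pow I r))"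

definition core :: "'a::comm_ring_1 set \<Rightarrow> 'a set" where
  "core I = \<Inter>{J. is_reduction J I}"

text \<open>The polynomial ring \<open>k[x,y,z]\<close> is the monoid algebra of \<open>\<nat>\<^sup>3\<close> over \<open>k\<close>: a polynomial is
  the finitely supported family of its coefficients, indexed by exponent vectors.\<close>

type_synonym 'k poly3 = "(nat \<times> nat \<times> nat) \<Rightarrow>\<^sub>0 'k"

definition X :: "'k::field poly3" where "X = Poly_Mapping.single (1, 0, 0) 1"
definition Y :: "'k::field poly3" where "Y = Poly_Mapping.single (0, 1, 0) 1"
definition Z :: "'k::field poly3" where "Z = Poly_Mapping.single (0, 0, 1) 1"

definition Const :: "'k::field \<Rightarrow> 'k poly3" where
  "Const u = Poly_Mapping.single 0 u"

definition homogeneous :: "nat \<Rightarrow> 'k::field poly3 \<Rightarrow> bool" where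
  "homogeneous d f \<longleftrightarrow> (\<forall>(i, j, l) \<in> Poly_Mapping.keys f. i + j + l = d)"

definition monomials_of_degree :: "nat \<Rightarrow> 'k::field poly3 set" where
  "monomials_of_degree d = {X ^ i * Y ^ j * Z ^ l | i j l. i + j + l = d}"

inductive_set subalgebra_gen :: "'k::field poly3 set \<Rightarrow> 'k poly3 set"
  for A :: "'k poly3 set" where
  Const: "Const u \<in> subalgebra_gen A"
| gen: "f \<in> A \<Longrightarrow> f \<in> subalgebra_gen A"
| add: "f \<in> subalgebra_gen A \<Longrightarrow> g \<in> subalgebra_gen A \<Longrightarrow> f + g \<in> subalgebra_gen A"
| mult: "f \<in> subalgebra_gen A \<Longrightarrow> g \<in> subalgebra_gen A \<Longrightarrow> f * g \<in> subalgebra_gen A"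

definition graded_part :: "'k::field poly3 set \<Rightarrow> nat \<Rightarrow> 'k poly3 set" where
  "graded_part S d = {f \<in> S. homogeneous d f}"

text \<open>\<open>S\<^sub>\<ge>\<^sub>j\<close>, the internal direct sum of the components \<open>S\<^sub>d\<close> with \<open>d \<ge> j\<close>.\<close>

definition graded_ge :: "'k::field poly3 set \<Rightarrow> nat \<Rightarrow> 'k poly3 set" where
  "graded_ge S j = {\<Sum>d\<in>D. f d | D f. finite D \<and> D \<subseteq> {j..} \<and> (\<forall>d\<in>D. f d \<in> graded_part S d)}"

end

theory Submission
  imports
    Defs
    "HOL-Library.Multiset"
    "HOL-Computational_Algebra.Polynomial"
    "HOL-Number_Theory.Number_Theory"
begin

text \<open>Put \<open>D = 3n - b - c\<close>, and let \<open>F d\<close> be the ideal generated by \<open>S\<^sub>\<ge>\<^sub>d\<close>, so that \<open>L = F n\<close>.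
  Since \<open>(x\<^sup>n, y\<^sup>n, z\<^sup>n)\<close> is a reduction of \<open>K\<close> and of \<open>L\<close>, the ideals \<open>I \<subseteq> K \<subseteq> L\<close> are reductions of
  one another, whence \<open>core L \<subseteq> core K \<subseteq> core I\<close>, and it remains to show \<open>F D \<subseteq> core L\<close> and
  \<open>core I \<subseteq> F D\<close>.

  For the first inclusion, let \<open>J\<close> be a reduction of \<open>L\<close>, and let \<open>V\<close> be the space of the leading forms
  in \<open>S\<^sub>n\<close> of the elements of \<open>J\<close>. As \<open>V\<close> generates an ideal containing powers of \<open>x\<close>, \<open>y\<^sup>b\<close>, \<open>z\<^sup>c\<close>, the
  regular sequence \<open>x\<^sup>n, y\<^sup>n, z\<^sup>n\<close> can be exchanged, one element at a time, for elements of \<open>V\<close>. Each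
  exchange preserves the property that the ideal contains \<open>S\<^sub>d\<close> for all \<open>d \<ge> D\<close>, which is evident for
  the three powers. Hence \<open>V\<close> generates \<open>S\<^sub>\<ge>\<^sub>D\<close>, and \<open>F D \<subseteq> J\<close> follows by descending induction on the degree.

  For the second inclusion, let \<open>h\<^sub>0, h\<^sub>1, h\<^sub>2\<close> be linear combinations of the monomials generating \<open>I\<close>. For
  almost all scalars \<open>t\<close> the ideal \<open>(x\<^sup>n - t h\<^sub>0, y\<^sup>n - t h\<^sub>1, z\<^sup>n - t h\<^sub>2)\<close> is a reduction of \<open>I\<close>, so the
  residue with respect to these generators, expanded as a power series in \<open>t\<close>, vanishes on \<open>core I\<close>. Its
  coefficients are sums of multinomial coefficients times monomials in the coefficients of the \<open>h\<^sub>i\<close>.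
  The monomials generating \<open>I\<close> span the lattice of \<open>S\<close> because of the assumption on the greatest common
  divisors; therefore every \<open>f\<close> outside \<open>F D\<close> has, after multiplication by a suitable monomial, a
  nonzero residue for some choice of the \<open>h\<^sub>i\<close>. In characteristic \<open>p\<close> the exponents have to be chosen
  without carries in base \<open>p\<close>, so that the multinomial coefficients do not vanish.\<close>

(* Left as a simp rule, this instance of associativity loops with ac_simps. *)
declare ideal.scale_scale [simp del]

section \<open>Products of ideals and reductions\<close>

lemma ideal_prod_base: "f \<in> I \<Longrightarrow> g \<in> J \<Longrightarrow> f * g \<in> ideal_prod I J"
  unfolding ideal_prod_def by (rule ideal.span_base) blast

lemma ideal_subspace_prod: "ideal.subspace (ideal_prod I J)"
  unfolding ideal_prod_def by simp

lemma ideal_subspace_pow: "ideal.subspace (ideal_pow I r)"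
  by (cases r) (simp_all add: ideal_subspace_prod)

lemma ideal_prod_least:
  assumes "ideal.subspace P" and "\<And>f g. f \<in> I \<Longrightarrow> g \<in> J \<Longrightarrow> f * g \<in> P"
  shows "ideal_prod I J \<subseteq> P"
  unfolding ideal_prod_def by (rule ideal.span_minimal) (use assms in auto)

lemma ideal_prod_mono: "I \<subseteq> I' \<Longrightarrow> J \<subseteq> J' \<Longrightarrow> ideal_prod I J \<subseteq> ideal_prod I' J'"
  by (rule ideal_prod_least[OF ideal_subspace_prod]) (auto intro: ideal_prod_base)

lemma ideal_prod_commute: "ideal_prod I J = ideal_prod J I"
  by (rule subset_antisym; rule ideal_prod_least[OF ideal_subspace_prod])
    (metis ideal_prod_base mult.commute)+

lemma ideal_subspace_colon:
  assumes "ideal.subspace P"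
  shows "ideal.subspace {g. a * g \<in> P}"
proof -
  have "a * (c * g) \<in> P" if "a * g \<in> P" for c g
    using ideal.subspace_scale[OF assms that, of c] by (simp add: mult.left_commute)
  then show ?thesis
    using assms by (simp add: ideal.subspace_def distrib_left)
qed

lemma ideal_prod_span: "ideal_prod (ideal.span A) (ideal.span B) = ideal.span {a * b | a b. a \<in> A \<and> b \<in> B}"
    (is "_ = ideal.span ?C")
proof
  have sub: "ideal.subspace {g. a * g \<in> ideal.span ?C}" for a
    by (rule ideal_subspace_colon) simp
  have 1: "a * g \<in> ideal.span ?C" if "a \<in> A" "g \<in> ideal.span B" for a g
  proof -
    have "ideal.span B \<subseteq> {g. a * g \<in> ideal.span ?C}"
      by (rule ideal.span_minimal[OF _ sub]) (use that(1) in \<open>auto intro: ideal.span_base\<close>)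
    then show ?thesis using that(2) by blast
  qed
  have 2: "f * g \<in> ideal.span ?C" if "f \<in> ideal.span A" "g \<in> ideal.span B" for f g
  proof -
    have "ideal.span A \<subseteq> {f. g * f \<in> ideal.span ?C}"
      by (rule ideal.span_minimal[OF _ sub]) (use 1 that(2) in \<open>auto simp: mult.commute\<close>)
    then show ?thesis using that(1) by (auto simp: mult.commute)
  qed
  show "ideal_prod (ideal.span A) (ideal.span B) \<subseteq> ideal.span ?C"
    by (rule ideal_prod_least) (auto intro: 2)
  show "ideal.span ?C \<subseteq> ideal_prod (ideal.span A) (ideal.span B)"
    by (rule ideal.span_minimal) (auto intro: ideal_prod_base ideal.span_base ideal_subspace_prod)
qed

lemma ideal_prod_span_left: "ideal_prod (ideal.span A) B = ideal_prod A B"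
  and ideal_prod_span_right: "ideal_prod A (ideal.span B) = ideal_prod A B"
proof -
  have *: "ideal_prod (ideal.span A) (ideal.span B) = ideal_prod A B" for A B :: "'a set"
    unfolding ideal_prod_span unfolding ideal_prod_def ..
  show "ideal_prod (ideal.span A) B = ideal_prod A B"
    using *[of "ideal.span A" B] *[of A B] by (simp add: ideal.span_span)
  show "ideal_prod A (ideal.span B) = ideal_prod A B"
    using *[of A "ideal.span B"] *[of A B] by (simp add: ideal.span_span)
qed

lemma ideal_prod_assoc: "ideal_prod (ideal_prod I J) K = ideal_prod I (ideal_prod J K)"
proof -
  have "ideal_prod (ideal_prod I J) K = ideal_prod {a * b | a b. a \<in> I \<and> b \<in> J} K"
    unfolding ideal_prod_def[of I J] by (rule ideal_prod_span_left)
  also have "\<dots> = ideal.span {a * b * c | a b c. a \<in> I \<and> b \<in> J \<and> c \<in> K}"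
    unfolding ideal_prod_def by (rule arg_cong[where f = ideal.span]) blast
  also have "\<dots> = ideal.span {a * (b * c) | a b c. a \<in> I \<and> b \<in> J \<and> c \<in> K}"
    by (simp only: mult.assoc)
  also have "\<dots> = ideal_prod I {b * c | b c. b \<in> J \<and> c \<in> K}"
    unfolding ideal_prod_def by (rule arg_cong[where f = ideal.span]) blast
  also have "\<dots> = ideal_prod I (ideal_prod J K)"
    unfolding ideal_prod_def[of J K] by (rule ideal_prod_span_right[symmetric])
  finally show ?thesis .
qed

lemma ideal_prod_UNIV_left: "ideal.subspace J \<Longrightarrow> ideal_prod UNIV J = J"
proof
  assume "ideal.subspace J"
  then show "ideal_prod UNIV J \<subseteq> J"
    by (intro ideal_prod_least) (auto simp: ideal.subspace_scale)
  show "J \<subseteq> ideal_prod UNIV J"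
    using ideal_prod_base[of 1 UNIV _ J] by auto
qed

lemma ideal_prod_subset_right: "ideal.subspace J \<Longrightarrow> ideal_prod I J \<subseteq> J"
  by (rule ideal_prod_least) (auto simp: ideal.subspace_scale)

lemma ideal_pow_base: "f \<in> I \<Longrightarrow> f ^ r \<in> ideal_pow I r"
  by (induction r) (auto intro: ideal_prod_base)

lemma is_reductionI:
  assumes "ideal.subspace J" "J \<subseteq> I" "ideal_pow I (Suc r) \<subseteq> ideal_prod J (ideal_pow I r)"
  shows "is_reduction J I"
  unfolding is_reduction_def
proof (intro conjI exI)
  show "ideal_pow I (r + 1) = ideal_prod J (ideal_pow I r)"
    using assms(3) ideal_prod_mono[OF assms(2) subset_refl] by auto
qed (use assms in auto)

lemma is_reduction_middle:
  assumes "is_reduction J L" "J \<subseteq> I" "I \<subseteq> L" "ideal.subspace I"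
  shows "is_reduction I L"
proof -
  obtain r where "ideal_pow L (r + 1) = ideal_prod J (ideal_pow L r)"
    using assms(1) by (auto simp: is_reduction_def)
  then have "ideal_pow L (Suc r) \<subseteq> ideal_prod I (ideal_pow L r)"
    using ideal_prod_mono[OF assms(2) subset_refl] by fastforce
  then show ?thesis using assms by (intro is_reductionI)
qed

lemma is_reduction_trans:
  assumes "is_reduction J I" "is_reduction I L"
  shows "is_reduction J L"
proof -
  obtain r where r: "ideal_pow I (Suc r) = ideal_prod J (ideal_pow I r)"
    using assms(1) by (auto simp: is_reduction_def)
  obtain s where s: "ideal_pow L (Suc s) = ideal_prod I (ideal_pow L s)"
    using assms(2) by (auto simp: is_reduction_def)
  \<comment> \<open>Iterating \<open>L^(s+1) = I L^s\<close> gives \<open>L^(s+t) = I^t L^s\<close>;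
    for \<open>t = r + 1\<close> the equation \<open>I^(r+1) = J I^r\<close> is then
    substituted.\<close>
  have pow: "ideal_pow L (s + t) = ideal_prod (ideal_pow I t) (ideal_pow L s)" for t
  proof (induction t)
    case 0
    then show ?case by (simp add: ideal_prod_UNIV_left ideal_subspace_pow)
  next
    case (Suc t)
    have "ideal_pow L (s + Suc t) = ideal_prod L (ideal_prod (ideal_pow I t) (ideal_pow L s))"
      using Suc by simp
    also have "\<dots> = ideal_prod (ideal_pow I t) (ideal_pow L (Suc s))"
      by (metis ideal_prod_assoc ideal_prod_commute ideal_pow.simps(2))
    also have "\<dots> = ideal_prod (ideal_pow I (Suc t)) (ideal_pow L s)"
      by (metis ideal_prod_assoc ideal_prod_commute ideal_pow.simps(2) s)
    finally show ?case .
  qed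
  have "ideal_pow L (Suc (s + r)) = ideal_prod J (ideal_pow L (s + r))"
    using pow[of "Suc r"] pow[of r] r by (simp add: ideal_prod_assoc del: ideal_pow.simps)
  then show ?thesis
    using assms by (intro is_reductionI) (auto simp: is_reduction_def)
qed

lemma core_antimono: "is_reduction I L \<Longrightarrow> core L \<subseteq> core I"
  unfolding core_def using is_reduction_trans by blast

lemma ideal_span_insert_iff: "f \<in> ideal.span (insert a B) \<longleftrightarrow> (\<exists>u g. g \<in> ideal.span B \<and> f = u * a + g)"
  unfolding ideal.span_insert by (auto simp: algebra_simps) (metis add_diff_cancel_left' diff_add_cancel)+

lemma ideal_span_doubleton_iff: "f \<in> ideal.span {a, b} \<longleftrightarrow> (\<exists>u v. f = u * a + v * b)"
  by (auto simp: ideal_span_insert_iff)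

lemma ideal_span_triple_iff: "f \<in> ideal.span {a, b, c} \<longleftrightarrow> (\<exists>u v w. f = u * a + v * b + w * c)"
  unfolding ideal_span_insert_iff[of f a] ideal_span_doubleton_iff by (auto simp: add.assoc)

section \<open>Linear algebra over an integral domain\<close>

text \<open>Gaussian elimination without division: cross-multiplying with the pivot keeps the
  coefficients in the domain. It is applied over \<open>k\<close> and over polynomials in the
  parameter \<open>t\<close>.\<close>

lemma linear_dependence_idom:
  fixes f :: "'i \<Rightarrow> 'a \<Rightarrow> 't::idom"
  assumes "finite A" "finite I" "card A < card I"
  shows "\<exists>c. (\<exists>i\<in>I. c i \<noteq> 0) \<and> (\<forall>a\<in>A. (\<Sum>i\<in>I. c i * f i a) = 0)"
  using assms
proof (induction A arbitrary: f I rule: finite_induct)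
  case empty
  then have "I \<noteq> {}" by auto
  then show ?case by (intro exI[of _ "\<lambda>_. 1"]) auto
next
  case (insert a A)
  show ?case
  proof (cases "\<forall>i\<in>I. f i a = 0")
    case True
    have "card A < card I" using insert.prems insert.hyps by simp
    from insert.IH[OF insert.prems(1) this, of f] True show ?thesis by auto
  next
    case False
    then obtain j where j: "j \<in> I" "f j a \<noteq> 0" by blast
    define J where "J = I - {j}"
    define f' where "f' i b = f j a * f i b - f i a * f j b" for i b
    have "card A < card J" "finite J"
      using insert.prems insert.hyps j by (auto simp: J_def)
    from insert.IH[OF this(2,1), of f'] obtain c
      where c: "\<exists>i\<in>J. c i \<noteq> 0" "\<And>b. b \<in> A \<Longrightarrow> (\<Sum>i\<in>J. c i * f' i b) = 0" by blast
    define e where "e i = (if i = j then - (\<Sum>i\<in>J. c i * f i a) else c i * f j a)" for i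
    have I: "I = insert j J" "j \<notin> J" "finite J"
      using j insert.prems by (auto simp: J_def)
    have eq: "(\<Sum>i\<in>I. e i * f i b) = (\<Sum>i\<in>J. c i * f' i b)" for b
    proof -
      have "(\<Sum>i\<in>I. e i * f i b) = - (\<Sum>i\<in>J. c i * f i a) * f j b + (\<Sum>i\<in>J. c i * f j a * f i b)"
        unfolding I(1) using I(2,3) by (subst sum.insert) (auto simp: e_def intro!: sum.cong)
      also have "\<dots> = (\<Sum>i\<in>J. c i * f' i b)"
        by (simp add: f'_def sum_distrib_right sum_distrib_left sum_subtractf algebra_simps)
      finally show ?thesis .
    qed
    have "(\<Sum>i\<in>I. e i * f i b) = 0" if "b \<in> insert a A" for b
      using that c(2) unfolding eq by (auto simp: f'_def mult.commute)
    moreover have "\<exists>i\<in>I. e i \<noteq> 0"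
      using c(1) j I by (auto simp: e_def)
    ultimately show ?thesis by blast
  qed
qed

text \<open>Fraction-free elimination at a pivot \<open>v i b\<close> removes one vector at a time.
  In the end \<open>s\<close> is zero, which unwinds to a relation over \<open>k[t]\<close>, or it
  has a nonzero entry, which has finitely many roots. Membership at infinitely many \<open>t\<close>
  thus becomes one polynomial relation.\<close>

lemma generic_span:
  fixes v :: "'i \<Rightarrow> 'a \<Rightarrow> 'k::field poly" and s :: "'a \<Rightarrow> 'k poly"
  assumes "finite I"
  shows "(\<exists>c d. c \<noteq> 0 \<and> (\<forall>a. c * s a = (\<Sum>i\<in>I. d i * v i a))) \<or>
         finite {t. \<exists>d. \<forall>a. poly (s a) t = (\<Sum>i\<in>I. d i * poly (v i a) t)}"
  using assms
proof (induction I arbitrary: v s rule: finite_induct)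
  case empty
  show ?case
  proof (cases "\<forall>a. s a = 0")
    case True
    then show ?thesis by (intro disjI1 exI[of _ 1]) auto
  next
    case False
    then obtain a where "s a \<noteq> 0" by blast
    then have "finite {t. poly (s a) t = 0}" by (rule poly_roots_finite)
    then show ?thesis by (auto intro: finite_subset[rotated])
  qed
next
  case (insert i I)
  show ?case
  proof (cases "\<forall>a. v i a = 0")
    case True
    then show ?thesis using insert.IH[of s v] insert.hyps by simp
  next
    case False
    then obtain b where b: "v i b \<noteq> 0" by blast
    define v' where "v' j a = v i b * v j a - v j b * v i a" for j a
    define s' where "s' a = v i b * s a - s b * v i a" for a
    consider (rel) c d where "c \<noteq> 0" "\<And>a. c * s' a = (\<Sum>j\<in>I. d j * v' j a)"
      | (fin) "finite {t. \<exists>d. \<forall>a. poly (s' a) t = (\<Sum>j\<in>I. d j * poly (v' j a) t)}"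
      using insert.IH[of s' v'] by blast
    then show ?thesis
    proof cases
      case rel
      define e where "e j = (if j = i then c * s b - (\<Sum>j\<in>I. d j * v j b) else d j * v i b)" for j
      have "c * v i b * s a = (\<Sum>j\<in>insert i I. e j * v j a)" for a
      proof -
        have "(\<Sum>j\<in>insert i I. e j * v j a)
            = (c * s b - (\<Sum>j\<in>I. d j * v j b)) * v i a + (\<Sum>j\<in>I. d j * v i b * v j a)"
          using insert.hyps by (subst sum.insert) (auto simp: e_def intro!: sum.cong)
        also have "\<dots> = c * s b * v i a + (\<Sum>j\<in>I. d j * v' j a)"
          by (simp add: v'_def sum_distrib_left sum_subtractf algebra_simps)
        also have "\<dots> = c * v i b * s a"
          unfolding rel(2)[symmetric] by (simp add: s'_def algebra_simps)
        finally show ?thesis ..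
      qed
      then show ?thesis using b rel(1) by (intro disjI1 exI[of _ "c * v i b"]) auto
    next
      case fin
      \<comment> \<open>No pivot is inverted, so the inclusion also covers those \<open>t\<close> at
        which \<open>v i b\<close> vanishes.\<close>
      have "{t. \<exists>d. \<forall>a. poly (s a) t = (\<Sum>j\<in>insert i I. d j * poly (v j a) t)}
          \<subseteq> {t. \<exists>d. \<forall>a. poly (s' a) t = (\<Sum>j\<in>I. d j * poly (v' j a) t)}"
      proof clarify
        fix t d assume d: "\<forall>a. poly (s a) t = (\<Sum>j\<in>insert i I. d j * poly (v j a) t)"
        have "poly (s' a) t = (\<Sum>j\<in>I. d j * poly (v' j a) t)" for a
          using insert.hyps unfolding s'_def v'_def
          by (simp add: d sum_distrib_left sum_subtractf algebra_simps)
        then show "\<exists>d. \<forall>a. poly (s' a) t = (\<Sum>j\<in>I. d j * poly (v' j a) t)" by blast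
      qed
      then show ?thesis using fin finite_subset by blast
    qed
  qed
qed

lemma infinite_field_nonroot:
  fixes f :: "nat \<Rightarrow> 'k::field"
  assumes "infinite (UNIV :: 'k set)" "i \<le> m" "f i \<noteq> 0"
  obtains t where "(\<Sum>i\<le>m. f i * t ^ i) \<noteq> 0"
proof -
  define p where "p = (\<Sum>i\<le>m. Polynomial.monom (f i) i)"
  have "poly.coeff p i = f i"
    using assms(2) by (simp add: p_def coeff_sum if_distrib cong: if_cong)
  then have "p \<noteq> 0" using assms(3) by auto
  then have "finite {t. poly p t = 0}" by (rule poly_roots_finite)
  then obtain t where "poly p t \<noteq> 0"
    using assms(1) by (metis (mono_tags, lifting) UNIV_eq_I mem_Collect_eq)
  then show ?thesis
    by (intro that[of t]) (simp add: p_def poly_sum poly_monom)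
qed

section \<open>Monomials and monomial ideals\<close>

type_synonym expo = "nat \<times> nat \<times> nat"

abbreviation coef :: "'k::field poly3 \<Rightarrow> expo \<Rightarrow> 'k" where
  "coef \<equiv> Poly_Mapping.lookup"

abbreviation supp :: "'k::field poly3 \<Rightarrow> expo set" where
  "supp \<equiv> Poly_Mapping.keys"

definition mon :: "expo \<Rightarrow> 'k::field poly3" where
  "mon u = Poly_Mapping.single u 1"

lemma mon_0: "mon 0 = 1"
  by (simp add: mon_def)

lemma mon_add: "mon (u + v) = mon u * mon v"
  by (simp add: mon_def mult_single)

lemma mon_power: "mon (i, 0, 0) = X ^ i" "mon (0, i, 0) = Y ^ i" "mon (0, 0, i) = Z ^ i"
proof -
  have s: "mon (Suc i, 0, 0) = X * mon (i, 0, 0)" "mon (0, Suc i, 0) = Y * mon (0, i, 0)"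
    "mon (0, 0, Suc i) = Z * mon (0, 0, i)" for i
    by (simp_all add: mon_def X_def Y_def Z_def mult_single)
  have z: "mon (0, 0, 0) = 1" using mon_0 by (simp add: zero_prod_def)
  show "mon (i, 0, 0) = X ^ i" by (induction i) (simp_all add: s z)
  show "mon (0, i, 0) = Y ^ i" by (induction i) (simp_all add: s z)
  show "mon (0, 0, i) = Z ^ i" by (induction i) (simp_all add: s z)
qed

lemma mon_monomial: "X ^ i * Y ^ j * Z ^ l = mon (i, j, l)"
  by (simp add: mon_power[symmetric] mon_add[symmetric])

lemma coef_mon: "coef (mon u) v = (if u = v then 1 else 0)"
  by (simp add: mon_def lookup_single when_def)

lemma supp_mon [simp]: "supp (mon u) = {u}"
  by (simp add: mon_def)

lemma coef_Const_mult [simp]: "coef (Const c * f) u = c * coef f u"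
  by (simp add: Const_def mult_map_scale_conv_mult[symmetric] Poly_Mapping.map.rep_eq when_def)

lemma supp_Const_mult: "supp (Const c * f) \<subseteq> supp f"
  by (auto simp: in_keys_iff)

lemma Const_0 [simp]: "Const 0 = 0" and Const_1 [simp]: "Const 1 = 1"
  and Const_add: "Const (c + d) = Const c + Const d"
  and Const_mult: "Const (c * d) = Const c * Const d"
  by (simp_all add: Const_def single_add mult_single)

lemma Const_power: "Const (c ^ m) = Const c ^ m"
  by (induction m) (simp_all add: Const_mult)

lemma Const_uminus: "Const (- c) = - Const c"
  by (simp add: Const_def single_uminus)

lemma coef_mon_mult: "coef (mon u * f) (u + v) = coef f v"
  by (simp add: mon_def lookup_mult lookup_single when_mult)

lemma supp_mult_subset: "w \<in> supp (f * g) \<Longrightarrow> \<exists>u\<in>supp f. \<exists>v\<in>supp g. w = u + v"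
  using keys_mult[of f g] by blast

lemma coef_mon_mult_notin: "(\<And>v. w \<noteq> u + v) \<Longrightarrow> coef (mon u * f) w = 0"
  using supp_mult_subset[of w "mon u" f] by (auto simp: in_keys_iff[of w])

lemma supp_mon_mult: "supp (mon u * f) = (\<lambda>v. u + v) ` supp f"
proof
  show "supp (mon u * f) \<subseteq> (\<lambda>v. u + v) ` supp f"
    using supp_mult_subset by fastforce
  show "(\<lambda>v. u + v) ` supp f \<subseteq> supp (mon u * f)"
    by (auto simp: in_keys_iff coef_mon_mult)
qed

lemma poly3_sum_monomials: "f = (\<Sum>u\<in>supp f. Const (coef f u) * mon u)"
  by (rule poly_mapping_eqI)
    (simp add: lookup_sum coef_mon if_distrib in_keys_iff cong: if_cong)

lemma ideal_subspace_supp: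
  assumes "\<And>u v. u \<in> U \<Longrightarrow> v + u \<in> U"
  shows "ideal.subspace {f :: 'k::field poly3. supp f \<subseteq> U}"
  unfolding ideal.subspace_def
proof (intro conjI ballI allI)
  fix f g :: "'k poly3" assume fg: "f \<in> {f. supp f \<subseteq> U}" "g \<in> {f. supp f \<subseteq> U}"
  show "f + g \<in> {f. supp f \<subseteq> U}" using keys_add[of f g] fg by blast
next
  fix c f :: "'k poly3" assume "f \<in> {f. supp f \<subseteq> U}"
  then show "c * f \<in> {f. supp f \<subseteq> U}"
    using assms by (metis (no_types, lifting) mem_Collect_eq subset_iff supp_mult_subset)
qed simp

lemma mem_monomial_ideal_iff:
  "f \<in> ideal.span (mon ` M) \<longleftrightarrow> (\<forall>u\<in>supp f. \<exists>m\<in>M. \<exists>v. u = v + m)"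
proof
  assume f: "f \<in> ideal.span (mon ` M)"
  let ?U = "{u. \<exists>m\<in>M. \<exists>v. u = v + m}"
  have "ideal.span (mon ` M) \<subseteq> {f. supp f \<subseteq> ?U}"
  proof (rule ideal.span_minimal)
    have "m \<in> ?U" if "m \<in> M" for m
      using that add_0_left[of m, symmetric] by blast
    then show "mon ` M \<subseteq> {f. supp f \<subseteq> ?U}" by auto
    show "ideal.subspace {f. supp f \<subseteq> ?U}"
    proof (rule ideal_subspace_supp)
      fix u v assume "u \<in> ?U"
      then obtain m w where m: "m \<in> M" "u = w + m" by blast
      then have "v + u = (v + w) + m" by (simp only: add.assoc)
      then show "v + u \<in> ?U" using m(1) by blast
    qed
  qed
  then show "\<forall>u\<in>supp f. \<exists>m\<in>M. \<exists>v. u = v + m" using f by auto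
next
  assume *: "\<forall>u\<in>supp f. \<exists>m\<in>M. \<exists>v. u = v + m"
  have "Const (coef f u) * mon u \<in> ideal.span (mon ` M)" if "u \<in> supp f" for u
  proof -
    from bspec[OF * that] obtain m v where m: "m \<in> M" "u = v + m" by (elim bexE exE)
    have "mon m \<in> ideal.span (mon ` M)" using m(1) by (intro ideal.span_base imageI)
    then have "(Const (coef f u) * mon v) * mon m \<in> ideal.span (mon ` M)"
      by (rule ideal.span_scale)
    then show ?thesis by (simp only: m(2) mon_add mult.assoc)
  qed
  then have "(\<Sum>u\<in>supp f. Const (coef f u) * mon u) \<in> ideal.span (mon ` M)"
    by (intro ideal.span_sum)
  then show "f \<in> ideal.span (mon ` M)" by (simp only: poly3_sum_monomials[symmetric])
qed

text \<open>For \<open>A\<close> of fixed total degree this extracts a homogeneous component; for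
  \<open>A = Sx d\<close> below it is the projection of \<open>R\<close> onto a graded piece of
  \<open>S\<close>, which yields leading forms.\<close>

definition prj :: "expo set \<Rightarrow> 'k::field poly3 \<Rightarrow> 'k poly3" where
  "prj A f = (\<Sum>u\<in>supp f \<inter> A. Const (coef f u) * mon u)"

lemma coef_prj [simp]: "coef (prj A f) u = (if u \<in> A then coef f u else 0)"
  by (simp add: prj_def lookup_sum coef_mon if_distrib in_keys_iff cong: if_cong)

lemma supp_prj: "supp (prj A f) = supp f \<inter> A"
  by (auto simp: in_keys_iff split: if_splits)

lemma prj_add: "prj A (f + g) = prj A f + prj A g"
  by (rule poly_mapping_eqI) (simp add: lookup_add)

lemma prj_Const_mult: "prj A (Const c * f) = Const c * prj A f"
  by (rule poly_mapping_eqI) simp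

lemma prj_id: "supp f \<subseteq> A \<Longrightarrow> prj A f = f"
  by (rule poly_mapping_eqI) (auto simp: in_keys_iff)

lemma prj_zero: "supp f \<inter> A = {} \<Longrightarrow> prj A f = 0"
  by (rule poly_mapping_eqI) (auto simp: in_keys_iff)

lemma prj_split: "f = prj A f + prj (- A) f"
  by (rule poly_mapping_eqI) (simp add: lookup_add)

text \<open>Splitting \<open>f\<close> along \<open>A'\<close> splits the product into a part
  supported in \<open>A\<close> and a part supported outside, since a shift by an exponent of
  \<open>B\<close> respects both pieces.\<close>

lemma prj_mult:
  assumes "supp g \<subseteq> B" "\<And>u v. v \<in> B \<Longrightarrow> u + v \<in> A \<longleftrightarrow> u \<in> A'"
  shows "prj A (f * g) = prj A' f * g"
proof -
  have "w \<in> A" if "w \<in> supp (prj A' f * g)" for w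
    using supp_mult_subset[OF that] assms by (metis Int_iff subset_iff supp_prj)
  then have 1: "supp (prj A' f * g) \<subseteq> A" by blast
  have "w \<notin> A" if "w \<in> supp (prj (- A') f * g)" for w
    using supp_mult_subset[OF that] assms by (metis Int_iff Compl_iff subset_iff supp_prj)
  then have 2: "supp (prj (- A') f * g) \<inter> A = {}" by blast
  have "prj A (f * g) = prj A (prj A' f * g) + prj A (prj (- A') f * g)"
    by (subst prj_split[of f A']) (simp add: distrib_right prj_add)
  then show ?thesis using prj_id[OF 1] prj_zero[OF 2] by simp
qed

section \<open>Systems of parameters in the weighted subring\<close>

definition nzd :: "'a::comm_ring_1 set \<Rightarrow> 'a \<Rightarrow> bool" where
  "nzd A r \<longleftrightarrow> (\<forall>f. r * f \<in> A \<longrightarrow> f \<in> A)"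

lemma nzd_power: "nzd A r \<Longrightarrow> r ^ m * f \<in> A \<Longrightarrow> f \<in> A"
  by (induction m) (auto simp: nzd_def mult.assoc)

text \<open>The case \<open>a = 1\<close> is built in: \<open>S\<close> is
  \<open>k[x, y^b, z^c]\<close>.\<close>

locale weights =
  fixes n b c :: nat
  assumes n_pos: "n > 0" and b_dvd: "b dvd n" and c_dvd: "c dvd n"
begin

text \<open>One more than the socle degree \<open>3n - 1 - b - c\<close> of \<open>S\<close> modulo
  a regular sequence of three forms of degree \<open>n\<close>, the generators of \<open>S\<close>
  having degrees 1, \<open>b\<close>, \<open>c\<close>.\<close>

definition D :: nat where "D = 3 * n - b - c"

definition Sx :: "nat \<Rightarrow> expo set" where
  "Sx d = {(i, j, l). b dvd j \<and> c dvd l \<and> i + j + l = d}"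

definition Sd :: "nat \<Rightarrow> 'k::field poly3 set" where
  "Sd d = {f. supp f \<subseteq> Sx d}"

lemma b_pos: "b > 0" and b_le: "b \<le> n" and c_pos: "c > 0" and c_le: "c \<le> n"
  using n_pos b_dvd c_dvd by (auto intro: dvd_imp_le intro!: Nat.gr0I)

lemma n_le_D: "n \<le> D"
  using b_le c_le by (simp add: D_def)

lemma Sx_add: "u \<in> Sx d \<Longrightarrow> v \<in> Sx e \<Longrightarrow> u + v \<in> Sx (d + e)"
  by (auto simp: Sx_def)

lemma Sx_add_iff: "d \<ge> e \<Longrightarrow> v \<in> Sx e \<Longrightarrow> u + v \<in> Sx d \<longleftrightarrow> u \<in> Sx (d - e)"
  by (auto simp: Sx_def dvd_add_left_iff)

lemma finite_Sx: "finite (Sx d)"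
  by (rule finite_subset[of _ "{..d} \<times> {..d} \<times> {..d}"]) (auto simp: Sx_def)

lemma Sd_mult:
  assumes "f \<in> Sd d" "g \<in> Sd e" shows "f * g \<in> Sd (d + e)"
proof -
  have "w \<in> Sx (d + e)" if "w \<in> supp (f * g)" for w
  proof -
    from supp_mult_subset[OF that] obtain u v
      where "u \<in> supp f" "v \<in> supp g" and w: "w = u + v" by (elim bexE)
    then have "u \<in> Sx d" "v \<in> Sx e" using assms by (auto simp: Sd_def)
    then show ?thesis unfolding w by (rule Sx_add)
  qed
  then show ?thesis by (auto simp: Sd_def)
qed

lemma Sd_Const_mult: "f \<in> Sd d \<Longrightarrow> Const t * f \<in> Sd d"
  using supp_Const_mult[of t f] by (auto simp: Sd_def)

lemma Sd_add: "f \<in> Sd d \<Longrightarrow> g \<in> Sd d \<Longrightarrow> f + g \<in> Sd d"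
  using keys_add[of f g] by (auto simp: Sd_def)

lemma Sd_0: "0 \<in> Sd d"
  by (simp add: Sd_def)

lemma Sd_sum: "(\<And>i. i \<in> I \<Longrightarrow> f i \<in> Sd d) \<Longrightarrow> sum f I \<in> Sd d"
  by (induction I rule: infinite_finite_induct) (simp_all add: Sd_0 Sd_add)

lemma Sd_power: "f \<in> Sd d \<Longrightarrow> f ^ m \<in> Sd (m * d)"
proof (induction m)
  case 0
  then show ?case by (simp add: Sd_def Sx_def zero_prod_def)
next
  case (Suc m)
  then show ?case using Sd_mult[of f d "f ^ m" "m * d"] by simp
qed

lemma prj_Sd: "prj (Sx d) f \<in> Sd d"
  by (simp add: Sd_def supp_prj)

lemma prj_Sd_id: "f \<in> Sd d \<Longrightarrow> prj (Sx d) f = f"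
  by (simp add: Sd_def prj_id)

text \<open>The projection of \<open>R\<close> onto \<open>S\<close> is linear over
  \<open>S\<close>, because an exponent of \<open>S\<close> cancels in the divisibility conditions.
  This turns relations in \<open>R\<close> into relations with coefficients in
  \<open>S\<close>.\<close>

lemma prj_mult_Sd: "e \<le> d \<Longrightarrow> g \<in> Sd e \<Longrightarrow> prj (Sx d) (f * g) = prj (Sx (d - e)) f * g"
  by (rule prj_mult[where B = "Sx e"]) (simp_all add: Sd_def Sx_add_iff)

definition sat :: "'k::field poly3 \<Rightarrow> 'k poly3 \<Rightarrow> 'k poly3 \<Rightarrow> bool" where
  "sat p q r \<longleftrightarrow> (\<forall>d\<ge>D. Sd d \<subseteq> ideal.span {p, q, r})"

context
  fixes p q r :: "'k::field poly3"
  assumes Sd_pqr: "p \<in> Sd n" "q \<in> Sd n" "r \<in> Sd n" and sat: "sat p q r"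
begin

lemma sat_quotient:
  assumes "d \<ge> D" "f \<in> Sd d"
  shows "\<exists>s\<in>Sd (d - n). f - s * r \<in> ideal.span {p, q}"
proof -
  have "f \<in> ideal.span {p, q, r}"
    using sat assms unfolding sat_def by blast
  then obtain u v w where "f = u * p + v * q + w * r"
    unfolding ideal_span_triple_iff by blast
  then have "prj (Sx d) f = prj (Sx d) (u * p) + prj (Sx d) (v * q) + prj (Sx d) (w * r)"
    by (simp add: prj_add)
  then have "f - prj (Sx (d - n)) w * r = prj (Sx (d - n)) u * p + prj (Sx (d - n)) v * q"
    using n_le_D assms by (simp add: prj_Sd_id[OF assms(2)] prj_mult_Sd[OF _ Sd_pqr(1)]
        prj_mult_Sd[OF _ Sd_pqr(2)] prj_mult_Sd[OF _ Sd_pqr(3)])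
  then show ?thesis using prj_Sd ideal_span_doubleton_iff by metis
qed

lemma sat_quotient_power:
  assumes "d + n \<ge> D" "f \<in> Sd (d + j * n)"
  shows "\<exists>s\<in>Sd d. f - r ^ j * s \<in> ideal.span {p, q}"
  using assms(2)
proof (induction j arbitrary: f)
  case 0
  then show ?case by (auto intro!: bexI[of _ f] ideal.span_zero)
next
  case (Suc j)
  obtain s where s: "s \<in> Sd (d + j * n)" "f - s * r \<in> ideal.span {p, q}"
    using sat_quotient[OF _ Suc.prems] assms(1) by auto
  obtain s' where s': "s' \<in> Sd d" "s - r ^ j * s' \<in> ideal.span {p, q}"
    using Suc.IH[OF s(1)] by blast
  have "f - r ^ Suc j * s' = (f - s * r) + r * (s - r ^ j * s')"
    by (simp add: algebra_simps)
  also have "\<dots> \<in> ideal.span {p, q}"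
    by (intro ideal.span_add ideal.span_scale s(2) s'(2))
  finally show ?case using s'(1) by blast
qed

text \<open>Modulo \<open>(p, q)\<close> the graded pieces have bounded dimension, since they are eventually
  multiples of a power of \<open>r\<close>; the \<open>m + 1\<close> monomials of degree \<open>m\<close> in two forms outgrow the bound.\<close>

lemma binary_relation:
  assumes "g \<in> Sd n" "h \<in> Sd n"
  obtains m e where "\<exists>i\<le>m. e i \<noteq> 0"
    "(\<Sum>i\<le>m. Const (e i) * (g ^ i * h ^ (m - i))) \<in> ideal.span {p, q}"
proof -
  define j where "j = card (Sx (3 * n))"
  \<comment> \<open>The degree \<open>m n = 3n + j n\<close> allows \<open>r^j\<close> to be divided
    out with quotients in \<open>Sd (3 * n)\<close>, a space of dimension
    \<open>j < m + 1\<close>.\<close>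
  define m where "m = j + 3"
  have "\<exists>s\<in>Sd (3 * n). g ^ i * h ^ (m - i) - r ^ j * s \<in> ideal.span {p, q}" if "i \<le> m" for i
  proof (rule sat_quotient_power)
    have "i * n + (m - i) * n = 3 * n + j * n"
      using that by (simp add: m_def add_mult_distrib[symmetric])
    then show "g ^ i * h ^ (m - i) \<in> Sd (3 * n + j * n)"
      using Sd_mult[OF Sd_power[OF assms(1), of i] Sd_power[OF assms(2), of "m - i"]] by simp
  qed (simp add: D_def)
  then obtain s where s: "\<And>i. i \<le> m \<Longrightarrow> s i \<in> Sd (3 * n)"
      "\<And>i. i \<le> m \<Longrightarrow> g ^ i * h ^ (m - i) - r ^ j * s i \<in> ideal.span {p, q}"
    by metis
  obtain e where e: "\<exists>i\<in>{..m}. e i \<noteq> 0"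
    "\<And>a. a \<in> Sx (3 * n) \<Longrightarrow> (\<Sum>i\<le>m. e i * coef (s i) a) = 0"
    using linear_dependence_idom[of "Sx (3 * n)" "{..m}" "\<lambda>i. coef (s i)"]
    by (auto simp: finite_Sx m_def j_def)
  have *: "(\<Sum>i\<le>m. Const (e i) * s i) = 0"
  proof (rule poly_mapping_eqI)
    fix a
    show "coef (\<Sum>i\<le>m. Const (e i) * s i) a = coef 0 a"
    proof (cases "a \<in> Sx (3 * n)")
      case True
      then show ?thesis using e(2) by (simp add: lookup_sum)
    next
      case False
      then have "coef (s i) a = 0" if "i \<le> m" for i
        using s(1)[OF that] by (auto simp: Sd_def in_keys_iff)
      then show ?thesis by (simp add: lookup_sum)
    qed
  qed
  have "(\<Sum>i\<le>m. Const (e i) * (g ^ i * h ^ (m - i)))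
      = (\<Sum>i\<le>m. Const (e i) * (g ^ i * h ^ (m - i) - r ^ j * s i)) + r ^ j * (\<Sum>i\<le>m. Const (e i) * s i)"
    by (simp add: sum_distrib_left right_diff_distrib sum_subtractf mult.left_commute)
  also have "\<dots> \<in> ideal.span {p, q}"
    unfolding * by (auto intro!: ideal.span_sum ideal.span_scale s(2))
  finally show thesis using e(1) that by blast
qed

text \<open>Modulo \<open>(p, q)\<close> the power \<open>r^m\<close> is a multiple of
  \<open>w\<close>, so it kills whatever \<open>w\<close> kills.\<close>

lemma exchange_nzd:
  assumes "nzd (ideal.span {p, q}) r" "r ^ m \<in> ideal.span {p, q, w}"
  shows "nzd (ideal.span {p, q}) w"
  unfolding nzd_def
proof (intro allI impI)
  fix f assume wf: "w * f \<in> ideal.span {p, q}"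
  obtain u v s where eq: "r ^ m = u * p + v * q + s * w"
    using assms(2) by (auto simp: ideal_span_triple_iff)
  have pq: "u * p + v * q \<in> ideal.span {p, q}"
    unfolding ideal_span_doubleton_iff by blast
  have "r ^ m * f = s * (w * f) + f * (u * p + v * q)"
    unfolding eq by (simp add: algebra_simps)
  also have "\<dots> \<in> ideal.span {p, q}"
    by (intro ideal.span_add ideal.span_scale wf pq)
  finally show "f \<in> ideal.span {p, q}" using nzd_power[OF assms(1)] by blast
qed

text \<open>A homogeneous relation between \<open>r\<close> and \<open>w\<close> gives
  \<open>r^(k+1) = w Q\<close> modulo \<open>(p, q)\<close>. Writing \<open>f = s r\<close> and
  \<open>Q s = r^k s'\<close> there, one gets \<open>r^k f = r^k w s'\<close>, and
  \<open>r^k\<close> cancels.\<close>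

lemma exchange_sat:
  assumes "nzd (ideal.span {p, q}) r" "nzd (ideal.span {p, q}) w" "w \<in> Sd n"
  shows "sat p q w"
proof -
  let ?A = "ideal.span {p, q}"
  obtain m e where e: "\<exists>i\<le>m. e i \<noteq> 0" "(\<Sum>i\<le>m. Const (e i) * (r ^ i * w ^ (m - i))) \<in> ?A"
    using binary_relation[OF Sd_pqr(3) assms(3)] by blast
  \<comment> \<open>The highest power of \<open>r\<close> that occurs; all terms then share the
    factor \<open>w^(m-k)\<close>, which cancels and leaves a scalar multiple of \<open>r^k\<close>
    as leading term.\<close>
  define k where "k = (GREATEST i. i \<le> m \<and> e i \<noteq> 0)"
  have k: "k \<le> m" "e k \<noteq> 0" and k_max: "\<And>i. i \<le> m \<Longrightarrow> k < i \<Longrightarrow> e i = 0"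
    using GreatestI_ex_nat[of "\<lambda>i. i \<le> m \<and> e i \<noteq> 0" m] Greatest_le_nat[of "\<lambda>i. i \<le> m \<and> e i \<noteq> 0" _ m] e(1)
    unfolding k_def by (auto simp: not_less[symmetric])
  have "(\<Sum>i\<le>m. Const (e i) * (r ^ i * w ^ (m - i))) = (\<Sum>i\<le>k. Const (e i) * (r ^ i * w ^ (m - i)))"
    using k(1) k_max by (intro sum.mono_neutral_right) auto
  also have "\<dots> = w ^ (m - k) * (\<Sum>i\<le>k. Const (e i) * (r ^ i * w ^ (k - i)))"
    unfolding sum_distrib_left
  proof (rule sum.cong[OF refl])
    fix i assume "i \<in> {..k}"
    then have "m - i = (m - k) + (k - i)" using k(1) by simp
    then have "w ^ (m - i) = w ^ (m - k) * w ^ (k - i)" by (simp only: power_add)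
    then show "Const (e i) * (r ^ i * w ^ (m - i)) = w ^ (m - k) * (Const (e i) * (r ^ i * w ^ (k - i)))"
      by (simp add: ac_simps)
  qed
  finally have "w ^ (m - k) * (\<Sum>i\<le>k. Const (e i) * (r ^ i * w ^ (k - i))) \<in> ?A"
    using e(2) by (simp only:)
  then have "(\<Sum>i\<le>k. Const (e i) * (r ^ i * w ^ (k - i))) \<in> ?A"
    by (rule nzd_power[OF assms(2)])
  \<comment> \<open>The extra factor \<open>r\<close> makes \<open>Q\<close> below a form of degree
    \<open>k n\<close> for every \<open>k\<close>, including \<open>k = 0\<close>, where
    \<open>Q\<close> is zero.\<close>
  then have mem: "Const (inverse (e k)) * r * (\<Sum>i\<le>k. Const (e i) * (r ^ i * w ^ (k - i))) \<in> ?A"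
    by (rule ideal.span_scale)
  define Q where "Q = - Const (inverse (e k)) * (\<Sum>i<k. Const (e i) * (r ^ Suc i * w ^ (k - Suc i)))"
  have "w * (\<Sum>i<k. Const (e i) * (r ^ Suc i * w ^ (k - Suc i))) = r * (\<Sum>i<k. Const (e i) * (r ^ i * w ^ (k - i)))"
    unfolding sum_distrib_left
  proof (rule sum.cong[OF refl])
    fix i assume "i \<in> {..<k}"
    then have "w ^ (k - i) = w * w ^ (k - Suc i)" by (simp flip: power_Suc add: Suc_diff_Suc)
    then show "w * (Const (e i) * (r ^ Suc i * w ^ (k - Suc i))) = r * (Const (e i) * (r ^ i * w ^ (k - i)))"
      by (simp add: ac_simps)
  qed
  then have wQ: "w * Q = - Const (inverse (e k)) * (r * (\<Sum>i<k. Const (e i) * (r ^ i * w ^ (k - i))))"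
    unfolding Q_def mult.left_commute[of w] by (rule arg_cong)
  let ?S = "\<Sum>i<k. Const (e i) * (r ^ i * w ^ (k - i))"
  have "Const (inverse (e k)) * r * (?S + Const (e k) * r ^ k) = Const (inverse (e k) * e k) * r ^ Suc k - w * Q"
    unfolding wQ Const_mult by (simp add: distrib_left mult_ac)
  moreover have "(\<Sum>i\<le>k. Const (e i) * (r ^ i * w ^ (k - i))) = ?S + Const (e k) * r ^ k"
    unfolding lessThan_Suc_atMost[symmetric] by simp
  ultimately have "Const (inverse (e k) * e k) * r ^ Suc k - w * Q \<in> ?A"
    using mem by (simp only:)
  moreover have "Const (inverse (e k) * e k) = 1" using k(2) by simp
  ultimately have rQ: "r ^ Suc k - w * Q \<in> ?A"
    by (simp only: mult_1_left)
  have "r ^ Suc i * w ^ (k - Suc i) \<in> Sd (k * n)" if "i < k" for i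
    using Sd_mult[OF Sd_power[OF Sd_pqr(3), of "Suc i"] Sd_power[OF assms(3), of "k - Suc i"]] that
    by (simp add: add_mult_distrib[symmetric] del: mult_Suc)
  then have Q: "Q \<in> Sd (k * n)"
    unfolding Q_def Const_uminus[symmetric] by (intro Sd_Const_mult Sd_sum) auto
  show ?thesis
    unfolding sat_def
  proof (intro allI impI subsetI)
    fix d and f :: "'k poly3"
    assume d: "d \<ge> D" and f: "f \<in> Sd d"
    obtain s where s: "s \<in> Sd (d - n)" "f - s * r \<in> ?A"
      using sat_quotient[OF d f] by blast
    have "Q * s \<in> Sd ((d - n) + k * n)"
      using Sd_mult[OF Q s(1)] by (simp add: add.commute)
    then obtain s' where s': "s' \<in> Sd (d - n)" "Q * s - r ^ k * s' \<in> ?A"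
      using sat_quotient_power[of "d - n" "Q * s" k] d n_le_D by auto
    have "r ^ k * (f - w * s') = r ^ k * (f - s * r) + s * (r ^ Suc k - w * Q) + w * (Q * s - r ^ k * s')"
      by (simp add: algebra_simps)
    also have "\<dots> \<in> ?A"
      by (intro ideal.span_add ideal.span_scale s(2) s'(2) rQ)
    finally have "f - w * s' \<in> ?A" using nzd_power[OF assms(1)] by blast
    then obtain u v where "f - w * s' = u * p + v * q" by (auto simp: ideal_span_doubleton_iff)
    then have "f = u * p + v * q + s' * w" by (simp add: algebra_simps)
    then show "f \<in> ideal.span {p, q, w}" by (auto simp: ideal_span_triple_iff)
  qed
qed

text \<open>A binary relation between two forms \<open>w\<close> and \<open>g\<close> becomes monic in \<open>w\<close> after replacing \<open>g\<close>
  by \<open>g - t w\<close> for a suitable scalar \<open>t\<close>, so that \<open>w\<close> can be dropped from the generators.\<close>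

lemma select_parameter:
  assumes inf: "infinite (UNIV :: 'k set)"
    and V: "V \<subseteq> Sd n" "0 \<in> V" "\<And>f g. f \<in> V \<Longrightarrow> g \<in> V \<Longrightarrow> f + g \<in> V" "\<And>t f. f \<in> V \<Longrightarrow> Const t * f \<in> V"
    and r: "r ^ M \<in> ideal.span V"
  obtains w m where "w \<in> V" "r ^ m \<in> ideal.span {p, q, w}"
proof -
  have *: "\<exists>w\<in>V. \<exists>m. r ^ m \<in> ideal.span {p, q, w}"
    if "finite F" "F \<subseteq> V" "w \<in> V" "r ^ m \<in> ideal.span ({p, q, w} \<union> F)" for F w m
    using that
  proof (induction F arbitrary: w m rule: finite_induct)
    case empty
    then show ?case by auto
  next
    case (insert g F)
    obtain m' e where e: "\<exists>i\<le>m'. e i \<noteq> 0"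
        "(\<Sum>i\<le>m'. Const (e i) * (g ^ i * w ^ (m' - i))) \<in> ideal.span {p, q}"
      using binary_relation[of g w] insert.prems V(1) by blast
    \<comment> \<open>After substituting \<open>g = t w + w'\<close>, this sum is the coefficient of
      \<open>w^m'\<close> modulo \<open>w'\<close>; being nonzero, it puts \<open>w^m'\<close> into
      \<open>(p, q, w')\<close>.\<close>
    obtain t where t: "(\<Sum>i\<le>m'. e i * t ^ i) \<noteq> 0"
      using e(1) infinite_field_nonroot[OF inf] by metis
    define w' where "w' = g + Const (- t) * w"
    have w'V: "w' \<in> V" using insert.prems V(3,4) by (simp add: w'_def)
    have "w' dvd g ^ i - (Const t * w) ^ i" for i
      unfolding w'_def Const_uminus
      using power_diff_sumr2[of g i "Const t * w"] by (auto simp: dvd_def)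
    then have "w' dvd (\<Sum>i\<le>m'. Const (e i) * ((g ^ i - (Const t * w) ^ i) * w ^ (m' - i)))"
      by (intro dvd_sum dvd_mult dvd_mult2)
    also have "(\<Sum>i\<le>m'. Const (e i) * ((g ^ i - (Const t * w) ^ i) * w ^ (m' - i)))
        = (\<Sum>i\<le>m'. Const (e i) * (g ^ i * w ^ (m' - i))) - (\<Sum>i\<le>m'. Const (e i * t ^ i) * w ^ m')"
      unfolding sum_subtractf[symmetric]
    proof (rule sum.cong[OF refl])
      fix i assume "i \<in> {..m'}"
      then have "w ^ m' = w ^ i * w ^ (m' - i)" by (simp flip: power_add)
      then show "Const (e i) * ((g ^ i - (Const t * w) ^ i) * w ^ (m' - i)) =
          Const (e i) * (g ^ i * w ^ (m' - i)) - Const (e i * t ^ i) * w ^ m'"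
        by (simp add: Const_mult Const_power power_mult_distrib algebra_simps)
    qed
    also have "(\<Sum>i\<le>m'. Const (e i * t ^ i) * w ^ m') = Const (\<Sum>i\<le>m'. e i * t ^ i) * w ^ m'"
      unfolding sum_distrib_right[symmetric]
      by (rule arg_cong[where f = "\<lambda>x. x * w ^ m'"]) (induction m', simp_all add: Const_add)
    finally obtain u where "(\<Sum>i\<le>m'. Const (e i) * (g ^ i * w ^ (m' - i)))
        - Const (\<Sum>i\<le>m'. e i * t ^ i) * w ^ m' = w' * u" by (auto simp: dvd_def)
    then have "Const (\<Sum>i\<le>m'. e i * t ^ i) * w ^ m'
        = (\<Sum>i\<le>m'. Const (e i) * (g ^ i * w ^ (m' - i))) - u * w'" by (simp add: algebra_simps)
    also have "\<dots> \<in> ideal.span {p, q, w'}"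
      by (intro ideal.span_diff ideal.span_scale subsetD[OF ideal.span_mono e(2)])
        (auto intro: ideal.span_base)
    finally have "Const (inverse (\<Sum>i\<le>m'. e i * t ^ i)) * (Const (\<Sum>i\<le>m'. e i * t ^ i) * w ^ m')
        \<in> ideal.span {p, q, w'}" by (rule ideal.span_scale)
    then have wm': "w ^ m' \<in> ideal.span {p, q, w'}"
      using t by (simp add: mult.assoc[symmetric] Const_mult[symmetric])
    let ?B = "{p, q, w'} \<union> F"
    have "g = w' + Const t * w" by (simp add: w'_def Const_uminus)
    then have "g \<in> ideal.span (insert w ?B)"
      by (metis UnI1 ideal.span_add ideal.span_base ideal.span_scale insertI1 insertI2)
    then have "{p, q, w} \<union> insert g F \<subseteq> ideal.span (insert w ?B)"
      by (auto intro: ideal.span_base)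
    then have "ideal.span ({p, q, w} \<union> insert g F) \<subseteq> ideal.span (insert w ?B)"
      by (rule ideal.span_minimal) simp
    then obtain s y where y: "y \<in> ideal.span ?B" "r ^ m = s * w + y"
      using insert.prems(3) ideal_span_insert_iff by blast
    \<comment> \<open>Modulo \<open>y\<close> the power is \<open>s^m' w^m'\<close>, which already
      lies in the smaller ideal; raising to the power \<open>m'\<close> thus eliminates
      \<open>w\<close>.\<close>
    have "y dvd (s * w + y) ^ m' - (s * w) ^ m'"
      using power_diff_sumr2[of "s * w + y" m' "s * w"] by (auto simp: dvd_def)
    then obtain z where "(s * w + y) ^ m' - (s * w) ^ m' = y * z" by (auto simp: dvd_def)
    then have "(s * w + y) ^ m' = s ^ m' * w ^ m' + z * y"
      by (simp add: power_mult_distrib algebra_simps)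
    then have "r ^ (m * m') = s ^ m' * w ^ m' + z * y"
      by (simp only: power_mult y(2))
    also have "\<dots> \<in> ideal.span ?B"
      by (intro ideal.span_add ideal.span_scale y(1) subsetD[OF ideal.span_mono wm']) auto
    finally show ?case using insert.IH[of w' "m * m'"] w'V insert.prems by blast
  qed
  obtain F u where F: "finite F" "F \<subseteq> V" and rM: "r ^ M = (\<Sum>a\<in>F. u a * a)"
    using r unfolding ideal.span_explicit by blast
  have F3: "r ^ M \<in> ideal.span F"
    unfolding rM by (intro ideal.span_sum ideal.span_scale ideal.span_base)
  \<comment> \<open>The induction starts from the parameter \<open>w = 0\<close>.\<close>
  have "r ^ M \<in> ideal.span ({p, q, 0} \<union> F)"
    using F3 ideal.span_mono[of F "{p, q, 0} \<union> F"] by blast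
  then show thesis using *[OF F V(2)] that by blast
qed

end

end

section \<open>Exchange of the three pure powers for forms in V\<close>

lemma ideal_span_singleton_iff: "f \<in> ideal.span {a} \<longleftrightarrow> (\<exists>u. f = u * a)"
  by (auto simp: ideal.span_singleton)

lemma nzd_mon:
  assumes "\<And>u w m. m \<in> M \<Longrightarrow> v + u = w + m \<Longrightarrow> \<exists>m\<in>M. \<exists>w. u = w + m"
  shows "nzd (ideal.span (mon ` M)) (mon v)"
  unfolding nzd_def mem_monomial_ideal_iff supp_mon_mult
proof (intro allI impI ballI)
  fix f :: "'a poly3" and u
  assume "\<forall>u\<in>(\<lambda>u. v + u) ` supp f. \<exists>m\<in>M. \<exists>w. u = w + m" "u \<in> supp f"
  from bspec[OF this(1) imageI[OF this(2)]] obtain m w where "m \<in> M" "v + u = w + m"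
    by (elim bexE exE)
  then show "\<exists>m\<in>M. \<exists>w. u = w + m" by (rule assms)
qed

context weights
begin

text \<open>If no exponent reaches \<open>n\<close>, divisibility by \<open>b\<close> and
  \<open>c\<close> leaves at most \<open>n - 1\<close>, \<open>n - b\<close> and
  \<open>n - c\<close>, whose sum is \<open>D - 1\<close>.\<close>

lemma sat_powers: "sat (mon (n, 0, 0)) (mon (0, n, 0)) (mon (0, 0, n))"
  unfolding sat_def
proof (intro allI impI subsetI)
  fix d and f :: "'k::field poly3"
  assume d: "d \<ge> D" and f: "f \<in> Sd d"
  let ?M = "{(n, 0, 0), (0, n, 0), (0, 0, n)} :: expo set"
  have "\<exists>m\<in>?M. \<exists>v. u = v + m" if "u \<in> supp f" for u
  proof -
    obtain i j l where u: "u = (i, j, l)" by (cases u)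
    have *: "b dvd j" "c dvd l" "i + j + l = d"
      using f that u by (auto simp: Sd_def Sx_def)
    have "j + b \<le> n" if "j < n"
      using * that b_dvd by (metis add.commute dvd_add_right_iff dvd_imp_le dvd_minus_self le_add_diff_inverse less_imp_le_nat nat_add_left_cancel_le not_less zero_less_diff)
    moreover have "l + c \<le> n" if "l < n"
      using * that c_dvd by (metis add.commute dvd_add_right_iff dvd_imp_le dvd_minus_self le_add_diff_inverse less_imp_le_nat nat_add_left_cancel_le not_less zero_less_diff)
    ultimately have "i \<ge> n \<or> j \<ge> n \<or> l \<ge> n"
      using *(3) d b_le c_le unfolding D_def by linarith
    then consider "i \<ge> n" | "j \<ge> n" | "l \<ge> n" by blast
    then show ?thesis
    proof cases
      case 1
      then have "u = (i - n, j, l) + (n, 0, 0)" by (simp add: u)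
      then show ?thesis by blast
    next
      case 2
      then have "u = (i, j - n, l) + (0, n, 0)" by (simp add: u)
      then show ?thesis by blast
    next
      case 3
      then have "u = (i, j, l - n) + (0, 0, n)" by (simp add: u)
      then show ?thesis by blast
    qed
  qed
  then have "f \<in> ideal.span (mon ` ?M)"
    unfolding mem_monomial_ideal_iff by (rule ballI)
  then show "f \<in> ideal.span {mon (n, 0, 0), mon (0, n, 0), mon (0, 0, n)}"
    by simp
qed

lemma mon_powers_Sd: "mon (n, 0, 0) \<in> Sd n" "mon (0, n, 0) \<in> Sd n" "mon (0, 0, n) \<in> Sd n"
  using b_dvd c_dvd by (auto simp: Sd_def Sx_def)

text \<open>From \<open>q f = t w\<close> modulo \<open>p\<close>, regularity of \<open>w\<close>
  puts \<open>t\<close> into \<open>(p, q)\<close>, and then \<open>q\<close> cancels modulo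
  \<open>p\<close>. This reorders a regular sequence between two exchanges.\<close>

lemma nzd_swap:
  assumes "nzd (ideal.span {p}) q" "nzd (ideal.span {p, q}) w"
  shows "nzd (ideal.span {p, w}) q"
  unfolding nzd_def
proof (intro allI impI)
  fix f assume "q * f \<in> ideal.span {p, w}"
  then obtain u t where ut: "q * f = u * p + t * w" by (auto simp: ideal_span_doubleton_iff)
  then have "w * t = (- u) * p + f * q" by (simp add: algebra_simps)
  then have "t \<in> ideal.span {p, q}"
    using assms(2) unfolding nzd_def ideal_span_doubleton_iff by blast
  then obtain t1 t2 where t: "t = t1 * p + t2 * q" by (auto simp: ideal_span_doubleton_iff)
  have "q * (f - t2 * w) = (u + t1 * w) * p"
    using ut unfolding t by (simp add: algebra_simps)
  then have "f - t2 * w \<in> ideal.span {p}"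
    using assms(1) unfolding nzd_def ideal_span_singleton_iff by blast
  then obtain g where "f - t2 * w = g * p" by (auto simp: ideal_span_singleton_iff)
  then have "f = g * p + t2 * w" by (simp add: algebra_simps)
  then show "f \<in> ideal.span {p, w}" by (auto simp: ideal_span_doubleton_iff)
qed

text \<open>An element of \<open>(x\<^sup>n, y\<^sup>n\<^sup>k)\<close> for all \<open>k\<close> lies in \<open>(x\<^sup>n)\<close>, which lets a nonzerodivisor modulo
  \<open>(x\<^sup>n, y\<^sup>n)\<close> descend to \<open>(x\<^sup>n)\<close>.\<close>

lemma nzd_descend:
  fixes w :: "'k::field poly3"
  assumes "nzd (ideal.span {mon (n, 0, 0), mon (0, n, 0)}) w"
    and y: "nzd (ideal.span {mon (n, 0, 0)}) (mon (0, n, 0) :: 'k poly3)"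
  shows "nzd (ideal.span {mon (n, 0, 0)}) w"
  unfolding nzd_def
proof (intro allI impI)
  fix s assume s: "w * s \<in> ideal.span {mon (n, 0, 0)}"
  let ?x = "mon (n, 0, 0) :: 'k poly3" and ?y = "mon (0, n, 0) :: 'k poly3"
  have *: "\<exists>t. s - ?y ^ k * t \<in> ideal.span {?x} \<and> w * t \<in> ideal.span {?x}" for k
  proof (induction k)
    case 0
    then show ?case using s by (intro exI[of _ s]) (simp add: ideal.span_zero)
  next
    case (Suc k)
    then obtain t where t: "s - ?y ^ k * t \<in> ideal.span {?x}" "w * t \<in> ideal.span {?x}" by blast
    have "w * t \<in> ideal.span {?x, ?y}"
      by (rule subsetD[OF ideal.span_mono t(2)]) simp
    then have "t \<in> ideal.span {?x, ?y}"
      using assms(1) unfolding nzd_def by blast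
    then obtain t1 t2 where tt: "t = t1 * ?x + t2 * ?y" by (auto simp: ideal_span_doubleton_iff)
    have x: "?x \<in> ideal.span {?x}" by (simp add: ideal.span_base)
    have "s - ?y ^ Suc k * t2 = (s - ?y ^ k * t) + (?y ^ k * t1) * ?x"
      by (simp add: tt algebra_simps)
    also have "\<dots> \<in> ideal.span {?x}" by (intro ideal.span_add ideal.span_scale t(1) x)
    finally have 1: "s - ?y ^ Suc k * t2 \<in> ideal.span {?x}" .
    have "?y * (w * t2) = w * t - (w * t1) * ?x"
      by (simp add: tt algebra_simps)
    also have "\<dots> \<in> ideal.span {?x}" by (intro ideal.span_diff ideal.span_scale t(2) x)
    finally have "w * t2 \<in> ideal.span {?x}" using y unfolding nzd_def by blast
    then show ?case using 1 by blast
  qed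
  \<comment> \<open>The exponent of \<open>y\<close> in \<open>?y ^ k\<close> exceeds those in all
    terms of \<open>s\<close>, so the subtracted multiple touches no term of
    \<open>s\<close>.\<close>
  define k where "k = Suc (\<Sum>u\<in>supp s. fst (snd u))"
  obtain t where t: "s - ?y ^ k * t \<in> ideal.span (mon ` {(n, 0, 0)})" using *[of k] by auto
  have yk: "?y ^ k = mon (0, n * k, 0)"
    by (simp add: mon_power power_mult)
  have "\<exists>m\<in>{(n, 0, 0)}. \<exists>v. u = v + m" if "u \<in> supp s" for u
  proof -
    have "fst (snd u) < k"
      using that member_le_sum[of u "supp s" "\<lambda>u. fst (snd u)"] by (simp add: k_def)
    also have "k \<le> n * k" using n_pos by simp
    finally have "u \<noteq> (0, n * k, 0) + v" for v by (cases u; cases v) auto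
    then have "coef (s - ?y ^ k * t) u = coef s u"
      unfolding yk lookup_minus by (simp add: coef_mon_mult_notin del: split_paired_All)
    then have "u \<in> supp (s - ?y ^ k * t)" using that by (simp add: in_keys_iff)
    with t show ?thesis unfolding mem_monomial_ideal_iff by (rule bspec)
  qed
  then have "s \<in> ideal.span (mon ` {(n, 0, 0)})"
    unfolding mem_monomial_ideal_iff by (rule ballI)
  then show "s \<in> ideal.span {?x}" by simp
qed

text \<open>The powers \<open>z\<close>, \<open>y\<close>, \<open>x\<close> are replaced in this
  order by \<open>w3\<close>, \<open>w2\<close>, \<open>w1\<close>. An exchange acts on the last
  entry, so the sequence is permuted in between and its regularity carried over to the new
  order.\<close>

lemma Sd_subset_span:
  fixes V :: "'k::field poly3 set"
  assumes inf: "infinite (UNIV :: 'k set)"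
    and V: "V \<subseteq> Sd n" "0 \<in> V" "\<And>f g. f \<in> V \<Longrightarrow> g \<in> V \<Longrightarrow> f + g \<in> V" "\<And>t f. f \<in> V \<Longrightarrow> Const t * f \<in> V"
    and pow: "mon (n, 0, 0) ^ M \<in> ideal.span V" "mon (0, n, 0) ^ M \<in> ideal.span V"
      "mon (0, 0, n) ^ M \<in> ideal.span V"
    and "d \<ge> D"
  shows "Sd d \<subseteq> ideal.span V"
proof -
  define x y z :: "'k poly3"
    where "x = mon (n, 0, 0)" and "y = mon (0, n, 0)" and "z = mon (0, 0, n)"
  have S: "x \<in> Sd n" "y \<in> Sd n" "z \<in> Sd n"
    by (simp_all add: x_def y_def z_def mon_powers_Sd)
  have select: "\<exists>w\<in>V. \<exists>m. r ^ m \<in> ideal.span {p, q, w}"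
    if pqr: "p \<in> Sd n" "q \<in> Sd n" "r \<in> Sd n" "sat p q r" "r ^ M \<in> ideal.span V" for p q r
  proof -
    obtain w m where "w \<in> V" "r ^ m \<in> ideal.span {p, q, w}"
      by (rule select_parameter[OF pqr(1-4) inf V(1,2) _ _ pqr(5)]) (use V(3,4) in blast)+
    then show ?thesis by blast
  qed
  have "nzd (ideal.span (mon ` {(n, 0, 0), (0, n, 0)})) z"
    unfolding z_def
  proof (rule nzd_mon)
    fix u w m :: expo assume "m \<in> {(n, 0, 0), (0, n, 0)}" "(0, 0, n) + u = w + m"
    then show "\<exists>m\<in>{(n, 0, 0), (0, n, 0)}. \<exists>w. u = w + m"
      by (cases u; cases w) (auto simp: add_eq_conv_diff)
  qed
  then have nz: "nzd (ideal.span {x, y}) z" by (simp add: x_def y_def)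
  have "nzd (ideal.span (mon ` {(n, 0, 0)})) y"
    unfolding y_def
  proof (rule nzd_mon)
    fix u w m :: expo assume "m \<in> {(n, 0, 0)}" "(0, n, 0) + u = w + m"
    then show "\<exists>m\<in>{(n, 0, 0)}. \<exists>w. u = w + m"
      by (cases u; cases w) auto
  qed
  then have ny: "nzd (ideal.span {x}) y" by (simp add: x_def)
  have x0: "f = 0" if "x * f = 0" for f
    using that supp_mon_mult[of "(n, 0, 0)" f] by (simp add: x_def)
  have s0: "sat x y z" unfolding x_def y_def z_def by (rule sat_powers)
  obtain w3 m3 where w3: "w3 \<in> V" "z ^ m3 \<in> ideal.span {x, y, w3}"
    using select[OF S s0] pow(3) unfolding z_def by blast
  have nw3: "nzd (ideal.span {x, y}) w3"
    by (rule exchange_nzd[OF S s0 nz w3(2)])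
  have w3S: "w3 \<in> Sd n" using w3 V(1) by blast
  have "sat x y w3" by (rule exchange_sat[OF S s0 nz nw3 w3S])
  then have s3: "sat x w3 y" by (simp add: sat_def insert_commute)
  have ny3: "nzd (ideal.span {x, w3}) y"
    by (rule nzd_swap[OF ny nw3])
  obtain w2 m2 where w2: "w2 \<in> V" "y ^ m2 \<in> ideal.span {x, w3, w2}"
    using select[OF S(1) w3S S(2) s3] pow(2) unfolding y_def by blast
  have nw2: "nzd (ideal.span {x, w3}) w2"
    by (rule exchange_nzd[OF S(1) w3S S(2) s3 ny3 w2(2)])
  have w2S: "w2 \<in> Sd n" using w2 V(1) by blast
  have "sat x w3 w2" by (rule exchange_sat[OF S(1) w3S S(2) s3 ny3 nw2 w2S])
  then have s2: "sat w3 w2 x" by (simp add: sat_def insert_commute)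
  \<comment> \<open>This yields that \<open>x\<close> is regular modulo \<open>w3\<close>, which the
    last swap requires.\<close>
  have nw3x: "nzd (ideal.span {x}) w3"
    unfolding x_def by (rule nzd_descend) (use nw3 ny in \<open>simp_all add: x_def y_def\<close>)
  have nx3: "nzd (ideal.span {w3}) x"
    unfolding nzd_def
  proof (intro allI impI)
    fix f assume "x * f \<in> ideal.span {w3}"
    then obtain s where s: "x * f = s * w3" by (auto simp: ideal_span_singleton_iff)
    then have "w3 * s = f * x" by (simp add: mult.commute)
    then have "s \<in> ideal.span {x}"
      using nw3x unfolding nzd_def ideal_span_singleton_iff by blast
    then obtain t where t: "s = t * x" by (auto simp: ideal_span_singleton_iff)
    have "x * (f - t * w3) = 0" using s unfolding t by (simp add: algebra_simps)
    then have "f = t * w3" using x0 by fastforce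
    then show "f \<in> ideal.span {w3}" by (auto simp: ideal_span_singleton_iff)
  qed
  have "nzd (ideal.span {w3, x}) w2" using nw2 by (simp add: insert_commute)
  then have nx: "nzd (ideal.span {w3, w2}) x"
    by (rule nzd_swap[OF nx3])
  obtain w1 m1 where w1: "w1 \<in> V" "x ^ m1 \<in> ideal.span {w3, w2, w1}"
    using select[OF w3S w2S S(1) s2] pow(1) unfolding x_def by blast
  have nw1: "nzd (ideal.span {w3, w2}) w1"
    by (rule exchange_nzd[OF w3S w2S S(1) s2 nx w1(2)])
  have "w1 \<in> Sd n" using w1 V(1) by blast
  then have "sat w3 w2 w1" by (rule exchange_sat[OF w3S w2S S(1) s2 nx nw1])
  then have "Sd d \<subseteq> ideal.span {w3, w2, w1}" using \<open>d \<ge> D\<close> by (simp add: sat_def)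
  also have "\<dots> \<subseteq> ideal.span V" using w1 w2 w3 by (intro ideal.span_mono) simp
  finally show ?thesis .
qed

end

section \<open>The filtration of the polynomial ring induced by the subring\<close>

fun tdeg :: "expo \<Rightarrow> nat" where
  "tdeg (i, j, l) = i + j + l"

lemma tdeg_add: "tdeg (u + v) = tdeg u + tdeg v"
  by (cases u; cases v) simp

context weights
begin

text \<open>The largest degree of a monomial of \<open>S\<close> that divides the given one.\<close>

fun om :: "expo \<Rightarrow> nat" where
  "om (i, j, l) = i + b * (j div b) + c * (l div c)"

definition Fx :: "nat \<Rightarrow> expo set" where
  "Fx d = {u. d \<le> om u}"

definition F :: "nat \<Rightarrow> 'k::field poly3 set" where
  "F d = {f. supp f \<subseteq> Fx d}"

lemma om_le_tdeg: "om u \<le> tdeg u"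
  by (cases u) (simp add: add_mono)

lemma Sx_iff: "u \<in> Sx d \<longleftrightarrow> om u = d \<and> tdeg u = d"
proof (cases u)
  case (fields i j l)
  have *: "(x = j \<and> y = l \<and> i + j + l = d) \<longleftrightarrow> (i + x + y = d \<and> i + j + l = d)"
    if "x \<le> j" "y \<le> l" for x y
    using that by auto
  have "b dvd j \<longleftrightarrow> b * (j div b) = j" "c dvd l \<longleftrightarrow> c * (l div c) = l"
    by (metis dvd_mult_div_cancel dvd_triv_left)+
  then have "u \<in> Sx d \<longleftrightarrow> b * (j div b) = j \<and> c * (l div c) = l \<and> i + j + l = d"
    by (simp only: fields Sx_def mem_Collect_eq prod.case)
  then show ?thesis
    by (simp only: *[OF times_div_less_eq_dividend times_div_less_eq_dividend] fields om.simps tdeg.simps)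
qed

lemma om_add: "om u + om v \<le> om (u + v)"
proof -
  have *: "k * (i div k) + k * (j div k) \<le> k * ((i + j) div k)" for i j k :: nat
    unfolding distrib_left[symmetric] by (rule mult_le_mono2) (use div_add1_eq[of i j k] in linarith)
  obtain i j l where u: "u = (i, j, l)" by (cases u)
  obtain i' j' l' where v: "v = (i', j', l')" by (cases v)
  show ?thesis using *[of b j j'] *[of c l l']
    unfolding u v by simp
qed

text \<open>\<open>om\<close> is superadditive and bounded by the additive \<open>tdeg\<close>, so
  equality for the sum forces equality for both summands.\<close>

lemma Sx_add_split:
  assumes "u \<in> Fx d" "v \<in> Fx e" "u + v \<in> Sx (d + e)"
  shows "u \<in> Sx d" "v \<in> Sx e"
  using assms om_le_tdeg[of u] om_le_tdeg[of v] om_add[of u v]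
  unfolding Fx_def Sx_iff tdeg_add mem_Collect_eq by linarith+

lemma ideal_subspace_F: "ideal.subspace (F d)"
  unfolding F_def
proof (rule ideal_subspace_supp)
  fix u v assume "u \<in> Fx d"
  then show "v + u \<in> Fx d" using om_add[of v u] unfolding Fx_def by simp
qed

lemma F_mult:
  assumes "f \<in> F d" "g \<in> F e" shows "f * g \<in> F (d + e)"
proof -
  have "w \<in> Fx (d + e)" if "w \<in> supp (f * g)" for w
  proof -
    from supp_mult_subset[OF that] obtain u v
      where "u \<in> supp f" "v \<in> supp g" and w: "w = u + v" by (elim bexE)
    then have "u \<in> Fx d" "v \<in> Fx e" using assms by (auto simp: F_def)
    then show ?thesis using om_add[of u v] unfolding w Fx_def by simp
  qed
  then show ?thesis by (auto simp: F_def)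
qed

lemma Sd_subset_F: "Sd d \<subseteq> F d"
  by (auto simp: Sd_def F_def Fx_def Sx_iff)

lemma F_0: "F 0 = UNIV"
  by (auto simp: F_def Fx_def)

text \<open>Leading forms are multiplicative for the filtration \<open>F\<close>: by
  \<open>Sx_add_split\<close>, two terms multiply into \<open>Sx (d + e)\<close> only if both are
  leading terms.\<close>

lemma prj_mult_F:
  assumes "f \<in> F d" "g \<in> F e"
  shows "prj (Sx (d + e)) (f * g) = prj (Sx d) f * prj (Sx e) g"
proof -
  have *: "prj (Sx (d + e)) (f' * g') = 0"
    if "f' \<in> F d" "g' \<in> F e" "supp f' \<inter> Sx d = {} \<or> supp g' \<inter> Sx e = {}" for f' g' :: "'a poly3"
  proof (rule prj_zero)
    have "w \<notin> Sx (d + e)" if "w \<in> supp (f' * g')" for w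
    proof
      assume "w \<in> Sx (d + e)"
      from supp_mult_subset[OF that] obtain u v
        where uv: "u \<in> supp f'" "v \<in> supp g'" and w: "w = u + v" by (elim bexE)
      then have "u \<in> Fx d" "v \<in> Fx e" using \<open>f' \<in> F d\<close> \<open>g' \<in> F e\<close> by (auto simp: F_def)
      then have "u \<in> Sx d" "v \<in> Sx e" using Sx_add_split \<open>w \<in> Sx (d + e)\<close> unfolding w by blast+
      then show False using uv \<open>supp f' \<inter> Sx d = {} \<or> supp g' \<inter> Sx e = {}\<close> by blast
    qed
    then show "supp (f' * g') \<inter> Sx (d + e) = {}" by blast
  qed
  have Ff: "prj A f \<in> F d" "prj A g \<in> F e" for A
    using assms by (auto simp: F_def supp_prj)
  have "f * g = prj (Sx d) f * g + prj (- Sx d) f * g"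
    by (simp only: prj_split[symmetric] distrib_right[symmetric])
  moreover have "prj (Sx d) f * g = prj (Sx d) f * prj (Sx e) g + prj (Sx d) f * prj (- Sx e) g"
    by (simp only: prj_split[symmetric] distrib_left[symmetric])
  ultimately have "f * g = prj (Sx d) f * prj (Sx e) g + prj (Sx d) f * prj (- Sx e) g + prj (- Sx d) f * g"
    by (simp only:)
  then have "prj (Sx (d + e)) (f * g) = prj (Sx (d + e)) (prj (Sx d) f * prj (Sx e) g)
      + prj (Sx (d + e)) (prj (Sx d) f * prj (- Sx e) g) + prj (Sx (d + e)) (prj (- Sx d) f * g)"
    by (simp only: prj_add)
  also have "\<dots> = prj (Sx d) f * prj (Sx e) g"
    using *[OF Ff(1) Ff(2)] *[OF Ff(1) assms(2)] prj_Sd_id[OF Sd_mult[OF prj_Sd prj_Sd]]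
    by (simp add: supp_prj Int_assoc)
  finally show ?thesis .
qed

lemma Fx_iff: "u \<in> Fx d \<longleftrightarrow> (\<exists>m\<in>(\<Union>e\<in>{d..}. Sx e). \<exists>v. u = v + m)"
proof
  assume "u \<in> Fx d"
  obtain i j l where u: "u = (i, j, l)" by (cases u)
  have "(i, b * (j div b), c * (l div c)) \<in> Sx (om u)"
    by (simp add: Sx_def u)
  moreover have "u = (0, j mod b, l mod c) + (i, b * (j div b), c * (l div c))"
    by (simp add: u)
  moreover have "om u \<in> {d..}" using \<open>u \<in> Fx d\<close> by (simp add: Fx_def)
  ultimately show "\<exists>m\<in>(\<Union>e\<in>{d..}. Sx e). \<exists>v. u = v + m"
    by (intro bexI[where x = "(i, b * (j div b), c * (l div c))"] exI UN_I)
next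
  assume "\<exists>m\<in>(\<Union>e\<in>{d..}. Sx e). \<exists>v. u = v + m"
  then obtain m v where m: "m \<in> (\<Union>e\<in>{d..}. Sx e)" and u: "u = v + m" by (elim bexE exE)
  have "d \<le> om m" using m by (auto simp: Sx_iff)
  then show "u \<in> Fx d" using om_add[of v m] unfolding u Fx_def by simp
qed

lemma F_eq_span: "F d = ideal.span (mon ` (\<Union>e\<in>{d..}. Sx e))"
proof (rule Set.set_eqI)
  fix f
  show "f \<in> F d \<longleftrightarrow> f \<in> ideal.span (mon ` (\<Union>e\<in>{d..}. Sx e))"
    unfolding mem_monomial_ideal_iff Fx_iff[symmetric] by (auto simp: F_def)
qed

lemma ideal_pow_F: "ideal_pow (F n :: 'k::field poly3 set) r \<subseteq> F (n * r)"
proof (induction r)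
  case 0
  then show ?case by (simp add: F_0)
next
  case (Suc r)
  have "ideal_prod (F n) (ideal_pow (F n) r) \<subseteq> (F (n + n * r) :: 'k poly3 set)"
    using Suc by (intro ideal_prod_least[OF ideal_subspace_F] F_mult subsetD[OF Suc])
  then show ?case by simp
qed

theorem reduction_contains_F:
  fixes J :: "'k::field poly3 set"
  assumes inf: "infinite (UNIV :: 'k set)" and red: "is_reduction J (F n)"
  shows "F D \<subseteq> J"
proof -
  obtain r where r: "ideal_pow (F n) (Suc r) = ideal_prod J (ideal_pow (F n) r)"
    using red by (auto simp: is_reduction_def)
  have J: "ideal.subspace J" "J \<subseteq> F n" using red by (auto simp: is_reduction_def)
  define V where "V = prj (Sx n) ` J"
  have V_add: "f + g \<in> V" if "f \<in> V" "g \<in> V" for f g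
    using that ideal.subspace_add[OF J(1)] by (auto simp: V_def prj_add[symmetric])
  have V_scale: "Const t * f \<in> V" if "f \<in> V" for t f
    using that ideal.subspace_scale[OF J(1)] by (auto simp: V_def prj_Const_mult[symmetric])
  have V: "V \<subseteq> Sd n" "0 \<in> V"
    using prj_Sd ideal.subspace_0[OF J(1)] by (auto simp: V_def prj_zero intro!: image_eqI[of 0 _ 0])
  let ?d = "n + n * r"
  \<comment> \<open>The reduction equation on leading forms: those of \<open>J L^r\<close> lie in
    the ideal generated by \<open>V\<close>, and \<open>L^(r+1)\<close> equals this product. Hence
    that ideal contains the power \<open>r + 1\<close> of every form in \<open>Sd n\<close>.\<close>
  have "ideal_prod J (ideal_pow (F n) r) \<subseteq> {h \<in> F ?d. prj (Sx ?d) h \<in> ideal.span V}"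
  proof (rule ideal_prod_least)
    show "ideal.subspace {h \<in> F ?d. prj (Sx ?d) h \<in> ideal.span V}"
      unfolding ideal.subspace_def
    proof (intro conjI ballI allI)
      fix x h assume h: "h \<in> {h \<in> F ?d. prj (Sx ?d) h \<in> ideal.span V}"
      have "prj (Sx (0 + ?d)) (x * h) = prj (Sx 0) x * prj (Sx ?d) h"
        by (rule prj_mult_F) (use h in \<open>simp_all add: F_0\<close>)
      then show "x * h \<in> {h \<in> F ?d. prj (Sx ?d) h \<in> ideal.span V}"
        using h by (auto simp: ideal.span_scale ideal.subspace_scale[OF ideal_subspace_F])
    qed (auto simp: prj_add ideal.span_add ideal.subspace_add[OF ideal_subspace_F]
        ideal.subspace_0[OF ideal_subspace_F] prj_zero ideal.span_zero)
    fix f g :: "'k poly3" assume fg: "f \<in> J" "g \<in> ideal_pow (F n) r"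
    then have F: "f \<in> F n" "g \<in> F (n * r)" using J(2) ideal_pow_F by blast+
    have "prj (Sx n) f \<in> ideal.span V" using fg(1) by (auto simp: V_def intro: ideal.span_base)
    then show "f * g \<in> {h \<in> F ?d. prj (Sx ?d) h \<in> ideal.span V}"
      using F_mult[OF F] prj_mult_F[OF F] ideal.span_scale by (auto simp: mult.commute)
  qed
  then have pow: "prj (Sx ?d) (f ^ Suc r) \<in> ideal.span V" if "f \<in> F n" for f
    using ideal_pow_base[OF that, of "Suc r"] r by blast
  have powV: "f ^ Suc r \<in> ideal.span V" if "f \<in> Sd n" for f :: "'k poly3"
    using pow[of f] prj_Sd_id[OF Sd_power[OF that, of "Suc r"]] that Sd_subset_F by (auto simp: mult.commute)
  have powJ: "f ^ Suc r \<in> J" if "f \<in> F n" for f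
    using ideal_pow_base[OF that, of "Suc r"] r ideal_prod_subset_right[OF J(1)]
    by (metis ideal_prod_commute subsetD)
  have lift: "\<exists>g\<in>J \<inter> F (om m). prj (Sx (om m)) g = mon m" if "m \<in> Sx (om m)" "D \<le> om m" for m
  proof -
    let ?e = "om m"
    have "mon m \<in> Sd ?e" using that(1) by (auto simp: Sd_def)
    then have "mon m \<in> ideal.span V"
      using Sd_subset_span[OF inf V V_add V_scale powV powV powV that(2)] mon_powers_Sd by blast
    then obtain t q where t: "finite t" "t \<subseteq> V" "mon m = (\<Sum>a\<in>t. q a * a)"
      unfolding ideal.span_explicit by blast
    have "\<forall>a\<in>t. \<exists>f\<in>J. a = prj (Sx n) f" using t(2) by (auto simp: V_def)
    then obtain \<phi> where \<phi>: "\<And>a. a \<in> t \<Longrightarrow> \<phi> a \<in> J" "\<And>a. a \<in> t \<Longrightarrow> prj (Sx n) (\<phi> a) = a"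
      by metis
    have ne: "(?e - n) + n = ?e" using that(2) n_le_D by simp
    \<comment> \<open>Each \<open>a\<close> in \<open>V\<close> is replaced by a preimage in
      \<open>J\<close>, and each coefficient by its part in \<open>S\<close> of degree
      \<open>?e - n\<close>, so that \<open>g\<close> stays in \<open>F ?e\<close>.\<close>
    define g where "g = (\<Sum>a\<in>t. prj (Sx (?e - n)) (q a) * \<phi> a)"
    have qF: "prj (Sx (?e - n)) (q a) \<in> F (?e - n)" for a
      using prj_Sd Sd_subset_F by blast
    have "prj (Sx ?e) (\<Sum>a\<in>t'. prj (Sx (?e - n)) (q a) * \<phi> a) = prj (Sx ?e) (\<Sum>a\<in>t'. q a * a)"
      if "t' \<subseteq> t" for t'
      using finite_subset[OF that t(1)] that
    proof (induction t' rule: finite_induct)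
      case (insert a t')
      have a: "a \<in> t" using insert by simp
      have "prj (Sx ?e) (prj (Sx (?e - n)) (q a) * \<phi> a) = prj (Sx (?e - n)) (q a) * a"
        using prj_mult_F[OF qF[of a] subsetD[OF J(2) \<phi>(1)[OF a]]]
        by (simp only: ne \<phi>(2)[OF a] prj_Sd_id[OF prj_Sd])
      also have "\<dots> = prj (Sx ?e) (q a * a)"
        by (rule prj_mult_Sd[symmetric]) (use that(1) a t(2) V(1) ne in \<open>auto\<close>)
      finally show ?case using insert by (simp add: prj_add)
    qed simp
    then have "prj (Sx ?e) g = prj (Sx ?e) (mon m)" unfolding g_def t(3) by blast
    also have "\<dots> = mon m" using that(1) by (intro prj_id) simp
    finally have 1: "prj (Sx ?e) g = mon m" .
    have "g \<in> J" unfolding g_def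
      by (intro ideal.subspace_sum[OF J(1)] ideal.subspace_scale[OF J(1)] \<phi>(1))
    moreover have "prj (Sx (?e - n)) (q a) * \<phi> a \<in> F ?e" if "a \<in> t" for a
      using F_mult[OF qF[of a], of "\<phi> a" n] \<phi>(1)[OF that] J(2) unfolding ne by blast
    then have "g \<in> F ?e" unfolding g_def
      by (intro ideal.subspace_sum[OF ideal_subspace_F])
    ultimately show ?thesis using 1 by blast
  qed
  \<comment> \<open>In total degree at least \<open>?B\<close> some variable has exponent at least
    \<open>n (r + 1)\<close>, and that power of it lies in \<open>J\<close>. This starts the
    descending induction.\<close>
  let ?B = "3 * (n * Suc r)"
  have "mon u \<in> J" if "u \<in> Fx D" for u
    using that
  proof (induction "?B - tdeg u" arbitrary: u rule: less_induct)
    case less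
    obtain i j l where u: "u = (i, j, l)" by (cases u)
    show ?case
    proof (cases "tdeg u \<ge> ?B")
      case True
      have xJ: "mon (n * Suc r, 0, 0) \<in> J" "mon (0, n * Suc r, 0) \<in> J" "mon (0, 0, n * Suc r) \<in> J"
        using powJ[of "mon (n, 0, 0)"] powJ[of "mon (0, n, 0)"] powJ[of "mon (0, 0, n)"]
          mon_powers_Sd Sd_subset_F unfolding mon_power power_mult by blast+
      have "i \<ge> n * Suc r \<or> j \<ge> n * Suc r \<or> l \<ge> n * Suc r" using True unfolding u tdeg.simps by linarith
      then consider "i \<ge> n * Suc r" | "j \<ge> n * Suc r" | "l \<ge> n * Suc r" by blast
      then show ?thesis
      proof cases
        case 1
        then have "u = (i - n * Suc r, j, l) + (n * Suc r, 0, 0)" by (simp add: u)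
        then show ?thesis using ideal.subspace_scale[OF J(1) xJ(1)] by (simp only: mon_add)
      next
        case 2
        then have "u = (i, j - n * Suc r, l) + (0, n * Suc r, 0)" by (simp add: u)
        then show ?thesis using ideal.subspace_scale[OF J(1) xJ(2)] by (simp only: mon_add)
      next
        case 3
        then have "u = (i, j, l - n * Suc r) + (0, 0, n * Suc r)" by (simp add: u)
        then show ?thesis using ideal.subspace_scale[OF J(1) xJ(3)] by (simp only: mon_add)
      qed
    next
      case False
      define m v where "m = (i, b * (j div b), c * (l div c))" and "v = (0 :: nat, j mod b, l mod c)"
      have uv: "u = v + m" and om: "om m = om u" and mS: "m \<in> Sx (om m)"
        using b_pos c_pos by (simp_all add: u m_def v_def Sx_def)
      have "D \<le> om m" using less.prems om by (simp add: Fx_def)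
      then obtain g where g: "g \<in> J" "g \<in> F (om m)" "prj (Sx (om m)) g = mon m"
        using lift[OF mS] by blast
      define h where "h = prj (- Sx (om m)) g"
      have "mon w' \<in> J" if "w' \<in> supp (mon v * h)" for w'
      proof -
        from that obtain w where w: "w \<in> supp h" "w' = v + w"
          unfolding supp_mon_mult by (elim imageE)
        have wF: "w \<in> Fx (om m)" and wS: "w \<notin> Sx (om m)"
          using w(1) g(2) by (auto simp: h_def supp_prj F_def)
        \<comment> \<open>A term of \<open>F (om m)\<close> that is not leading exceeds
          \<open>om m\<close> in total degree, so \<open>h\<close> involves only monomials covered
          by the induction hypothesis.\<close>
        have "tdeg w > om m"
          using wF wS om_le_tdeg[of w] unfolding Fx_def Sx_iff mem_Collect_eq by linarith
        moreover have "tdeg m = om m" using mS Sx_iff by blast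
        ultimately have "tdeg u < tdeg w'" unfolding uv w(2) tdeg_add by simp
        then have "?B - tdeg w' < ?B - tdeg u" using False by simp
        moreover have "w' \<in> Fx D"
          using wF \<open>D \<le> om m\<close> om_add[of v w] unfolding w(2) Fx_def by simp
        ultimately show ?thesis by (rule less.hyps)
      qed
      then have "(\<Sum>w\<in>supp (mon v * h). Const (coef (mon v * h) w) * mon w) \<in> J"
        by (intro ideal.subspace_sum[OF J(1)] ideal.subspace_scale[OF J(1)])
      then have hJ: "mon v * h \<in> J" by (simp only: poly3_sum_monomials[symmetric])
      have "g = mon m + h" unfolding h_def g(3)[symmetric] by (rule prj_split)
      then have "mon u = mon v * g - mon v * h" by (simp add: uv mon_add distrib_left)
      then show ?thesis
        using ideal.subspace_diff[OF J(1) ideal.subspace_scale[OF J(1) g(1)] hJ] by simp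
    qed
  qed
  then have "f \<in> J" if "f \<in> F D" for f
  proof -
    have "(\<Sum>u\<in>supp f. Const (coef f u) * mon u) \<in> J"
      using that \<open>\<And>u. u \<in> Fx D \<Longrightarrow> mon u \<in> J\<close>
      by (intro ideal.subspace_sum[OF J(1)] ideal.subspace_scale[OF J(1)]) (auto simp: F_def)
    then show ?thesis by (simp only: poly3_sum_monomials[symmetric])
  qed
  then show ?thesis by blast
qed

end

section \<open>Reductions of monomial ideals\<close>

definition msum :: "expo set \<Rightarrow> nat \<Rightarrow> expo set" where
  "msum M r = {\<Sum>\<^sub># N | N. set_mset N \<subseteq> M \<and> size N = r}"

lemma msumI: "set_mset N \<subseteq> M \<Longrightarrow> size N = r \<Longrightarrow> \<Sum>\<^sub># N \<in> msum M r"
  by (auto simp: msum_def)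

lemma msum_0: "msum M 0 = {0}"
  by (auto simp: msum_def)

lemma msum_Suc: "msum M (Suc r) = (\<lambda>(u, v). u + v) ` (M \<times> msum M r)"
proof (intro subset_antisym subsetI)
  fix w assume "w \<in> msum M (Suc r)"
  then obtain N where N: "w = \<Sum>\<^sub># N" "set_mset N \<subseteq> M" "size N = Suc r" by (auto simp: msum_def)
  obtain u N' where "N = add_mset u N'" using N(3) size_eq_Suc_imp_eq_union by blast
  then have "w = u + \<Sum>\<^sub># N'" "u \<in> M" "\<Sum>\<^sub># N' \<in> msum M r"
    using N by (auto intro: msumI)
  then show "w \<in> (\<lambda>(u, v). u + v) ` (M \<times> msum M r)" by force
next
  fix w assume "w \<in> (\<lambda>(u, v). u + v) ` (M \<times> msum M r)"
  then obtain u v where uv: "u \<in> M" "v \<in> msum M r" and w: "w = u + v"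
    by (elim imageE) (auto simp del: split_paired_All)
  from uv(2) obtain N where N: "v = \<Sum>\<^sub># N" "set_mset N \<subseteq> M" "size N = r" by (auto simp: msum_def)
  have "\<Sum>\<^sub># (add_mset u N) \<in> msum M (Suc r)"
    using N uv by (intro msumI) auto
  then show "w \<in> msum M (Suc r)" using N w by simp
qed

lemma finite_msum: "finite M \<Longrightarrow> finite (msum M r)"
  by (induction r) (simp_all add: msum_0 msum_Suc)

lemma ideal_pow_monomials: "ideal_pow (ideal.span (mon ` M)) r = ideal.span (mon ` msum M r)"
proof (induction r)
  case 0
  have "ideal.span (mon ` msum M 0) = (UNIV :: 'a poly3 set)"
    by (auto simp: msum_0 mon_0 ideal.span_singleton)
  then show ?case by simp
next
  case (Suc r)
  have "{a * b | a b. a \<in> mon ` M \<and> b \<in> mon ` msum M r}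
      = (\<lambda>(u, v). mon u * mon v :: 'a poly3) ` (M \<times> msum M r)"
    by (force simp del: split_paired_Ex)
  also have "\<dots> = mon ` msum M (Suc r)"
    unfolding msum_Suc image_image by (intro image_cong refl) (simp add: case_prod_unfold mon_add)
  finally have "{a * b | a b. a \<in> mon ` M \<and> b \<in> mon ` msum M r} = (mon ` msum M (Suc r) :: 'a poly3 set)" .
  then show ?case by (simp add: Suc ideal_prod_span)
qed

fun pure :: "nat \<Rightarrow> nat \<Rightarrow> expo" where
  "pure n i = (if i = 0 then (n, 0, 0) else if i = 1 then (0, n, 0) else (0, 0, n))"

declare pure.simps [simp del]

lemma pure_0: "pure n 0 = (n, 0, 0)" and pure_1: "pure n (Suc 0) = (0, n, 0)" and pure_2: "pure n 2 = (0, 0, n)"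
  by (simp_all add: pure.simps)

lemma lessThan_3: "{..<3} = {0, Suc 0, 2 :: nat}"
  by auto

lemma less_3_cases: "i < (3 :: nat) \<Longrightarrow> i = 0 \<or> i = Suc 0 \<or> i = 2"
  by auto

lemma tdeg_pure: "tdeg (pure n i) = n"
  by (simp add: pure.simps)

lemma sum_mset_replicate_expo: "\<Sum>\<^sub># (replicate_mset k (i, j, l)) = (k * i, k * j, k * l :: nat)"
  by (induction k) (simp_all add: zero_prod_def)

lemma tdeg_msum: "(\<And>u. u \<in> M \<Longrightarrow> tdeg u = n) \<Longrightarrow> w \<in> msum M r \<Longrightarrow> tdeg w = n * r"
proof (induction r arbitrary: w)
  case (Suc r)
  from Suc.prems(2) obtain u v where "u \<in> M" "v \<in> msum M r" and w: "w = u + v"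
    unfolding msum_Suc by (elim imageE SigmaE) simp
  then have "tdeg u = n" "tdeg v = n * r" using Suc.IH[of v] Suc.prems(1) by blast+
  then show ?case by (simp add: w tdeg_add)
qed (simp add: msum_0 zero_prod_def)

text \<open>A sufficiently long sum contains some \<open>u\<close> at least \<open>n\<close> times, and
  \<open>n u\<close> dominates a sum of \<open>n\<close> of the exponents of \<open>x\<^sup>n, y\<^sup>n, z\<^sup>n\<close>.\<close>

lemma msum_pure_factor:
  assumes "n > 0" "finite M" "pure n ` {..<3} \<subseteq> M" "\<And>u. u \<in> M \<Longrightarrow> n \<le> tdeg u"
  obtains r where "\<And>w. w \<in> msum M (Suc r) \<Longrightarrow> \<exists>i<3. \<exists>m\<in>msum M r. \<exists>e. w = e + (pure n i + m)"
proof
  let ?r = "card M * n"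
  fix w assume "w \<in> msum M (Suc ?r)"
  then obtain N where N: "w = \<Sum>\<^sub># N" "set_mset N \<subseteq> M" "size N = Suc ?r" by (auto simp: msum_def)
  have "\<exists>u. n \<le> count N u"
  proof (rule ccontr)
    assume "\<nexists>u. n \<le> count N u"
    then have "size N \<le> card (set_mset N) * n"
      unfolding size_multiset_overloaded_eq
      by (intro sum_bounded_above[where K = n, simplified]) (auto simp: not_le intro: less_imp_le)
    also have "\<dots> \<le> ?r" using N(2) assms(2) by (simp add: card_mono)
    finally show False using N(3) by simp
  qed
  then obtain u where u: "n \<le> count N u" by blast
  define N' where "N' = N - replicate_mset n u"
  have N': "N = replicate_mset n u + N'"
    using u by (simp add: N'_def count_le_replicate_mset_subset_eq)
  have "u \<in># N" using u assms(1) by (simp flip: count_greater_zero_iff)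
  then have "u \<in> M" using N(2) by blast
  obtain i j l where ijl: "u = (i, j, l)" by (cases u)
  have "n \<le> i + j + l" using assms(4)[OF \<open>u \<in> M\<close>] by (simp add: ijl)
  define i' j' l' where "i' = min i n" and "j' = min j (n - i')" and "l' = n - i' - j'"
  have le: "i' \<le> i" "j' \<le> j" "l' \<le> l" "i' + j' + l' = n"
    using \<open>n \<le> i + j + l\<close> by (auto simp: i'_def j'_def l'_def)
  define P where "P = replicate_mset i' (pure n 0) + replicate_mset j' (pure n 1) + replicate_mset l' (pure n 2)"
  have "size P = n" using le by (simp add: P_def)
  then obtain p P' where P': "P = add_mset p P'"
    using assms(1) size_eq_Suc_imp_eq_union by (metis gr0_conv_Suc)
  have "set_mset P \<subseteq> pure n ` {..<3}" by (auto simp: P_def)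
  then obtain k where k: "k < 3" "p = pure n k" and PM: "set_mset P' \<subseteq> M"
    using assms(3) by (auto simp: P')
  have m: "\<Sum>\<^sub># (P' + N') \<in> msum M ?r"
    using PM N \<open>size P = n\<close> by (intro msumI) (auto simp: P' N')
  have sum_P: "\<Sum>\<^sub># P = (i' * n, j' * n, l' * n)"
    by (simp add: P_def pure_0 pure_1 pure_2 sum_mset_replicate_expo)
  have "w = (n * (i - i'), n * (j - j'), n * (l - l')) + (\<Sum>\<^sub># P + \<Sum>\<^sub># N')"
  proof -
    have "\<Sum>\<^sub># (replicate_mset n u) = (n * (i - i'), n * (j - j'), n * (l - l')) + \<Sum>\<^sub># P"
      using le(1-3) unfolding sum_P ijl sum_mset_replicate_expo
      by (simp add: diff_mult_distrib2 mult.commute)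
    then show ?thesis unfolding N(1) N' by (simp only: sum_mset.union add.assoc)
  qed
  then have "w = (n * (i - i'), n * (j - j'), n * (l - l')) + (pure n k + \<Sum>\<^sub># (P' + N'))"
    unfolding P' k(2) by (simp only: sum_mset.union sum_mset.add_mset add.assoc)
  with k(1) m show "\<exists>i<3. \<exists>m\<in>msum M ?r. \<exists>e. w = e + (pure n i + m)"
    by (intro exI conjI bexI)
qed

lemma pure_reduction:
  assumes "n > 0" "finite M" "pure n ` {..<3} \<subseteq> M" "\<And>u. u \<in> M \<Longrightarrow> n \<le> tdeg u"
  shows "is_reduction (ideal.span (mon ` pure n ` {..<3})) (ideal.span (mon ` M) :: 'k::field poly3 set)"
proof -
  obtain r where r: "\<And>w. w \<in> msum M (Suc r) \<Longrightarrow> \<exists>i<3. \<exists>m\<in>msum M r. \<exists>e. w = e + (pure n i + m)"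
    using msum_pure_factor[OF assms] by blast
  let ?J = "ideal.span (mon ` pure n ` {..<3}) :: 'k poly3 set"
  let ?I = "ideal.span (mon ` M) :: 'k poly3 set"
  show ?thesis
  proof (rule is_reductionI)
    show "?J \<subseteq> ?I" using assms(3) by (intro ideal.span_mono image_mono)
    have "mon w \<in> ideal_prod ?J (ideal_pow ?I r)" if w: "w \<in> msum M (Suc r)" for w
    proof -
      from r[OF w] obtain i m e where im: "i < 3" "m \<in> msum M r" and we: "w = e + (pure n i + m)"
        by (elim exE conjE bexE)
      have "mon (pure n i) * mon m \<in> ideal_prod ?J (ideal_pow ?I r)"
        unfolding ideal_pow_monomials using im
        by (intro ideal_prod_base ideal.span_base imageI) simp_all
      from ideal.subspace_scale[OF ideal_subspace_prod this, of "mon e"]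
      show ?thesis by (simp only: we mon_add)
    qed
    then show "ideal_pow ?I (Suc r) \<subseteq> ideal_prod ?J (ideal_pow ?I r)"
      unfolding ideal_pow_monomials[of M "Suc r"]
      by (intro ideal.span_minimal ideal_subspace_prod) auto
  qed simp
qed

lemma ideal_span_image_sum:
  assumes "finite I" "f \<in> ideal.span (v ` I)"
  shows "\<exists>q. f = (\<Sum>i\<in>I. q i * v i)"
  using assms
proof (induction I arbitrary: f rule: finite_induct)
  case (insert i I)
  from insert.prems obtain u g where g: "g \<in> ideal.span (v ` I)" "f = u * v i + g"
    unfolding image_insert ideal_span_insert_iff by blast
  obtain q where q: "g = (\<Sum>i\<in>I. q i * v i)" using insert.IH[OF g(1)] by blast
  have "f = (\<Sum>j\<in>insert i I. (q(i := u)) j * v j)"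
    using insert.hyps unfolding g(2) q by (simp cong: sum.cong) (intro sum.cong, auto)
  then show ?case by blast
qed simp

text \<open>Setting for perturbing the pure powers to \<open>x^n - t h_0\<close>,
  \<open>y^n - t h_1\<close>, \<open>z^n - t h_2\<close> inside an ideal generated by monomials of
  one degree.\<close>

locale equigenerated =
  fixes n :: nat and G :: "expo set" and h :: "nat \<Rightarrow> 'k::field poly3"
  assumes n_pos: "n > 0" and finite_G: "finite G" and pure_G: "pure n ` {..<3} \<subseteq> G"
    and tdeg_G: "\<And>u. u \<in> G \<Longrightarrow> tdeg u = n" and supp_h: "\<And>i. i < 3 \<Longrightarrow> supp (h i) \<subseteq> G"
begin

abbreviation I :: "'k poly3 set" where
  "I \<equiv> ideal.span (mon ` G)"

definition g :: "'k \<Rightarrow> nat \<Rightarrow> 'k poly3" where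
  "g t i = mon (pure n i) - Const t * h i"

definition J :: "'k \<Rightarrow> 'k poly3 set" where
  "J t = ideal.span (g t ` {..<3})"

text \<open>For \<open>t = 0\<close> the ideal \<open>J t\<close> is the reduction \<open>(x\<^sup>n, y\<^sup>n, z\<^sup>n)\<close>, and being a reduction is an
  open condition on \<open>t\<close>.\<close>

lemma finite_nonreductions: "finite {t. \<not> is_reduction (J t) I}"
proof -
  obtain r where r': "\<And>w. w \<in> msum G (Suc r) \<Longrightarrow> \<exists>i<3. \<exists>m\<in>msum G r. \<exists>e. w = e + (pure n i + m)"
    using msum_pure_factor[OF n_pos finite_G pure_G] tdeg_G by (metis order_refl)
  \<comment> \<open>Both sides have the same degree because \<open>G\<close> lies in degree
    \<open>n\<close>, so the cofactor \<open>e\<close> is trivial.\<close>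
  have "\<exists>i<3. \<exists>m\<in>msum G r. w = pure n i + m" if w: "w \<in> msum G (Suc r)" for w
  proof -
    from r'[OF w] obtain i m e where im: "i < 3" "m \<in> msum G r" and we: "w = e + (pure n i + m)"
      by (elim exE conjE bexE)
    have "tdeg w = n * Suc r" "tdeg m = n * r"
      using tdeg_msum[OF tdeg_G] w im(2) by blast+
    then have "tdeg e = 0" unfolding we by (simp add: tdeg_add tdeg_pure)
    then have "e = 0" by (cases e) (simp add: zero_prod_def)
    then show ?thesis using im we by auto
  qed
  then obtain \<iota> \<mu> where im: "\<And>w. w \<in> msum G (Suc r) \<Longrightarrow> \<iota> w < (3::nat)"
      "\<And>w. w \<in> msum G (Suc r) \<Longrightarrow> \<mu> w \<in> msum G r"
      "\<And>w. w \<in> msum G (Suc r) \<Longrightarrow> w = pure n (\<iota> w) + \<mu> w"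
    by metis
  let ?W = "msum G (Suc r)"
  have fW: "finite ?W" by (rule finite_msum[OF finite_G])
  \<comment> \<open>At \<open>t = 0\<close> these are the monomials generating
    \<open>I^(r+1)\<close>; for every \<open>t\<close> they lie in \<open>J t\<close> times
    \<open>I^r\<close>.\<close>
  define v where "v t w = mon w - Const t * (h (\<iota> w) * mon (\<mu> w))" for t :: 'k and w
  have v_mem: "v t w \<in> ideal_prod (J t) (ideal_pow I r)" if "w \<in> ?W" for t w
  proof -
    have "v t w = g t (\<iota> w) * mon (\<mu> w)"
      unfolding v_def g_def by (subst (1) im(3)[OF that]) (simp add: mon_add algebra_simps)
    moreover have "g t (\<iota> w) \<in> J t" unfolding J_def using im(1)[OF that] by (intro ideal.span_base) simp
    moreover have "mon (\<mu> w) \<in> ideal_pow I r"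
      unfolding ideal_pow_monomials using im(2)[OF that] by (intro ideal.span_base) simp
    ultimately show ?thesis by (simp add: ideal_prod_base)
  qed
  have coef_notin: "coef (h (\<iota> w) * mon (\<mu> w)) a = 0" if "w \<in> ?W" "a \<notin> ?W" for w a
  proof (rule ccontr)
    assume "\<not> ?thesis"
    then have "a \<in> supp (h (\<iota> w) * mon (\<mu> w))" by (simp add: in_keys_iff)
    from supp_mult_subset[OF this] obtain u u'
      where "u \<in> supp (h (\<iota> w))" "u' \<in> supp (mon (\<mu> w) :: 'k poly3)" and a: "a = u + u'" by (elim bexE)
    then have "u \<in> G" "u' \<in> msum G r" using supp_h[OF im(1)[OF that(1)]] im(2)[OF that(1)] by auto
    then have "a \<in> ?W" unfolding msum_Suc a by force
    then show False using that(2) by blast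
  qed
  have fin: "finite {t. mon w0 \<notin> ideal_prod (J t) (ideal_pow I r)}" if w0: "w0 \<in> ?W" for w0
  proof -
    \<comment> \<open>One vector more than there are coordinates: \<open>None\<close> stands for the
      monomial to be reached, \<open>Some w\<close> for \<open>v t w\<close> with entries polynomial
      in \<open>t\<close>.\<close>
    define f where "f o' a = (case o' of None \<Rightarrow> [:coef (mon w0) a:]
      | Some w \<Rightarrow> [:coef (mon w) a, - coef (h (\<iota> w) * mon (\<mu> w)) a:])" for o' a
    have "\<exists>c. (\<exists>o'\<in>insert None (Some ` ?W). c o' \<noteq> 0) \<and>
        (\<forall>a\<in>?W. (\<Sum>o'\<in>insert None (Some ` ?W). c o' * f o' a) = 0)"
      using fW by (intro linear_dependence_idom) (auto simp: card_image)
    then obtain c where c: "\<exists>o'\<in>insert None (Some ` ?W). c o' \<noteq> 0"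
        "\<And>a. a \<in> ?W \<Longrightarrow> (\<Sum>o'\<in>insert None (Some ` ?W). c o' * f o' a) = 0" by blast
    have rel: "c None * [:coef (mon w0) a:] + (\<Sum>w\<in>?W. c (Some w) * f (Some w) a) = 0" if "a \<in> ?W" for a
      using c(2)[OF that] fW by (simp add: sum.reindex f_def)
    have "c None \<noteq> 0"
    proof
      assume 0: "c None = 0"
      \<comment> \<open>At \<open>t = 0\<close> the vectors \<open>Some w\<close> are distinct unit
        vectors, so the lowest power of \<open>t\<close> in a relation among them alone would give a
        relation among unit vectors.\<close>
      define P where "P N \<longleftrightarrow> (\<exists>w\<in>?W. poly.coeff (c (Some w)) N \<noteq> 0)" for N
      from c(1) 0 obtain w where "w \<in> ?W" "c (Some w) \<noteq> 0" by auto
      then have "\<exists>N. P N" unfolding P_def by (metis leading_coeff_neq_0)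
      define N where "N = (LEAST N. P N)"
      have PN: "P N" unfolding N_def using \<open>\<exists>N. P N\<close> by (rule LeastI_ex)
      have less: "poly.coeff (c (Some w)) N' = 0" if "w \<in> ?W" "N' < N" for w N'
        using not_less_Least[of N' P] that unfolding N_def P_def by blast
      obtain w1 where w1: "w1 \<in> ?W" "poly.coeff (c (Some w1)) N \<noteq> 0" using PN P_def by blast
      have "poly.coeff (c (Some w) * f (Some w) w1) N = (if w = w1 then poly.coeff (c (Some w1)) N else 0)"
        if "w \<in> ?W" for w
        using less[OF that, of "N - 1"] by (cases N) (auto simp: f_def coef_mon mult_pCons_right)
      then have "poly.coeff (\<Sum>w\<in>?W. c (Some w) * f (Some w) w1) N = poly.coeff (c (Some w1)) N"
        using w1(1) fW by (simp add: coeff_sum)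
      then show False using rel[OF w1(1)] 0 w1(2) by simp
    qed
    then have "finite {t. poly (c None) t = 0}" by (rule poly_roots_finite)
    moreover have "mon w0 \<in> ideal_prod (J t) (ideal_pow I r)" if t: "poly (c None) t \<noteq> 0" for t
    proof -
      have "Const (poly (c None) t) * mon w0 + (\<Sum>w\<in>?W. Const (poly (c (Some w)) t) * v t w) = 0"
      proof (rule poly_mapping_eqI)
        fix a
        show "coef (Const (poly (c None) t) * mon w0 + (\<Sum>w\<in>?W. Const (poly (c (Some w)) t) * v t w)) a = coef 0 a"
        proof (cases "a \<in> ?W")
          case True
          have "poly (c None * [:coef (mon w0) a:] + (\<Sum>w\<in>?W. c (Some w) * f (Some w) a)) t = 0"
            using rel[OF True] by simp
          then show ?thesis
            by (simp add: lookup_add lookup_sum lookup_minus v_def f_def poly_sum) (simp add: algebra_simps)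
        next
          case False
          then have "coef (v t w) a = 0" if "w \<in> ?W" for w
            using that coef_notin[OF that False] by (auto simp: v_def lookup_minus coef_mon)
          then show ?thesis using False w0 by (auto simp: lookup_add lookup_sum coef_mon)
        qed
      qed
      then have "Const (poly (c None) t) * mon w0 = - (\<Sum>w\<in>?W. Const (poly (c (Some w)) t) * v t w)"
        by (simp add: eq_neg_iff_add_eq_0)
      also have "\<dots> \<in> ideal_prod (J t) (ideal_pow I r)"
        by (intro ideal.subspace_neg ideal.subspace_sum ideal.subspace_scale ideal_subspace_prod v_mem)
      finally have "Const (inverse (poly (c None) t)) * (Const (poly (c None) t) * mon w0)
          \<in> ideal_prod (J t) (ideal_pow I r)" by (rule ideal.subspace_scale[OF ideal_subspace_prod])
      moreover have "Const (inverse (poly (c None) t)) * (Const (poly (c None) t) * mon w0) = mon w0"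
        unfolding mult.assoc[symmetric] Const_mult[symmetric] using t by simp
      ultimately show ?thesis by (simp only:)
    qed
    ultimately show ?thesis by (auto intro: finite_subset[rotated])
  qed
  have "is_reduction (J t) I" if t: "\<forall>w\<in>?W. mon w \<in> ideal_prod (J t) (ideal_pow I r)" for t
  proof (rule is_reductionI)
    show "J t \<subseteq> I"
      unfolding J_def
    proof (rule ideal.span_minimal)
      have "g t i \<in> I" if "i < 3" for i
      proof -
        have "h i \<in> I"
          unfolding mem_monomial_ideal_iff
        proof (rule ballI)
          fix u assume "u \<in> supp (h i)"
          then have "u \<in> G" using supp_h[OF that] by blast
          then show "\<exists>m\<in>G. \<exists>v. u = v + m" by (intro bexI[of _ u] exI[of _ 0]) simp_all
        qed
        then show ?thesis unfolding g_def using pure_G that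
          by (intro ideal.span_diff ideal.span_scale) (auto intro!: ideal.span_base)
      qed
      then show "g t ` {..<3} \<subseteq> I" by blast
    qed simp
    show "ideal_pow I (Suc r) \<subseteq> ideal_prod (J t) (ideal_pow I r)"
      unfolding ideal_pow_monomials[of G "Suc r"] using t
      by (intro ideal.span_minimal ideal_subspace_prod) auto
  qed (simp add: J_def)
  then have "{t. \<not> is_reduction (J t) I} \<subseteq> (\<Union>w\<in>?W. {t. mon w \<notin> ideal_prod (J t) (ideal_pow I r)})"
    by blast
  then show ?thesis using fin fW by (meson finite_UN_I finite_subset)
qed

end

section \<open>Residue functionals\<close>

lemma finite_tdeg: "finite {t. tdeg t = N}"
  by (rule finite_subset[of _ "{..N} \<times> {..N} \<times> {..N}"]) auto

text \<open>As \<open>1/(x^n - t h)\<close> expands into the terms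
  \<open>t^e h^e / x^(n(e+1))\<close>, taking the coefficient of \<open>1/x\<close> means reading
  off the exponent \<open>n(e+1) - 1\<close> in \<open>f h^e\<close>, and likewise for
  \<open>y\<close> and \<open>z\<close>.\<close>

fun target :: "nat \<Rightarrow> expo \<Rightarrow> expo" where
  "target n (i, j, l) = (n - 1 + n * i, n - 1 + n * j, n - 1 + n * l)"

fun hpow :: "(nat \<Rightarrow> 'k::field poly3) \<Rightarrow> expo \<Rightarrow> 'k poly3" where
  "hpow h (i, j, l) = h 0 ^ i * h 1 ^ j * h 2 ^ l"

text \<open>Up to the choice of the numerator, the power series with coefficients \<open>residue n h N f\<close> is
  the residue of \<open>f\<close> with respect to \<open>x\<^sup>n - t h\<^sub>0, y\<^sup>n - t h\<^sub>1, z\<^sup>n - t h\<^sub>2\<close>, expanded in powers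
  of \<open>t\<close>. It vanishes on the ideal generated by these three polynomials.\<close>

definition residue :: "nat \<Rightarrow> (nat \<Rightarrow> 'k::field poly3) \<Rightarrow> nat \<Rightarrow> 'k poly3 \<Rightarrow> 'k" where
  "residue n h N f = (\<Sum>e\<in>{e. tdeg e = N}. coef (f * hpow h e) (target n e))"

context equigenerated
begin

definition \<Phi> :: "expo \<Rightarrow> 'k poly3 \<Rightarrow> 'k" where
  "\<Phi> e f = coef (f * hpow h e) (target n e)"

abbreviation \<psi> :: "nat \<Rightarrow> 'k poly3 \<Rightarrow> 'k" where
  "\<psi> \<equiv> residue n h"

lemma \<psi>_def: "\<psi> N f = (\<Sum>e\<in>{e. tdeg e = N}. \<Phi> e f)"
  by (simp add: residue_def \<Phi>_def)

lemma hpow_add: "i < 3 \<Longrightarrow> hpow h (e + pure 1 i) = h i * hpow h e"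
  by (cases e) (auto dest!: less_3_cases simp: pure_0 pure_1 pure_2)

lemma target_add: "i < 3 \<Longrightarrow> target n (e + pure 1 i) = pure n i + target n e"
  by (cases e) (auto dest!: less_3_cases simp: pure_0 pure_1 pure_2)

lemma \<Phi>_shift:
  assumes "i < 3" shows "\<Phi> (e + pure 1 i) (s * mon (pure n i)) = \<Phi> e (s * h i)"
proof -
  have "s * mon (pure n i) * (h i * hpow h e) = mon (pure n i) * (s * h i * hpow h e)"
    by (simp add: ac_simps)
  then show ?thesis
    unfolding \<Phi>_def hpow_add[OF assms] target_add[OF assms] by (simp only: coef_mon_mult)
qed

text \<open>If \<open>h i\<close> occurs to the power 0, the target exponent of the variable
  \<open>i\<close> is \<open>n - 1\<close>, out of reach for a multiple of its \<open>n\<close>-th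
  power.\<close>

lemma \<Phi>_boundary:
  assumes "i < 3" "\<And>e'. e \<noteq> e' + pure 1 i"
  shows "\<Phi> e (s * mon (pure n i)) = 0"
proof -
  obtain p q r where e: "e = (p, q, r)" by (cases e)
  have "target n e \<noteq> pure n i + v" for v
  proof -
    have "(i = 0 \<longrightarrow> p = 0) \<and> (i = Suc 0 \<longrightarrow> q = 0) \<and> (i = 2 \<longrightarrow> r = 0)"
      using assms(2)[of "(p - 1, q, r)"] assms(2)[of "(p, q - 1, r)"] assms(2)[of "(p, q, r - 1)"]
      unfolding e by (auto simp: pure.simps)
    then show ?thesis
      using n_pos less_3_cases[OF assms(1)] by (cases v) (auto simp: e pure.simps)
  qed
  then have "coef (mon (pure n i) * (s * hpow h e)) (target n e) = 0"
    by (rule coef_mon_mult_notin)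
  then show ?thesis unfolding \<Phi>_def by (simp only: ac_simps)
qed

text \<open>Raising the exponent \<open>i\<close> of \<open>e\<close> by one trades the pure power
  for \<open>h i\<close>. Together with \<open>\<psi>_0_shift\<close> this says that the series with
  coefficients \<open>\<psi> N\<close> vanishes on multiples of the perturbed generators.\<close>

lemma \<psi>_shift:
  assumes "i < 3" shows "\<psi> (Suc N) (s * mon (pure n i)) = \<psi> N (s * h i)"
proof -
  let ?T = "\<lambda>N. {e. tdeg e = N}"
  have "\<psi> (Suc N) (s * mon (pure n i)) = (\<Sum>e\<in>(\<lambda>e. e + pure 1 i) ` ?T N. \<Phi> e (s * mon (pure n i)))"
    unfolding \<psi>_def
  proof (rule sum.mono_neutral_right)
    show "(\<lambda>e. e + pure 1 i) ` ?T N \<subseteq> ?T (Suc N)" by (auto simp: tdeg_add tdeg_pure simp del: split_paired_All)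
    show "\<forall>e\<in>?T (Suc N) - (\<lambda>e. e + pure 1 i) ` ?T N. \<Phi> e (s * mon (pure n i)) = 0"
    proof
      fix e assume e: "e \<in> ?T (Suc N) - (\<lambda>e. e + pure 1 i) ` ?T N"
      have "e \<noteq> e' + pure 1 i" for e'
      proof
        assume ee: "e = e' + pure 1 i"
        then have "tdeg e' = N" using e by (simp add: tdeg_add tdeg_pure)
        then have "e \<in> (\<lambda>e. e + pure 1 i) ` ?T N" unfolding ee by (intro imageI) simp
        then show False using e by blast
      qed
      then show "\<Phi> e (s * mon (pure n i)) = 0" by (rule \<Phi>_boundary[OF assms])
    qed
  qed (rule finite_tdeg)
  also have "\<dots> = \<psi> N (s * h i)"
    unfolding \<psi>_def by (subst sum.reindex) (simp_all add: inj_on_def \<Phi>_shift[OF assms, unfolded One_nat_def])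
  finally show ?thesis .
qed

lemma \<psi>_0_shift: "i < 3 \<Longrightarrow> \<psi> 0 (s * mon (pure n i)) = 0"
  unfolding \<psi>_def
proof (rule sum.neutral, rule ballI)
  fix e assume i: "i < 3" and "e \<in> {e. tdeg e = 0}"
  then have "tdeg e = 0" by simp
  then have "e \<noteq> e' + pure 1 i" for e' using tdeg_add[of e' "pure 1 i"] by (auto simp: tdeg_pure)
  then show "\<Phi> e (s * mon (pure n i)) = 0" by (rule \<Phi>_boundary[OF i])
qed

lemma \<psi>_diff: "\<psi> N (f - f') = \<psi> N f - \<psi> N f'"
  by (simp add: \<psi>_def \<Phi>_def left_diff_distrib lookup_minus sum_subtractf)

lemma \<psi>_0: "\<psi> N 0 = 0"
  by (simp add: \<psi>_def \<Phi>_def)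

lemma \<psi>_sum: "\<psi> N (sum f A) = (\<Sum>a\<in>A. \<psi> N (f a))"
  unfolding \<psi>_def \<Phi>_def sum_distrib_right lookup_sum by (rule sum.swap)

lemma \<psi>_Const_mult: "\<psi> N (Const t * f) = t * \<psi> N f"
  by (simp add: \<psi>_def \<Phi>_def mult.assoc sum_distrib_left)

text \<open>Coefficientwise form of the following:
  \<open>p(t) f = \<Sum> q_i(t) (x_i^n - t h_i)\<close> implies \<open>p(t) \<psi>(f) = 0\<close> as
  power series, since the shifts telescope.\<close>

lemma \<psi>_relation:
  assumes q: "\<And>N. Const (poly.coeff p N) * f
      = (\<Sum>i<3. q i N * mon (pure n i) - (case N of 0 \<Rightarrow> 0 | Suc N \<Rightarrow> q i N * h i))"
  shows "(\<Sum>M\<le>N. poly.coeff p M * \<psi> (N - M) f) = 0"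
proof -
  have tel: "(\<Sum>M\<le>N. \<psi> (N - M) (q i M * mon (pure n i) - (case M of 0 \<Rightarrow> 0 | Suc M \<Rightarrow> q i M * h i))) = 0"
    if "i < 3" for i
  proof -
    have "(\<Sum>M\<le>N. \<psi> (N - M) (q i M * mon (pure n i))) = (\<Sum>M<N. \<psi> (N - M) (q i M * mon (pure n i)))"
      unfolding lessThan_Suc_atMost[symmetric] by (simp add: \<psi>_0_shift[OF that])
    also have "\<dots> = (\<Sum>M<N. \<psi> (N - Suc M) (q i M * h i))"
    proof (rule sum.cong[OF refl])
      fix M assume "M \<in> {..<N}"
      then have "N - M = Suc (N - Suc M)" by auto
      then show "\<psi> (N - M) (q i M * mon (pure n i)) = \<psi> (N - Suc M) (q i M * h i)"
        using \<psi>_shift[OF that] by simp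
    qed
    also have "\<dots> = (\<Sum>M\<le>N. \<psi> (N - M) (case M of 0 \<Rightarrow> 0 | Suc M \<Rightarrow> q i M * h i))"
      unfolding lessThan_Suc_atMost[symmetric] by (simp add: sum.lessThan_Suc_shift \<psi>_0 del: sum.lessThan_Suc)
    finally show ?thesis by (simp add: \<psi>_diff sum_subtractf)
  qed
  have "(\<Sum>M\<le>N. poly.coeff p M * \<psi> (N - M) f)
      = (\<Sum>M\<le>N. \<Sum>i<3. \<psi> (N - M) (q i M * mon (pure n i) - (case M of 0 \<Rightarrow> 0 | Suc M \<Rightarrow> q i M * h i)))"
    by (simp only: \<psi>_Const_mult[symmetric] q \<psi>_sum)
  also have "\<dots> = (\<Sum>i<3. \<Sum>M\<le>N. \<psi> (N - M) (q i M * mon (pure n i) - (case M of 0 \<Rightarrow> 0 | Suc M \<Rightarrow> q i M * h i)))"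
    by (rule sum.swap)
  also have "\<dots> = 0" using tel by (intro sum.neutral) simp
  finally show ?thesis .
qed

text \<open>For almost all \<open>t\<close> the element lies in \<open>J t\<close>; by
  \<open>generic_span\<close> this becomes one identity over \<open>k[t]\<close> with a nonzero
  factor \<open>p\<close>. The residue series is annihilated by \<open>p\<close>, hence
  zero.\<close>

lemma residue_core_eq_0:
  assumes inf: "infinite (UNIV :: 'k set)" and f: "f \<in> core I"
  shows "\<psi> N (prj {u. tdeg u = d} f) = 0"
proof -
  define f' where "f' = prj {u. tdeg u = d} f"
  \<comment> \<open>In a fixed degree \<open>d\<close> the coefficients of the \<open>g t i\<close>
    involve only the finitely many monomials in \<open>U\<close>, so finite linear algebra
    applies.\<close>
  define U where "U = {u. tdeg u + n = d}"
  have fU: "finite U" unfolding U_def by (rule finite_subset[OF _ finite_tdeg[of "d - n"]]) auto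
  define v where "v iu a = [:coef (mon (snd iu) * mon (pure n (fst iu))) a, - coef (mon (snd iu) * h (fst iu)) a:]"
    for iu :: "nat \<times> expo" and a
  let ?I = "{..<3} \<times> U"
  have "\<exists>e. \<forall>a. poly [:coef f' a:] t = (\<Sum>iu\<in>?I. e iu * poly (v iu a) t)" if t: "is_reduction (J t) I" for t
  proof -
    have "f \<in> ideal.span (g t ` {..<3})" using f t unfolding core_def J_def by blast
    then obtain q where q: "f = (\<Sum>i<3. q i * g t i)" using ideal_span_image_sum[of "{..<3}" f "g t"] by auto
    have "f' = (\<Sum>i<3. prj U (q i) * g t i)"
    proof -
      have *: "prj {u. tdeg u = d} (q i * g t i) = prj U (q i) * g t i" if "i < 3" for i
      proof (rule prj_mult)
        show "supp (g t i) \<subseteq> {u. tdeg u = n}"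
        proof
          fix u assume "u \<in> supp (g t i)"
          then have "u = pure n i \<or> u \<in> supp (h i)"
            by (auto simp: g_def in_keys_iff lookup_minus coef_mon split: if_splits simp del: split_paired_All)
          then show "u \<in> {u. tdeg u = n}" using supp_h[OF that] tdeg_G tdeg_pure by blast
        qed
      qed (simp add: U_def tdeg_add)
      show ?thesis unfolding f'_def q lessThan_3 by (simp add: prj_add *)
    qed
    also have "\<dots> = (\<Sum>i<3. \<Sum>u\<in>U. Const (coef (q i) u) * (mon u * g t i))"
    proof (rule sum.cong[OF refl])
      fix i
      have "prj U (q i) = (\<Sum>u\<in>U. Const (coef (q i) u) * mon u)"
        by (rule poly_mapping_eqI)
          (simp add: lookup_sum coef_mon if_distrib fU cong: if_cong)
      then show "prj U (q i) * g t i = (\<Sum>u\<in>U. Const (coef (q i) u) * (mon u * g t i))"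
        by (simp only: sum_distrib_right mult.assoc)
    qed
    also have "\<dots> = (\<Sum>iu\<in>?I. Const (coef (q (fst iu)) (snd iu)) * (mon (snd iu) * g t (fst iu)))"
      unfolding sum.cartesian_product by (simp add: case_prod_unfold)
    finally have f': "f' = \<dots>" .
    have "coef (mon u * g t i) a = poly (v (i, u) a) t" for i u a
      by (simp add: v_def g_def right_diff_distrib lookup_minus mult.left_commute[of "mon u" "Const t"])
    then have "poly [:coef f' a:] t = (\<Sum>iu\<in>?I. coef (q (fst iu)) (snd iu) * poly (v iu a) t)" for a
      by (subst f') (simp add: lookup_sum del: split_paired_All)
    then show ?thesis by (intro exI[of _ "\<lambda>iu. coef (q (fst iu)) (snd iu)"] allI)
  qed
  then have "UNIV - {t. \<not> is_reduction (J t) I} \<subseteq> {t. \<exists>e. \<forall>a. poly [:coef f' a:] t = (\<Sum>iu\<in>?I. e iu * poly (v iu a) t)}"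
    by blast
  moreover have "infinite (UNIV - {t. \<not> is_reduction (J t) I})"
    using inf finite_nonreductions by (simp add: Diff_infinite_finite)
  ultimately have "infinite {t. \<exists>e. \<forall>a. poly [:coef f' a:] t = (\<Sum>iu\<in>?I. e iu * poly (v iu a) t)}"
    using infinite_super by blast
  then obtain p e where p: "p \<noteq> 0" and e: "\<And>a. p * [:coef f' a:] = (\<Sum>iu\<in>?I. e iu * v iu a)"
    using generic_span[of ?I "\<lambda>a. [:coef f' a:]" v] fU by blast
  define q where "q i N = (\<Sum>u\<in>U. Const (poly.coeff (e (i, u)) N) * mon u)" for i N
  have "Const (poly.coeff p N) * f'
      = (\<Sum>i<3. q i N * mon (pure n i) - (case N of 0 \<Rightarrow> 0 | Suc N \<Rightarrow> q i N * h i))" for N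
  proof (rule poly_mapping_eqI)
    fix a
    have "coef (Const (poly.coeff p N) * f') a = poly.coeff (\<Sum>iu\<in>?I. e iu * v iu a) N"
      unfolding e[symmetric] by (simp add: mult_pCons_right mult.commute[of "poly.coeff p N"])
    also have "\<dots> = (\<Sum>i<3. \<Sum>u\<in>U. poly.coeff (e (i, u) * v (i, u) a) N)"
      by (simp add: coeff_sum sum.cartesian_product case_prod_unfold)
    also have "\<dots> = (\<Sum>i<3. coef (q i N * mon (pure n i) - (case N of 0 \<Rightarrow> 0 | Suc N \<Rightarrow> q i N * h i)) a)"
    proof (rule sum.cong[OF refl])
      fix i
      have 1: "coef (q i N * w) a = (\<Sum>u\<in>U. poly.coeff (e (i, u)) N * coef (mon u * w) a)" for w N
        by (simp add: q_def sum_distrib_right lookup_sum mult.assoc)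
      have "poly.coeff (e (i, u) * v (i, u) a) N = poly.coeff (e (i, u)) N * coef (mon u * mon (pure n i)) a
          - (case N of 0 \<Rightarrow> 0 | Suc N \<Rightarrow> poly.coeff (e (i, u)) N * coef (mon u * h i) a)" for u
        by (cases N) (simp_all add: v_def mult_pCons_right mult.commute)
      then show "(\<Sum>u\<in>U. poly.coeff (e (i, u) * v (i, u) a) N)
          = coef (q i N * mon (pure n i) - (case N of 0 \<Rightarrow> 0 | Suc N \<Rightarrow> q i N * h i)) a"
        by (cases N) (simp_all add: lookup_minus 1 sum_subtractf)
    qed
    finally show "coef (Const (poly.coeff p N) * f') a
        = coef (\<Sum>i<3. q i N * mon (pure n i) - (case N of 0 \<Rightarrow> 0 | Suc N \<Rightarrow> q i N * h i)) a"
      by (simp only: lookup_sum)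
  qed
  note rel = \<psi>_relation[OF this]
  \<comment> \<open>The lowest nonzero coefficient of \<open>p\<close> lets the coefficients of the
    series be shown to vanish one after another.\<close>
  define m where "m = (LEAST m. poly.coeff p m \<noteq> 0)"
  have "\<exists>m. poly.coeff p m \<noteq> 0" using p leading_coeff_neq_0 by blast
  then have m: "poly.coeff p m \<noteq> 0" unfolding m_def by (rule LeastI_ex)
  have less: "poly.coeff p M = 0" if "M < m" for M
    using not_less_Least[of M "\<lambda>m. poly.coeff p m \<noteq> 0"] that unfolding m_def by blast
  have "\<psi> N f' = 0"
  proof (induction N rule: less_induct)
    case (less N)
    have "poly.coeff p M * \<psi> (N + m - M) f' = (if M = m then poly.coeff p m * \<psi> N f' else 0)"
      if "M \<le> N + m" for M
    proof (cases M m rule: linorder_cases)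
      case greater
      then have "\<psi> (N + m - M) f' = 0" using that by (intro less) auto
      then show ?thesis using greater by simp
    qed (use \<open>\<And>M. M < m \<Longrightarrow> poly.coeff p M = 0\<close> in auto)
    then have "(\<Sum>M\<le>N + m. poly.coeff p M * \<psi> (N + m - M) f') = poly.coeff p m * \<psi> N f'"
      by (simp add: sum.delta)
    then show ?case using rel[of "N + m"] m by simp
  qed
  then show ?thesis unfolding f'_def .
qed

end

section \<open>Nonvanishing of residues\<close>

text \<open>In \<open>(a+1) C(m+a+1, a+1) = (m+a+1) C(m+a, a)\<close> the factors \<open>a+1\<close>
  and \<open>m+a+1\<close> contain the same power of \<open>p\<close>, as \<open>a+1 < p^t\<close>
  and \<open>p^t\<close> divides \<open>m\<close>.\<close>

lemma prime_not_dvd_choose: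
  fixes p :: nat
  assumes "prime p" "p ^ t dvd m" "a < p ^ t"
  shows "\<not> p dvd ((m + a) choose a)"
  using assms(3)
proof (induction a)
  case 0
  then show ?case using prime_gt_1_nat[OF assms(1)] by simp
next
  case (Suc a)
  define v where "v = multiplicity p (Suc a)"
  obtain x where x: "Suc a = p ^ v * x" "\<not> p dvd x"
    using multiplicity_decompose'[of "Suc a" p] assms(1) unfolding v_def
    by (metis nat.distinct(1) not_prime_unit)
  have "p ^ v \<le> Suc a" using x by (metis dvd_imp_le dvd_triv_left zero_less_Suc)
  then have "p ^ v < p ^ t" using Suc.prems by simp
  then have "v < t" using assms(1) prime_gt_1_nat power_strict_increasing_iff by blast
  then have "p ^ Suc v dvd m" using assms(2) by (meson Suc_leI dvd_trans le_imp_power_dvd)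
  then obtain y where y: "m = p ^ Suc v * y" by blast
  have "p ^ v * (x * (m + Suc a choose Suc a)) = Suc a * (Suc (m + a) choose Suc a)"
    by (simp add: x(1)[symmetric] mult.assoc[symmetric])
  also have "\<dots> = Suc (m + a) * (m + a choose a)"
    using Suc_times_binomial[of a "m + a"] by simp
  also have "Suc (m + a) = p ^ v * (p * y + x)"
    using x(1) y by (simp add: algebra_simps)
  finally have eq: "x * (m + Suc a choose Suc a) = (p * y + x) * (m + a choose a)"
    using assms(1) by (simp add: mult.assoc prime_gt_0_nat)
  show ?case
  proof
    assume "p dvd (m + Suc a choose Suc a)"
    then have "p dvd (p * y + x) * (m + a choose a)" unfolding eq[symmetric] by simp
    then have "p dvd p * y + x \<or> p dvd (m + a choose a)"
      using assms(1) prime_dvd_mult_iff by blast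
    then show False using Suc x(2) by (auto simp: dvd_add_right_iff)
  qed
qed

text \<open>Exponent vectors with multiplicities: a row prescribes one term in the multinomial
  expansion of a power of \<open>h i\<close>.\<close>

type_synonym row = "(expo \<times> nat) list"

definition esum :: "row \<Rightarrow> nat" where
  "esum gs = (\<Sum>(\<gamma>, e)\<leftarrow>gs. e)"

definition rmon :: "row \<Rightarrow> 'k::field poly3" where
  "rmon gs = (\<Prod>(\<gamma>, e)\<leftarrow>gs. mon \<gamma> ^ e)"

text \<open>The base-\<open>p\<close> expansions of the exponents in a row can be added without carries, so that the
  multinomial coefficient is not divisible by \<open>p\<close>.\<close>

fun no_carry :: "nat \<Rightarrow> row \<Rightarrow> bool" where
  "no_carry p [] \<longleftrightarrow> True"
| "no_carry p ((\<gamma>, e) # gs) \<longleftrightarrow> no_carry p gs \<and> \<not> p dvd ((esum gs + e) choose e)"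

lemma coef_of_nat_mult: "coef (of_nat m * f) u = of_nat m * coef f u"
proof -
  have "of_nat m = (Const (of_nat m) :: 'a poly3)" by (simp add: Const_def)
  then show ?thesis by (simp only: coef_Const_mult)
qed

text \<open>The coefficient is a polynomial in the scalar \<open>t\<close> put before the monomial
  \<open>\<gamma>\<close>. Absence of carries keeps the binomial coefficient at \<open>t^e\<close>
  nonzero in \<open>k\<close>, and an infinite field contains a nonroot.\<close>

lemma exists_row_power:
  fixes q :: "'k::field poly3"
  assumes inf: "infinite (UNIV :: 'k set)" and p: "\<And>m. of_nat m = (0 :: 'k) \<Longrightarrow> p dvd m"
    and "no_carry p gs" "coef (q * rmon gs) T \<noteq> 0"
  shows "\<exists>h. supp h \<subseteq> fst ` set gs \<and> coef (q * h ^ esum gs) T \<noteq> 0"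
  using assms(3,4)
proof (induction gs arbitrary: q)
  case Nil
  then show ?case by (intro exI[of _ 0]) (simp add: esum_def rmon_def)
next
  case (Cons \<gamma>e gs)
  obtain \<gamma> e where \<gamma>e: "\<gamma>e = (\<gamma>, e)" by (cases \<gamma>e)
  have "coef (q * mon \<gamma> ^ e * rmon gs) T \<noteq> 0"
    using Cons.prems(2) by (simp add: \<gamma>e rmon_def mult.assoc)
  then obtain h where h: "supp h \<subseteq> fst ` set gs" "coef (q * mon \<gamma> ^ e * h ^ esum gs) T \<noteq> 0"
    using Cons.IH[of "q * mon \<gamma> ^ e"] Cons.prems(1) by (auto simp: \<gamma>e)
  let ?m = "esum gs + e"
  define w where "w i = of_nat (?m choose i) * coef (q * mon \<gamma> ^ i * h ^ (?m - i)) T" for i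
  have "\<not> p dvd (?m choose e)" using Cons.prems(1) by (simp add: \<gamma>e)
  then have "w e \<noteq> 0" using h(2) p[of "?m choose e"] by (auto simp: w_def)
  then obtain t where t: "(\<Sum>i\<le>?m. w i * t ^ i) \<noteq> 0"
    using infinite_field_nonroot[OF inf, of e ?m w] by auto
  have eq: "q * (Const t * mon \<gamma> + h) ^ ?m
      = (\<Sum>i\<le>?m. of_nat (?m choose i) * (Const (t ^ i) * (q * mon \<gamma> ^ i * h ^ (?m - i))))"
    unfolding binomial_ring sum_distrib_left
    by (rule sum.cong) (simp_all add: power_mult_distrib Const_power ac_simps)
  have "coef (q * (Const t * mon \<gamma> + h) ^ ?m) T = (\<Sum>i\<le>?m. w i * t ^ i)"
    unfolding eq lookup_sum coef_of_nat_mult coef_Const_mult w_def by (simp add: mult_ac)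
  moreover have "supp (Const t * mon \<gamma> + h) \<subseteq> fst ` set (\<gamma>e # gs)"
    using keys_add[of "Const t * mon \<gamma>" h] supp_Const_mult[of t "mon \<gamma>"] h(1) by (auto simp: \<gamma>e)
  moreover have "esum (\<gamma>e # gs) = ?m" by (simp add: esum_def \<gamma>e)
  ultimately show ?case using t by metis
qed

lemma sum_tdeg: "(\<Sum>e\<in>{e. tdeg e = N}. \<phi> e) = (\<Sum>i\<le>N. \<Sum>j\<le>N. if i + j \<le> N then \<phi> (i, j, N - i - j) else 0)"
proof -
  have "(\<Sum>i\<le>N. \<Sum>j\<le>N. if i + j \<le> N then \<phi> (i, j, N - i - j) else 0)
      = (\<Sum>ij\<in>{..N} \<times> {..N}. if fst ij + snd ij \<le> N then \<phi> (fst ij, snd ij, N - fst ij - snd ij) else 0)"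
    unfolding sum.cartesian_product by (simp add: case_prod_unfold)
  also have "\<dots> = (\<Sum>ij\<in>{ij \<in> {..N} \<times> {..N}. fst ij + snd ij \<le> N}. \<phi> (fst ij, snd ij, N - fst ij - snd ij))"
    by (subst sum.inter_filter) simp_all
  also have "\<dots> = (\<Sum>e\<in>{e. tdeg e = N}. \<phi> e)"
    by (rule sum.reindex_bij_witness[of _ "\<lambda>(i, j, l). (i, j)" "\<lambda>(i, j). (i, j, N - i - j)"]) auto
  finally show ?thesis ..
qed

text \<open>Scaling weights the summand at \<open>(a, b, l')\<close> by \<open>s^a t^b\<close>. The
  total degree being fixed, distinct summands get distinct weights and cannot cancel for all
  \<open>s\<close> and \<open>t\<close>.\<close>

lemma residue_scale_nonzero:
  fixes h :: "nat \<Rightarrow> 'k::field poly3"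
  assumes inf: "infinite (UNIV :: 'k set)"
    and nz: "coef (f * hpow h (i, j, l)) (target n (i, j, l)) \<noteq> 0"
  shows "\<exists>s t. residue n (h(0 := Const s * h 0, Suc 0 := Const t * h (Suc 0))) (i + j + l) f \<noteq> 0"
proof -
  let ?N = "i + j + l"
  define \<phi> where "\<phi> e = coef (f * hpow h e) (target n e)" for e
  define w where "w a b = (if a + b \<le> ?N then \<phi> (a, b, ?N - a - b) else 0)" for a b
  have "w i j \<noteq> 0" using nz by (simp add: w_def \<phi>_def)
  then obtain t where t: "(\<Sum>b\<le>?N. w i b * t ^ b) \<noteq> 0"
    using infinite_field_nonroot[OF inf, of j ?N "w i"] by auto
  then obtain s where s: "(\<Sum>a\<le>?N. (\<Sum>b\<le>?N. w a b * t ^ b) * s ^ a) \<noteq> 0"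
    using infinite_field_nonroot[OF inf, of i ?N "\<lambda>a. \<Sum>b\<le>?N. w a b * t ^ b"] by auto
  let ?h = "h(0 := Const s * h 0, Suc 0 := Const t * h (Suc 0))"
  have "coef (f * hpow ?h (a, b, l')) (target n (a, b, l')) = \<phi> (a, b, l') * t ^ b * s ^ a" for a b l'
  proof -
    have eq: "f * hpow ?h (a, b, l') = Const (s ^ a * t ^ b) * (f * hpow h (a, b, l'))"
      by (simp add: power_mult_distrib Const_mult Const_power mult_ac)
    show ?thesis unfolding \<phi>_def eq coef_Const_mult by simp
  qed
  then have "residue n ?h ?N f = (\<Sum>a\<le>?N. (\<Sum>b\<le>?N. w a b * t ^ b) * s ^ a)"
    unfolding residue_def sum_tdeg sum_distrib_right w_def by (intro sum.cong refl) simp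
  then show ?thesis using s by metis
qed

theorem residue_nonzero:
  fixes f :: "'k::field poly3" and r :: "nat \<Rightarrow> row"
  assumes inf: "infinite (UNIV :: 'k set)" and p: "\<And>m. of_nat m = (0 :: 'k) \<Longrightarrow> p dvd m"
    and r: "\<And>i. i < 3 \<Longrightarrow> no_carry p (r i)"
    and nz: "coef (f * rmon (r 0) * rmon (r 1) * rmon (r 2)) (target n (esum (r 0), esum (r 1), esum (r 2))) \<noteq> 0"
  shows "\<exists>h N. (\<forall>i<3. supp (h i) \<subseteq> fst ` set (r i)) \<and> residue n h N f \<noteq> 0"
proof -
  let ?T = "target n (esum (r 0), esum (r 1), esum (r 2))"
  note row = exists_row_power[OF inf p]
  obtain h2 where h2: "supp h2 \<subseteq> fst ` set (r 2)"
      "coef (f * rmon (r 0) * rmon (r 1) * h2 ^ esum (r 2)) ?T \<noteq> 0"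
    using row[OF _ r[of 2] nz] by auto
  then have "coef (f * rmon (r 0) * h2 ^ esum (r 2) * rmon (r 1)) ?T \<noteq> 0" by (simp add: mult_ac)
  then obtain h1 where h1: "supp h1 \<subseteq> fst ` set (r 1)"
      "coef (f * rmon (r 0) * h2 ^ esum (r 2) * h1 ^ esum (r 1)) ?T \<noteq> 0"
    using row[OF _ r[of 1]] by (metis one_less_numeral_iff semiring_norm(77))
  then have "coef (f * h2 ^ esum (r 2) * h1 ^ esum (r 1) * rmon (r 0)) ?T \<noteq> 0" by (simp add: mult_ac)
  then obtain h0 where h0: "supp h0 \<subseteq> fst ` set (r 0)"
      "coef (f * h2 ^ esum (r 2) * h1 ^ esum (r 1) * h0 ^ esum (r 0)) ?T \<noteq> 0"
    using row[OF _ r[of 0]] by (metis zero_less_numeral)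
  define h where "h i = (if i = 0 then h0 else if i = 1 then h1 else h2)" for i :: nat
  have "f * h2 ^ esum (r 2) * h1 ^ esum (r 1) * h0 ^ esum (r 0) = f * hpow h (esum (r 0), esum (r 1), esum (r 2))"
    by (simp add: h_def mult_ac)
  then have "coef (f * hpow h (esum (r 0), esum (r 1), esum (r 2))) ?T \<noteq> 0" using h0(2) by (simp only: not_False_eq_True)
  from residue_scale_nonzero[OF inf this] obtain s t
    where st: "residue n (h(0 := Const s * h 0, Suc 0 := Const t * h (Suc 0))) (esum (r 0) + esum (r 1) + esum (r 2)) f \<noteq> 0"
    by blast
  have "\<forall>i<3. supp ((h(0 := Const s * h 0, Suc 0 := Const t * h (Suc 0))) i) \<subseteq> fst ` set (r i)"
  proof (intro allI impI)
    fix i :: nat assume "i < 3"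
    then show "supp ((h(0 := Const s * h 0, Suc 0 := Const t * h (Suc 0))) i) \<subseteq> fst ` set (r i)"
      using h0(1) h1(1) h2(1) supp_Const_mult[of s h0] supp_Const_mult[of t h1]
      by (auto dest!: less_3_cases simp: h_def)
  qed
  then show ?thesis using st by blast
qed

section \<open>Lattices spanned by the exponents\<close>

lemma Gcd_in_subgroup:
  fixes H :: "int set"
  assumes "finite A" "\<And>j. j \<in> A \<Longrightarrow> int j \<in> H" "0 \<in> H"
    and add: "\<And>x y. x \<in> H \<Longrightarrow> y \<in> H \<Longrightarrow> x + y \<in> H"
    and uminus: "\<And>x. x \<in> H \<Longrightarrow> - x \<in> H"
  shows "int (Gcd A) \<in> H"
  using assms(1,2)
proof (induction A rule: finite_induct)
  case (insert j A)
  have nat: "int m * x \<in> H" if "x \<in> H" for m x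
    using that assms(3) add by (induction m) (auto simp: distrib_right)
  have mult: "m * x \<in> H" if "x \<in> H" for m x
  proof (cases m rule: int_cases2)
    case (nonpos i)
    then show ?thesis using uminus[OF nat[OF that, of i]] by simp
  qed (use nat[OF that] in simp)
  obtain u v where "u * int j + v * int (Gcd A) = gcd (int j) (int (Gcd A))"
    using bezout_int by blast
  moreover have "u * int j + v * int (Gcd A) \<in> H"
    using insert by (intro add mult) auto
  ultimately show ?case by (simp add: gcd_int_int_eq)
qed (use assms(3) in simp)

lemma Gcd_reflect:
  assumes "A \<subseteq> {0..n}"
  shows "Gcd (insert n ((\<lambda>k. n - k) ` A)) = Gcd (insert n A :: nat set)"
proof -
  have "d dvd Gcd (insert n ((\<lambda>k. n - k) ` A)) \<longleftrightarrow> d dvd Gcd (insert n A)" for d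
    unfolding dvd_Gcd_iff using assms
    by (auto intro: dvd_diff_nat) (metis atLeastAtMost_iff diff_diff_cancel dvd_diff_nat subsetD)
  then show ?thesis by (metis dvd_antisym dvd_refl)
qed

text \<open>The three edge lattices of the triangle, generated by \<open>g\<^sub>0\<^sub>1(\<epsilon>\<^sub>1 - \<epsilon>\<^sub>0)\<close>, \<open>g\<^sub>0\<^sub>2(\<epsilon>\<^sub>2 - \<epsilon>\<^sub>0)\<close> and
  \<open>g\<^sub>1\<^sub>2(\<epsilon>\<^sub>2 - \<epsilon>\<^sub>1)\<close>, span the lattice of \<open>S\<close>.\<close>

lemma edge_lattice:
  fixes g01 g02 g12 :: nat and x1 x2 :: int
  assumes "coprime g01 g02" "int (gcd g01 g12) dvd x1" "int (gcd g02 g12) dvd x2"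
  obtains u t w where "x1 = int g01 * u - int g12 * w" "x2 = int g02 * t + int g12 * w"
proof -
  obtain u0 w0 where 1: "u0 * int g01 + w0 * int g12 = int (gcd g01 g12)"
    using bezout_int[of "int g01" "int g12"] by (auto simp: gcd_int_int_eq)
  obtain y where y: "x1 = int (gcd g01 g12) * y" using assms(2) by blast
  define u1 w1 where "u1 = y * u0" and "w1 = - (y * w0)"
  have x1: "x1 = int g01 * u1 - int g12 * w1"
    unfolding y 1[symmetric] u1_def w1_def by (simp add: algebra_simps)
  have "gcd (int g02) (int g12 * int g01) = gcd (int g02) (int g12)"
    using assms(1) by (simp add: gcd_mult_right_right_cancel coprime_commute)
  moreover have "int (gcd g02 g12) dvd x2 - int g12 * w1"
    using assms(3) by (auto intro!: dvd_diff dvd_mult2)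
  moreover obtain t0 s0 where "t0 * int g02 + s0 * (int g12 * int g01) = gcd (int g02) (int g12 * int g01)"
    using bezout_int by blast
  ultimately obtain t0 s0 z where 2: "t0 * int g02 + s0 * (int g12 * int g01) = gcd (int g02) (int g12)"
      and z: "x2 - int g12 * w1 = gcd (int g02) (int g12) * z"
    by (metis dvdE gcd_int_int_eq)
  show thesis
  proof
    show "x1 = int g01 * (u1 + int g12 * (z * s0)) - int g12 * (w1 + int g01 * (z * s0))"
      unfolding x1 by (simp add: algebra_simps)
    have "x2 = int g12 * w1 + (t0 * int g02 + s0 * (int g12 * int g01)) * z"
      using z 2 by simp
    then show "x2 = int g02 * (z * t0) + int g12 * (w1 + int g01 * (z * s0))"
      by (simp add: algebra_simps)
  qed
qed

lemma prime_not_dvd_Gcd_quotient: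
  assumes "\<not> p dvd Gcd A div d" "d dvd Gcd A" "d > (0::nat)"
  obtains k where "k \<in> A" "\<not> p * d dvd k"
proof -
  have "\<not> p * d dvd Gcd A"
    using assms by (metis dvd_div_iff_mult less_not_refl mult.commute)
  then show thesis using that by (auto simp: dvd_Gcd_iff)
qed

text \<open>By the inequality of valuations the full \<open>p\<close>-part of \<open>x\<close>
  divides the gcd.\<close>

lemma prime_not_dvd_div_gcd:
  fixes p x y :: nat
  assumes "prime p" "x > 0" "multiplicity p x \<le> multiplicity p y" "y > 0"
  shows "\<not> p dvd x div gcd x y"
proof
  let ?q = "p ^ multiplicity p x"
  have "?q dvd y" using assms(3) by (meson dvd_trans le_imp_power_dvd multiplicity_dvd)
  then have q: "?q dvd gcd x y" by (simp add: multiplicity_dvd)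
  assume "p dvd x div gcd x y"
  then have "gcd x y * p dvd x" using assms(2) by (metis dvd_div_iff_mult gcd_dvd1 gcd_pos_nat mult.commute not_gr_zero)
  then have "?q * p dvd x" using q by (meson dvd_trans mult_dvd_mono dvd_refl)
  then have "Suc (multiplicity p x) \<le> multiplicity p x"
    using assms(1,2) by (intro multiplicity_geI) (auto simp: mult.commute not_prime_unit)
  then show False by simp
qed

text \<open>The numbers \<open>k\<close> and \<open>l\<close> are the lattice steps of two monomials on the edges \<open>OP\<close> and \<open>OQ\<close> of
  the triangle. Together with the step \<open>n(\<epsilon>\<^sub>Q - \<epsilon>\<^sub>P)\<close>, a positive multiple of which undoes both, they
  generate a group of index prime to \<open>p\<close>; the remaining cosets are reached by the list \<open>gs\<close>,
  whose members are given the exponents \<open>1, q, q\<^sup>2, \<dots>\<close> for a power \<open>q\<close> of \<open>p\<close>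
  that is congruent to 1 modulo the index.\<close>

lemma carry_free_representation:
  fixes p k l n dP dQ :: nat and xP xQ :: int
  assumes p: "prime p" and n: "n > 0"
    and k: "dP dvd k" "\<not> p * dP dvd k" and l: "dQ dvd l" "\<not> p * dQ dvd l" and d: "dP > 0" "dQ > 0"
    and gs: "\<And>\<gamma>. \<gamma> \<in> set gs \<Longrightarrow> int dP dvd fst \<gamma>" "\<And>\<gamma>. \<gamma> \<in> set gs \<Longrightarrow> int dQ dvd snd \<gamma>"
    and xP: "int k dvd xP - (\<Sum>\<gamma>\<leftarrow>gs. fst \<gamma>)" and xQ: "int l dvd xQ - (\<Sum>\<gamma>\<leftarrow>gs. snd \<gamma>)"
  obtains r A B C where "r > 0" "(p ^ r) ^ length gs dvd C"
    "xP = int A * int k - int C * int n + (\<Sum>i<length gs. int ((p ^ r) ^ i) * fst (gs ! i))"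
    "xQ = int C * int n - int B * int l + (\<Sum>i<length gs. int ((p ^ r) ^ i) * snd (gs ! i))"
proof -
  obtain k' l' where k': "k = dP * k'" and l': "l = dQ * l'" using k(1) l(1) by blast
  define x where "x = k' * l'"
  have "\<not> p dvd k'" "\<not> p dvd l'" using k(2) l(2) unfolding k' l' by (auto simp: mult.commute)
  then have cop: "coprime p x" using p unfolding x_def
    by (metis coprime_mult_right_iff prime_imp_coprime)
  have kl: "k > 0" "l > 0" using k(2) l(2) by (auto intro!: Nat.gr0I)
  then have "x > 0" by (auto simp: x_def k' l')
  define r where "r = totient x"
  \<comment> \<open>By Euler's theorem \<open>q = p^r\<close> is 1 modulo \<open>x\<close>, so
    weighting the members of \<open>gs\<close> by powers of \<open>q\<close> does not change their
    sums modulo \<open>k\<close> and \<open>l\<close>.\<close>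
  have r: "r > 0" using \<open>x > 0\<close> by (simp add: r_def)
  define q where "q = p ^ r"
  have "[q = 1] (mod x)" unfolding q_def r_def using cop by (rule euler_theorem)
  then have "[q ^ i = 1 ^ i] (mod x)" for i by (rule cong_pow)
  then have "int x dvd int (q ^ i) - 1" for i
    by (metis cong_iff_dvd_diff cong_int_iff of_nat_1 power_one)
  have step: "int (y * d) dvd (\<Sum>i<length gs. int (q ^ i) * f (gs ! i)) - (\<Sum>\<gamma>\<leftarrow>gs. f \<gamma>)"
    if "\<And>\<gamma>. \<gamma> \<in> set gs \<Longrightarrow> int d dvd f \<gamma>" "y dvd x" for y d and f :: "int \<times> int \<Rightarrow> int"
  proof -
    have "(\<Sum>i<length gs. int (q ^ i) * f (gs ! i)) - (\<Sum>\<gamma>\<leftarrow>gs. f \<gamma>)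
        = (\<Sum>i<length gs. (int (q ^ i) - 1) * f (gs ! i))"
      by (simp add: sum_list_sum_nth atLeast0LessThan left_diff_distrib sum_subtractf)
    also have "int (y * d) dvd \<dots>"
    proof (rule dvd_sum)
      fix i assume "i \<in> {..<length gs}"
      then have "int d dvd f (gs ! i)" using that(1) by simp
      moreover have "int y dvd int (q ^ i) - 1"
        using \<open>\<And>i. int x dvd int (q ^ i) - 1\<close>[of i] that(2) by (meson dvd_trans int_dvd_int_iff)
      ultimately show "int (y * d) dvd (int (q ^ i) - 1) * f (gs ! i)"
        unfolding of_nat_mult by (intro mult_dvd_mono)
    qed
    finally show ?thesis .
  qed
  define sP sQ where "sP = (\<Sum>i<length gs. int (q ^ i) * fst (gs ! i))"
    and "sQ = (\<Sum>i<length gs. int (q ^ i) * snd (gs ! i))"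
  have "int k dvd sP - (\<Sum>\<gamma>\<leftarrow>gs. fst \<gamma>)" "int l dvd sQ - (\<Sum>\<gamma>\<leftarrow>gs. snd \<gamma>)"
    using step[of dP fst k'] step[of dQ snd l'] gs unfolding sP_def sQ_def k' l'
    by (simp_all add: x_def mult.commute)
  then have "int k dvd xP - sP" "int l dvd sQ - xQ"
    using dvd_diff[OF xP] dvd_diff[OF _ xQ] by (metis diff_diff_eq2 diff_add_cancel add_diff_eq add_diff_cancel_right diff_diff_add)+
  then obtain a b where a: "xP - sP = int k * a" and b: "sQ - xQ = int l * b" by blast
  define M where "M = nat \<bar>a\<bar> + nat \<bar>b\<bar>"
  define Q where "Q = q ^ length gs"
  have "Q > 0" using p by (simp add: Q_def q_def prime_gt_0_nat)
  have big: "int M \<le> int (M * l * n * Q)" "int M \<le> int (M * k * n * Q)"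
    using kl n \<open>Q > 0\<close> by (simp_all only: of_nat_le_iff) simp_all
  have ab: "\<bar>a\<bar> \<le> int M" "\<bar>b\<bar> \<le> int M" by (simp_all add: M_def)
  \<comment> \<open>The added terms cancel in both equations and make \<open>A\<close> and
    \<open>B\<close> nonnegative; the factor \<open>Q\<close> of \<open>C\<close> prevents
    carries.\<close>
  define A B C where "A = nat (a + int (M * l * n * Q))" and "B = nat (b + int (M * k * n * Q))"
    and "C = M * k * l * Q"
  have AB: "int A = a + int (M * l * n * Q)" "int B = b + int (M * k * n * Q)"
    using big ab unfolding A_def B_def by linarith+
  show thesis
  proof (rule that[OF r])
    show "(p ^ r) ^ length gs dvd C" by (simp add: C_def Q_def q_def)
    show "xP = int A * int k - int C * int n + (\<Sum>i<length gs. int ((p ^ r) ^ i) * fst (gs ! i))"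
      unfolding q_def[symmetric] sP_def[symmetric] AB C_def using a by (simp add: algebra_simps)
    show "xQ = int C * int n - int B * int l + (\<Sum>i<length gs. int ((p ^ r) ^ i) * snd (gs ! i))"
      unfolding q_def[symmetric] sQ_def[symmetric] AB C_def using b by (simp add: algebra_simps)
  qed
qed

text \<open>Modulo \<open>k\<close> and \<open>l\<close> the semigroup generated by \<open>\<Gamma>\<close> is a group.\<close>

definition reach :: "(int \<times> int) set \<Rightarrow> nat \<Rightarrow> nat \<Rightarrow> (int \<times> int) set" where
  "reach \<Gamma> k l = {(x, y). \<exists>gs. set gs \<subseteq> \<Gamma> \<and> int k dvd x - (\<Sum>\<gamma>\<leftarrow>gs. fst \<gamma>) \<and> int l dvd y - (\<Sum>\<gamma>\<leftarrow>gs. snd \<gamma>)}"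

lemma reach_base: "\<gamma> \<in> \<Gamma> \<Longrightarrow> \<gamma> \<in> reach \<Gamma> k l"
  by (cases \<gamma>) (auto simp: reach_def intro!: exI[of _ "[\<gamma>]"])

lemma reach_0: "0 \<in> reach \<Gamma> k l"
  by (auto simp: reach_def zero_prod_def intro!: exI[of _ "[]"])

lemma reach_add:
  assumes "u \<in> reach \<Gamma> k l" "v \<in> reach \<Gamma> k l" shows "u + v \<in> reach \<Gamma> k l"
proof -
  obtain x y x' y' where u: "u = (x, y)" and v: "v = (x', y')" by (cases u, cases v) blast
  obtain gs where gs: "set gs \<subseteq> \<Gamma>" "int k dvd x - (\<Sum>\<gamma>\<leftarrow>gs. fst \<gamma>)" "int l dvd y - (\<Sum>\<gamma>\<leftarrow>gs. snd \<gamma>)"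
    using assms(1) unfolding u reach_def by blast
  obtain gs' where gs': "set gs' \<subseteq> \<Gamma>" "int k dvd x' - (\<Sum>\<gamma>\<leftarrow>gs'. fst \<gamma>)" "int l dvd y' - (\<Sum>\<gamma>\<leftarrow>gs'. snd \<gamma>)"
    using assms(2) unfolding v reach_def by blast
  have "x + x' - (\<Sum>\<gamma>\<leftarrow>gs @ gs'. fst \<gamma>) = (x - (\<Sum>\<gamma>\<leftarrow>gs. fst \<gamma>)) + (x' - (\<Sum>\<gamma>\<leftarrow>gs'. fst \<gamma>))"
    "y + y' - (\<Sum>\<gamma>\<leftarrow>gs @ gs'. snd \<gamma>) = (y - (\<Sum>\<gamma>\<leftarrow>gs. snd \<gamma>)) + (y' - (\<Sum>\<gamma>\<leftarrow>gs'. snd \<gamma>))"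
    by simp_all
  then have "set (gs @ gs') \<subseteq> \<Gamma> \<and> int k dvd x + x' - (\<Sum>\<gamma>\<leftarrow>gs @ gs'. fst \<gamma>) \<and> int l dvd y + y' - (\<Sum>\<gamma>\<leftarrow>gs @ gs'. snd \<gamma>)"
    using gs gs' by (simp only: dvd_add set_append Un_subset_iff simp_thms)
  then show ?thesis unfolding u v reach_def by (simp only: add_Pair mem_Collect_eq prod.case) blast
qed

lemma reach_mult_nat: "(x, y) \<in> reach \<Gamma> k l \<Longrightarrow> (int m * x, int m * y) \<in> reach \<Gamma> k l"
proof (induction m)
  case 0
  then show ?case using reach_0 by (simp add: zero_prod_def)
next
  case (Suc m)
  then show ?case using reach_add[of "(x, y)" \<Gamma> k l "(int m * x, int m * y)"] by (simp add: distrib_right)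
qed

lemma reach_shift: "(x, y) \<in> reach \<Gamma> k l \<Longrightarrow> int k dvd x' - x \<Longrightarrow> int l dvd y' - y \<Longrightarrow> (x', y') \<in> reach \<Gamma> k l"
  unfolding reach_def by (auto, metis diff_add_cancel dvd_add add_diff_eq)

lemma reach_mult:
  assumes "k > 0" "l > 0" "(x, y) \<in> reach \<Gamma> k l" shows "(m * x, m * y) \<in> reach \<Gamma> k l"
proof (rule reach_shift)
  define m' where "m' = nat (m + \<bar>m\<bar> * (int k * int l))"
  have "- m \<le> \<bar>m\<bar> * 1" by simp
  also have "\<bar>m\<bar> * 1 \<le> \<bar>m\<bar> * (int k * int l)"
    using assms by (intro mult_left_mono) (simp_all add: int_one_le_iff_zero_less)
  finally have m': "int m' = m + \<bar>m\<bar> * (int k * int l)" unfolding m'_def by simp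
  show "(int m' * x, int m' * y) \<in> reach \<Gamma> k l" by (rule reach_mult_nat[OF assms(3)])
  show "int k dvd m * x - int m' * x" "int l dvd m * y - int m' * y"
    unfolding m' by (simp_all add: algebra_simps)
qed

section \<open>Rows of exponents that reach the target\<close>

fun cmp :: "nat \<Rightarrow> expo \<Rightarrow> nat" where
  "cmp k (i, j, l) = (if k = 0 then i else if k = 1 then j else l)"

definition rsum :: "nat \<Rightarrow> row \<Rightarrow> nat" where
  "rsum k gs = (\<Sum>(\<gamma>, e)\<leftarrow>gs. e * cmp k \<gamma>)"

lemma mon_power_expo: "mon (i, j, l) ^ e = mon (e * i, e * j, e * l)"
proof (induction e)
  case 0
  then show ?case using mon_0 by (simp add: zero_prod_def)
qed (simp add: mon_add[symmetric])

lemma rmon_eq: "rmon gs = mon (rsum 0 gs, rsum 1 gs, rsum 2 gs)"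
proof (induction gs)
  case Nil
  then show ?case using mon_0 by (simp add: rmon_def rsum_def zero_prod_def)
next
  case (Cons \<gamma>e gs)
  obtain \<gamma> e where \<gamma>e: "\<gamma>e = (\<gamma>, e)" by (cases \<gamma>e)
  obtain i j l where "\<gamma> = (i, j, l)" by (cases \<gamma>)
  then show ?case using Cons \<gamma>e by (simp add: rmon_def rsum_def mon_power_expo mon_add[symmetric])
qed

text \<open>For \<open>q\<close> at least 2 each exponent exceeds the sum of all later ones, which
  excludes carries when \<open>q\<close> is a power of \<open>p\<close>.\<close>

fun power_row :: "nat \<Rightarrow> expo list \<Rightarrow> row" where
  "power_row q [] = []"
| "power_row q (\<gamma> # gs) = (\<gamma>, q ^ length gs) # power_row q gs"

lemma power_row_sum:
  "(\<Sum>(\<gamma>, e)\<leftarrow>power_row q (rev gs). e * f \<gamma>) = (\<Sum>i<length gs. q ^ i * f (gs ! i))"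
proof (induction gs rule: rev_induct)
  case (snoc \<gamma> gs)
  have "(\<Sum>i<length gs. q ^ i * f ((gs @ [\<gamma>]) ! i)) = (\<Sum>i<length gs. q ^ i * f (gs ! i))"
    by (rule sum.cong) (simp_all add: nth_append)
  then show ?case using snoc by simp
qed simp

lemma set_power_row: "fst ` set (power_row q gs) = set gs"
  by (induction gs) auto

lemma esum_power_row: "q \<ge> 2 \<Longrightarrow> esum (power_row q gs) < q ^ length gs"
proof (induction gs)
  case (Cons \<gamma> gs)
  then have "q ^ length gs + esum (power_row q gs) < 2 * q ^ length gs" by simp
  also have "\<dots> \<le> q * q ^ length gs" using Cons.prems by (rule mult_le_mono1)
  finally show ?case by (simp add: esum_def)
qed (simp add: esum_def)

lemma no_carry_power_row:
  assumes "prime p" "r > 0" "(p ^ r) ^ length gs dvd m"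
  shows "no_carry p ((\<gamma>, m) # power_row (p ^ r) gs)"
proof -
  have q: "p ^ r \<ge> 2"
    using assms(1,2) by (metis le_trans prime_ge_2_nat self_le_power prime_ge_1_nat)
  have *: "\<not> p dvd ((esum (power_row (p ^ r) gs) + m) choose m)" if "(p ^ r) ^ length gs dvd m" for gs m
  proof -
    have "(esum (power_row (p ^ r) gs) + m) choose m = (m + esum (power_row (p ^ r) gs)) choose esum (power_row (p ^ r) gs)"
      using binomial_symmetric[of m "esum (power_row (p ^ r) gs) + m"] by (simp add: add.commute)
    then show ?thesis
      using prime_not_dvd_choose[OF assms(1), of "r * length gs" m] that esum_power_row[OF q, of gs]
      by (simp add: power_mult)
  qed
  have "no_carry p (power_row (p ^ r) gs)"
    by (induction gs) (simp_all add: *)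
  then show ?thesis using * assms(3) by simp
qed

lemma tdeg_cmp: "(O', P, Q) \<in> {(0, 1, 2), (1, 2, 0), (2, 0, 1)} \<Longrightarrow> tdeg \<gamma> = cmp O' \<gamma> + cmp P \<gamma> + cmp Q \<gamma>"
  by (cases \<gamma>) auto

lemma cmp_pure: "i < 3 \<Longrightarrow> j < 3 \<Longrightarrow> cmp i (pure n j) = (if i = j then n else 0)"
  by (auto dest!: less_3_cases simp: pure_0 pure_1 pure_2)

text \<open>One use of \<open>\<gamma>\<close> in row \<open>i\<close> moves the exponent by
  \<open>\<gamma> - n \<epsilon>_i\<close>, and the moves must lead from \<open>s\<close> to
  \<open>(n-1, n-1, n-1)\<close>. The degree settles coordinate \<open>O'\<close>. Row
  \<open>O'\<close> moves along \<open>OP\<close>, row \<open>Q\<close> along \<open>OQ\<close>, and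
  row \<open>P\<close> makes the moves from \<open>P\<close> to \<open>Q\<close> and those of
  \<open>gs\<close>.\<close>

lemma exists_rows:
  fixes \<Gamma> :: "expo set" and s :: expo
  assumes p: "prime p" and n: "n > 0"
    and perm: "(O', P, Q) \<in> {(0, 1, 2), (1, 2, 0), (2, 0, 1 :: nat)}"
    and pure: "pure n ` {..<3} \<subseteq> \<Gamma>" and tdeg: "\<And>\<gamma>. \<gamma> \<in> \<Gamma> \<Longrightarrow> tdeg \<gamma> = n"
    and OP: "finite KOP" "\<And>j. j \<in> KOP \<Longrightarrow> \<exists>\<gamma>\<in>\<Gamma>. cmp P \<gamma> = j \<and> cmp Q \<gamma> = 0"
    and OQ: "finite KOQ" "\<And>j. j \<in> KOQ \<Longrightarrow> \<exists>\<gamma>\<in>\<Gamma>. cmp Q \<gamma> = j \<and> cmp P \<gamma> = 0"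
    and PQ: "finite KPQ" "\<And>j. j \<in> KPQ \<Longrightarrow> \<exists>\<gamma>\<in>\<Gamma>. cmp Q \<gamma> = j \<and> cmp O' \<gamma> = 0"
    and g: "gOP = Gcd KOP" "gOQ = Gcd KOQ" "gPQ = Gcd KPQ" "gOP > 0" "gOQ > 0"
    and d: "dP = gcd gOP gPQ" "dQ = gcd gOQ gPQ"
    and dvd: "\<And>\<gamma>. \<gamma> \<in> \<Gamma> \<Longrightarrow> dP dvd cmp P \<gamma>" "\<And>\<gamma>. \<gamma> \<in> \<Gamma> \<Longrightarrow> dQ dvd cmp Q \<gamma>"
    and good: "\<not> p dvd gOP div dP" "\<not> p dvd gOQ div dQ"
    and xP: "int n - 1 - int (cmp P s) = int gOP * u - int gPQ * w"
    and xQ: "int n - 1 - int (cmp Q s) = int gOQ * t + int gPQ * w"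
    and s: "tdeg s = 3 * n - 3"
  obtains r where "\<And>i. i < 3 \<Longrightarrow> fst ` set (r i) \<subseteq> \<Gamma>" "\<And>i. i < 3 \<Longrightarrow> no_carry p (r i)"
    "\<And>k. k < 3 \<Longrightarrow> cmp k s + rsum k (r 0) + rsum k (r 1) + rsum k (r 2) = n - 1 + n * esum (r k)"
proof -
  have lt: "O' < 3" "P < 3" "Q < 3" and ne: "O' \<noteq> P" "O' \<noteq> Q" "P \<noteq> Q" using perm by auto
  have pures: "pure n O' \<in> \<Gamma>" "pure n P \<in> \<Gamma>" "pure n Q \<in> \<Gamma>" using pure lt by auto
  note deg = tdeg_cmp[OF perm]
  have dpos: "dP > 0" "dQ > 0" unfolding d using g(4,5) by simp_all
  have dn: "dP dvd n" "dQ dvd n"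
    using dvd(1)[OF pures(2)] dvd(2)[OF pures(3)] lt by (simp_all add: cmp_pure)
  obtain k where k: "k \<in> KOP" "\<not> p * dP dvd k"
    using prime_not_dvd_Gcd_quotient[of p KOP dP] good d g dpos by auto
  then obtain \<alpha> where \<alpha>: "\<alpha> \<in> \<Gamma>" "cmp P \<alpha> = k" "cmp Q \<alpha> = 0" using OP by blast
  \<comment> \<open>The move from \<open>Q\<close> towards \<open>O'\<close> has length
    \<open>cmp O' \<beta>\<close>: this is \<open>n\<close> unless \<open>p dQ\<close> divides
    \<open>n\<close>, and otherwise \<open>n - j\<close> with \<open>j\<close> not divisible by
    \<open>p dQ\<close>.\<close>
  obtain \<beta> where \<beta>: "\<beta> \<in> \<Gamma>" "cmp P \<beta> = 0" "\<not> p * dQ dvd cmp O' \<beta>"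
  proof (cases "p * dQ dvd n")
    case False
    then show thesis using that[OF pures(1)] lt ne by (simp add: cmp_pure)
  next
    case True
    obtain j where j: "j \<in> KOQ" "\<not> p * dQ dvd j"
      using prime_not_dvd_Gcd_quotient[of p KOQ dQ] good d g dpos by auto
    then obtain \<beta> where \<beta>: "\<beta> \<in> \<Gamma>" "cmp Q \<beta> = j" "cmp P \<beta> = 0" using OQ by blast
    have "n = cmp O' \<beta> + j" using tdeg[OF \<beta>(1)] deg[of \<beta>] \<beta> by simp
    then have "\<not> p * dQ dvd cmp O' \<beta>" using True j(2) dvd_add_right_iff by blast
    then show thesis using that \<beta> by blast
  qed
  define l where "l = cmp O' \<beta>"
  have \<beta>n: "n = l + cmp Q \<beta>" using tdeg[OF \<beta>(1)] deg[of \<beta>] \<beta>(2) by (simp add: l_def)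
  have \<alpha>n: "n = cmp O' \<alpha> + k" using tdeg[OF \<alpha>(1)] deg[of \<alpha>] \<alpha>(2,3) by simp
  have l: "dQ dvd l" using dn(2) dvd(2)[OF \<beta>(1)] \<beta>n by (metis dvd_add_left_iff)
  have kl: "k > 0" "l > 0" using k(2) \<beta>(3) by (auto intro!: Nat.gr0I simp: l_def)
  \<comment> \<open>The effect on the coordinates \<open>P\<close> and \<open>Q\<close> of one use
    of \<open>\<gamma>\<close> in row \<open>P\<close>.\<close>
  define \<phi> where "\<phi> \<gamma> = (int (cmp P \<gamma>) - int n, int (cmp Q \<gamma>))" for \<gamma>
  let ?R = "reach (\<phi> ` \<Gamma>) k l"
  have base: "(int (cmp P \<gamma>) - int n, int (cmp Q \<gamma>)) \<in> ?R" if "\<gamma> \<in> \<Gamma>" for \<gamma>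
    using reach_base[of "\<phi> \<gamma>" "\<phi> ` \<Gamma>"] that by (simp add: \<phi>_def)
  note mult = reach_mult[OF kl] and add = reach_add
  have n0: "(int n, 0) \<in> ?R"
    using mult[OF base[OF pures(1)], of "- 1"] lt ne by (simp add: cmp_pure)
  have span: "(int (Gcd K) * a, int (Gcd K) * a') \<in> ?R"
    if "finite K" "\<And>j. j \<in> K \<Longrightarrow> (int j * a, int j * a') \<in> ?R" for K a a'
  proof -
    have "int (Gcd K) \<in> {z. (z * a, z * a') \<in> ?R}"
    proof (rule Gcd_in_subgroup[OF that(1)])
      show "0 \<in> {z. (z * a, z * a') \<in> ?R}" using reach_0 by (simp add: zero_prod_def)
      fix x y assume "x \<in> {z. (z * a, z * a') \<in> ?R}" "y \<in> {z. (z * a, z * a') \<in> ?R}"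
      then show "x + y \<in> {z. (z * a, z * a') \<in> ?R}"
        using add[of "(x * a, x * a')" _ k l "(y * a, y * a')"] by (simp add: distrib_right)
    next
      fix x assume "x \<in> {z. (z * a, z * a') \<in> ?R}"
      then show "- x \<in> {z. (z * a, z * a') \<in> ?R}"
        using mult[of "x * a" "x * a'" _ "- 1"] by simp
    qed (use that(2) in simp)
    then show ?thesis by simp
  qed
  \<comment> \<open>Edge steps are obtained from moves of row \<open>P\<close>. The reachable set is
    a group, so it contains the gcd of the steps along each edge.\<close>
  have eOP: "(int gOP * 1, int gOP * 0) \<in> ?R"
    unfolding g(1)
  proof (rule span[OF OP(1)])
    fix j assume "j \<in> KOP"
    then obtain \<gamma> where "\<gamma> \<in> \<Gamma>" "cmp P \<gamma> = j" "cmp Q \<gamma> = 0" using OP by blast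
    then show "(int j * 1, int j * 0) \<in> ?R"
      using add[OF base[of \<gamma>] n0] by simp
  qed
  have eOQ: "(int gOQ * 0, int gOQ * 1) \<in> ?R"
    unfolding g(2)
  proof (rule span[OF OQ(1)])
    fix j assume "j \<in> KOQ"
    then obtain \<gamma> where "\<gamma> \<in> \<Gamma>" "cmp Q \<gamma> = j" "cmp P \<gamma> = 0" using OQ by blast
    then show "(int j * 0, int j * 1) \<in> ?R"
      using add[OF base[of \<gamma>] n0] by simp
  qed
  have ePQ: "(int gPQ * (- 1), int gPQ * 1) \<in> ?R"
    unfolding g(3)
  proof (rule span[OF PQ(1)])
    fix j assume "j \<in> KPQ"
    then obtain \<gamma> where \<gamma>: "\<gamma> \<in> \<Gamma>" "cmp Q \<gamma> = j" "cmp O' \<gamma> = 0" using PQ by blast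
    then have "int (cmp P \<gamma>) - int n = - int j" using tdeg[OF \<gamma>(1)] deg[of \<gamma>] by simp
    then show "(int j * (- 1), int j * 1) \<in> ?R" using base[of \<gamma>] \<gamma> by simp
  qed
  let ?xP = "int n - 1 - int (cmp P s)" and ?xQ = "int n - 1 - int (cmp Q s)"
  have "(?xP, ?xQ) \<in> ?R"
    using add[OF add[OF mult[OF eOP, of u] mult[OF eOQ, of t]] mult[OF ePQ, of w]]
    unfolding xP xQ by (simp add: mult.commute)
  then obtain gs' where gs': "set gs' \<subseteq> \<phi> ` \<Gamma>" "int k dvd ?xP - (\<Sum>\<gamma>\<leftarrow>gs'. fst \<gamma>)" "int l dvd ?xQ - (\<Sum>\<gamma>\<leftarrow>gs'. snd \<gamma>)"
    unfolding reach_def by blast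
  from gs'(1) have "gs' \<in> lists (\<phi> ` \<Gamma>)" by (simp add: lists_eq_set)
  then obtain gs where gs: "set gs \<subseteq> \<Gamma>" "gs' = map \<phi> gs"
    unfolding lists_image by (auto simp only: lists_eq_set)
  have 1: "int dP dvd fst \<gamma>" "int dQ dvd snd \<gamma>" if mem: "\<gamma> \<in> set gs'" for \<gamma>
  proof -
    obtain \<delta> where "\<delta> \<in> \<Gamma>" "\<gamma> = \<phi> \<delta>" using mem gs'(1) by blast
    then show "int dP dvd fst \<gamma>" "int dQ dvd snd \<gamma>"
      using dvd[of \<delta>] dn by (simp_all add: \<phi>_def)
  qed
  obtain r A B C where r: "r > 0" "(p ^ r) ^ length gs' dvd C"
    and rP: "?xP = int A * int k - int C * int n + (\<Sum>i<length gs'. int ((p ^ r) ^ i) * fst (gs' ! i))"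
    and rQ: "?xQ = int C * int n - int B * int l + (\<Sum>i<length gs'. int ((p ^ r) ^ i) * snd (gs' ! i))"
    by (rule carry_free_representation[OF p n dvd(1)[OF \<alpha>(1), unfolded \<alpha>(2)] k(2) l \<beta>(3)[folded l_def]
          dpos 1 gs'(2,3)])
  define q where "q = p ^ r"
  define sm where "sm f = (\<Sum>i<length gs. q ^ i * f (gs ! i))" for f :: "expo \<Rightarrow> nat"
  have eP: "?xP = int A * int k - int C * int n + int (sm (cmp P)) - int n * int (sm (\<lambda>_. 1))"
    unfolding rP gs(2) q_def[symmetric] sm_def
    by (simp add: \<phi>_def right_diff_distrib sum_subtractf sum_distrib_left mult.commute)
  have eQ: "?xQ = int C * int n - int B * int l + int (sm (cmp Q))"
    unfolding rQ gs(2) q_def[symmetric] sm_def by (simp add: \<phi>_def)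
  have smO: "sm (cmp O') + sm (cmp P) + sm (cmp Q) = n * sm (\<lambda>_. 1)"
  proof -
    have "q ^ i * cmp O' (gs ! i) + q ^ i * cmp P (gs ! i) + q ^ i * cmp Q (gs ! i) = n * (q ^ i * 1)"
      if "i < length gs" for i
    proof -
      have "gs ! i \<in> \<Gamma>" using that gs(1) nth_mem by blast
      then have "n = cmp O' (gs ! i) + cmp P (gs ! i) + cmp Q (gs ! i)" using tdeg deg by metis
      then show ?thesis by (simp add: algebra_simps)
    qed
    then show ?thesis
      unfolding sm_def sum.distrib[symmetric] sum_distrib_left by (intro sum.cong) simp_all
  qed
  \<comment> \<open>The list is reversed because \<open>power_row\<close> gives the highest power to
    its head; \<open>C\<close> is divisible by the next power of \<open>q\<close> and precedes
    it.\<close>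
  define \<rho> where "\<rho> i = (if i = O' then [(\<alpha>, A)] else if i = Q then [(\<beta>, B)]
      else (pure n Q, C) # power_row q (rev gs))" for i
  have \<rho>: "\<rho> O' = [(\<alpha>, A)]" "\<rho> Q = [(\<beta>, B)]" "\<rho> P = (pure n Q, C) # power_row q (rev gs)"
    using ne by (auto simp: \<rho>_def)
  have rsums: "rsum i (\<rho> O') = A * cmp i \<alpha>" "rsum i (\<rho> Q) = B * cmp i \<beta>"
    "rsum i (\<rho> P) = C * cmp i (pure n Q) + sm (cmp i)" for i
    unfolding \<rho> rsum_def by (simp_all add: power_row_sum sm_def)
  have esums: "esum (\<rho> O') = A" "esum (\<rho> Q) = B" "esum (\<rho> P) = C + sm (\<lambda>_. 1)"
    unfolding \<rho> esum_def using power_row_sum[of "\<lambda>_. 1" q gs] by (simp_all add: sm_def)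
  have sO: "int (cmp O' s) + int (cmp P s) + int (cmp Q s) = 3 * int n - 3"
    using s deg[of s] n by simp
  have prods: "A * n = A * cmp O' \<alpha> + A * k" "B * n = B * l + B * cmp Q \<beta>"
    using \<alpha>n \<beta>n by (simp_all flip: distrib_left)
  have row_eq: "cmp i s + rsum i (\<rho> O') + rsum i (\<rho> P) + rsum i (\<rho> Q) = n - 1 + n * esum (\<rho> i)"
    if "i = O' \<or> i = P \<or> i = Q" for i
  proof -
    have "int (cmp i s + rsum i (\<rho> O') + rsum i (\<rho> P) + rsum i (\<rho> Q)) = int n - 1 + int n * int (esum (\<rho> i))"
      using that
    proof (elim disjE)
      assume i: "i = O'"
      show ?thesis
        unfolding i rsums esums using eP eQ smO sO prods \<beta>(2) lt ne
        by (simp add: cmp_pure l_def[symmetric] algebra_simps flip: of_nat_mult of_nat_add)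
    next
      assume i: "i = P"
      show ?thesis
        unfolding i rsums esums using eP \<alpha>(2) \<beta>(2) lt ne
        by (simp add: cmp_pure algebra_simps)
    next
      assume i: "i = Q"
      show ?thesis
        unfolding i rsums esums using eQ \<alpha>(3) prods lt ne
        by (simp add: cmp_pure algebra_simps flip: of_nat_mult)
    qed
    also have "\<dots> = int (n - 1 + n * esum (\<rho> i))" using n by (simp add: of_nat_diff)
    finally show ?thesis by (simp only: of_nat_eq_iff)
  qed
  show thesis
  proof (rule that[of \<rho>])
    fix i :: nat assume "i < 3"
    then have i: "i = O' \<or> i = P \<or> i = Q" using perm by auto
    show "fst ` set (\<rho> i) \<subseteq> \<Gamma>"
      using i \<alpha>(1) \<beta>(1) pures(3) gs(1) by (auto simp: \<rho> set_power_row image_iff) (metis fst_conv image_eqI set_power_row set_rev subsetD)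
    have single: "no_carry p [(\<gamma>, m)]" for \<gamma> m using prime_gt_1_nat[OF p] by (simp add: esum_def)
    show "no_carry p (\<rho> i)"
      using i no_carry_power_row[OF p r(1), of "rev gs" C "pure n Q"] r(2) single
      by (auto simp: \<rho> q_def gs(2))
    show "cmp i s + rsum i (\<rho> 0) + rsum i (\<rho> 1) + rsum i (\<rho> 2) = n - 1 + n * esum (\<rho> i)"
      using row_eq[OF i] perm by auto
  qed
qed

section \<open>Residues for the generators of I\<close>

definition edges :: "nat \<Rightarrow> nat set \<Rightarrow> nat set \<Rightarrow> nat set \<Rightarrow> expo set" where
  "edges n ks ls ms = pure n ` {..<3} \<union> (\<lambda>k. (n - k, k, 0)) ` ks
     \<union> (\<lambda>l. (n - l, 0, l)) ` ls \<union> (\<lambda>m. (0, n - m, m)) ` ms"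

lemma Gcd_union_nat: "Gcd (A \<union> B :: nat set) = gcd (Gcd A) (Gcd B)"
proof -
  have "d dvd Gcd (A \<union> B) \<longleftrightarrow> d dvd gcd (Gcd A) (Gcd B)" for d
    by (auto simp: dvd_Gcd_iff)
  then show ?thesis by (metis dvd_antisym dvd_refl)
qed

lemma core_scale: "f \<in> core I \<Longrightarrow> q * f \<in> core I"
  by (auto simp: core_def is_reduction_def intro: ideal.subspace_scale)

context
  fixes n b c :: nat and ks ls ms :: "nat set"
  assumes n_pos: "n > 0" and fin: "finite ks" "finite ls" "finite ms"
    and le: "ks \<subseteq> {0..n}" "ls \<subseteq> {0..n}" "ms \<subseteq> {0..n}"
    and a: "Gcd ({n} \<union> ks \<union> ls) = 1" and b: "b = Gcd ({n} \<union> ks \<union> ms)" and c: "c = Gcd ({n} \<union> ls \<union> ms)"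
begin

lemma edges_dvd:
  assumes "\<gamma> \<in> edges n ks ls ms"
  shows "tdeg \<gamma> = n" "gcd (Gcd (insert n ks)) (Gcd (insert n ls)) dvd cmp 0 \<gamma>"
    "gcd (Gcd (insert n ks)) (Gcd (insert n ms)) dvd cmp 1 \<gamma>" "gcd (Gcd (insert n ls)) (Gcd (insert n ms)) dvd cmp 2 \<gamma>"
proof -
  have dk: "Gcd (insert n ks) dvd n" "\<And>k. k \<in> ks \<Longrightarrow> Gcd (insert n ks) dvd k"
    and dl: "Gcd (insert n ls) dvd n" "\<And>k. k \<in> ls \<Longrightarrow> Gcd (insert n ls) dvd k"
    and dm: "Gcd (insert n ms) dvd n" "\<And>k. k \<in> ms \<Longrightarrow> Gcd (insert n ms) dvd k"
    by (auto intro!: Gcd_dvd simp del: Gcd_insert)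
  consider i where "i < 3" "\<gamma> = pure n i" | k where "k \<in> ks" "\<gamma> = (n - k, k, 0)"
    | l where "l \<in> ls" "\<gamma> = (n - l, 0, l)" | m where "m \<in> ms" "\<gamma> = (0, n - m, m)"
    using assms unfolding edges_def by blast
  note cases = this
  show "tdeg \<gamma> = n" using cases le by cases (auto simp: tdeg_pure)
  show "gcd (Gcd (insert n ks)) (Gcd (insert n ls)) dvd cmp 0 \<gamma>"
    using cases by cases (auto simp: cmp_pure simp del: Gcd_insert intro!: dvd_diff_nat intro: gcd_dvdI1[OF dk(1)] gcd_dvdI2[OF dl(1)]
        gcd_dvdI1[OF dk(2)] gcd_dvdI2[OF dl(2)])
  show "gcd (Gcd (insert n ks)) (Gcd (insert n ms)) dvd cmp 1 \<gamma>"
    using cases by cases (auto simp: cmp_pure simp del: Gcd_insert intro!: dvd_diff_nat intro: gcd_dvdI1[OF dk(1)] gcd_dvdI2[OF dm(1)]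
        gcd_dvdI1[OF dk(2)] gcd_dvdI2[OF dm(2)])
  show "gcd (Gcd (insert n ls)) (Gcd (insert n ms)) dvd cmp 2 \<gamma>"
    using cases by cases (auto simp: cmp_pure simp del: Gcd_insert intro!: dvd_diff_nat intro: gcd_dvdI1[OF dl(1)] gcd_dvdI2[OF dm(1)]
        gcd_dvdI1[OF dl(2)] gcd_dvdI2[OF dm(2)])
qed

lemma weights: "weights n b c"
  by standard (simp_all add: n_pos b c)

interpretation weights n b c
  by (rule weights)

text \<open>\<open>O'\<close> is chosen opposite to the edge whose gcd is most divisible by
  \<open>p\<close>, so that the two quotients required by \<open>exists_rows\<close> are prime to
  \<open>p\<close>. After a rotation some edges are read from their other end, which
  \<open>Gcd_reflect\<close> permits.\<close>

lemma edges_rows: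
  assumes p: "prime p" and s: "tdeg s = 3 * n - 3"
    and x1: "int b dvd int n - 1 - int (cmp 1 s)" and x2: "int c dvd int n - 1 - int (cmp 2 s)"
  obtains r where "\<And>i. i < 3 \<Longrightarrow> fst ` set (r i) \<subseteq> edges n ks ls ms" "\<And>i. i < 3 \<Longrightarrow> no_carry p (r i)"
    "\<And>k. k < 3 \<Longrightarrow> cmp k s + rsum k (r 0) + rsum k (r 1) + rsum k (r 2) = n - 1 + n * esum (r k)"
proof -
  note rowsI = that
  let ?G = "edges n ks ls ms"
  define g01 g02 g12 where "g01 = Gcd (insert n ks)" and "g02 = Gcd (insert n ls)" and "g12 = Gcd (insert n ms)"
  note g = g01_def g02_def g12_def
  have reflect: "g01 = Gcd (insert n ((\<lambda>k. n - k) ` ks))" "g02 = Gcd (insert n ((\<lambda>k. n - k) ` ls))"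
    "g12 = Gcd (insert n ((\<lambda>k. n - k) ` ms))"
    using le by (simp_all add: g Gcd_reflect del: Gcd_insert)
  have pos: "g01 > 0" "g02 > 0" "g12 > 0" using n_pos by (simp_all add: g)
  have gcds: "gcd g01 g02 = 1" "b = gcd g01 g12" "c = gcd g02 g12"
    using a unfolding b c g by (simp_all add: Gcd_union_nat gcd.commute gcd.left_commute)
  note dvd = edges_dvd[folded g]
  obtain u t w where uw: "int n - 1 - int (cmp 1 s) = int g01 * u - int g12 * w"
      "int n - 1 - int (cmp 2 s) = int g02 * t + int g12 * w"
    using edge_lattice[of g01 g02 g12 "int n - 1 - int (cmp 1 s)" "int n - 1 - int (cmp 2 s)"]
      gcds x1 x2 by (metis coprime_iff_gcd_eq_1)
  have "int (cmp 0 s) + int (cmp 1 s) + int (cmp 2 s) = 3 * int n - 3"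
    using s tdeg_cmp[of 0 1 2 s] n_pos by simp
  then have u0: "int n - 1 - int (cmp 0 s) = - (int g01 * u) - int g02 * t"
    using uw by linarith
  have pure: "pure n ` {..<3} \<subseteq> ?G" by (auto simp: edges_def)
  have edge:
    "\<exists>\<gamma>\<in>?G. cmp 1 \<gamma> = j \<and> cmp 2 \<gamma> = 0" "\<exists>\<gamma>\<in>?G. cmp 0 \<gamma> = n - j \<and> cmp 2 \<gamma> = 0" if "j \<in> insert n ks" for j
    using that pure le(1) by (force simp: edges_def lessThan_3 pure_0 pure_1 pure_2)+
  have edge':
    "\<exists>\<gamma>\<in>?G. cmp 2 \<gamma> = j \<and> cmp 1 \<gamma> = 0" "\<exists>\<gamma>\<in>?G. cmp 0 \<gamma> = n - j \<and> cmp 1 \<gamma> = 0" if "j \<in> insert n ls" for j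
    using that pure le(2) by (force simp: edges_def lessThan_3 pure_0 pure_1 pure_2)+
  have edge'':
    "\<exists>\<gamma>\<in>?G. cmp 2 \<gamma> = j \<and> cmp 0 \<gamma> = 0" "\<exists>\<gamma>\<in>?G. cmp 1 \<gamma> = n - j \<and> cmp 0 \<gamma> = 0" if "j \<in> insert n ms" for j
    using that pure le(3) by (force simp: edges_def lessThan_3 pure_0 pure_1 pure_2)+
  have corner: "\<exists>\<gamma>\<in>?G. cmp i \<gamma> = n \<and> cmp j \<gamma> = 0" if "i < 3" "j < 3" "i \<noteq> j" for i j
    using that pure by (intro bexI[of _ "pure n i"]) (auto simp: cmp_pure)
  have reflI: "R j" if "j \<in> insert n ((\<lambda>k. n - k) ` A)" "R n" "\<And>k. k \<in> A \<Longrightarrow> R (n - k)"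
    for R :: "nat \<Rightarrow> bool" and j A
    using that by auto
  consider "multiplicity p g01 \<le> multiplicity p g12" "multiplicity p g02 \<le> multiplicity p g12"
    | "multiplicity p g12 \<le> multiplicity p g02" "multiplicity p g01 \<le> multiplicity p g02"
    | "multiplicity p g02 \<le> multiplicity p g01" "multiplicity p g12 \<le> multiplicity p g01"
    by linarith
  then show thesis
  proof cases
    case 1
    show thesis
    proof (rule exists_rows[where O' = 0 and P = 1 and Q = 2 and p = p and n = n and \<Gamma> = ?G and s = s
          and KOP = "insert n ks" and KOQ = "insert n ls" and KPQ = "insert n ms"
          and gOP = g01 and gOQ = g02 and gPQ = g12 and dP = "gcd g01 g12" and dQ = "gcd g02 g12"
          and u = u and t = t and w = w])
      show "gcd g01 g12 dvd cmp 1 \<gamma>" "gcd g02 g12 dvd cmp 2 \<gamma>" if "\<gamma> \<in> ?G" for \<gamma> using dvd(3,4)[OF that] .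
      show "int n - 1 - int (cmp 1 s) = int g01 * u - int g12 * w" "int n - 1 - int (cmp 2 s) = int g02 * t + int g12 * w"
        using uw .
      show "\<exists>\<gamma>\<in>?G. cmp 1 \<gamma> = j \<and> cmp 2 \<gamma> = 0" if "j \<in> insert n ks" for j
        using edge(1)[OF that] .
      show "\<exists>\<gamma>\<in>?G. cmp 2 \<gamma> = j \<and> cmp 1 \<gamma> = 0" if "j \<in> insert n ls" for j
        using edge'(1)[OF that] .
      show "\<exists>\<gamma>\<in>?G. cmp 2 \<gamma> = j \<and> cmp 0 \<gamma> = 0" if "j \<in> insert n ms" for j
        using edge''(1)[OF that] .
      show "\<not> p dvd g01 div gcd g01 g12" "\<not> p dvd g02 div gcd g02 g12"
        using prime_not_dvd_div_gcd p pos 1 by blast+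
      show thesis
        if "\<And>i. i < 3 \<Longrightarrow> fst ` set (r i) \<subseteq> ?G" "\<And>i. i < 3 \<Longrightarrow> no_carry p (r i)"
          "\<And>k. k < 3 \<Longrightarrow> cmp k s + rsum k (r 0) + rsum k (r 1) + rsum k (r 2) = n - 1 + n * esum (r k)" for r
        by (rule rowsI[OF that])
    qed (assumption | rule p n_pos pure dvd(1) pos s g HOL.refl | simp add: fin)+
  next
    case 2
    show thesis
    proof (rule exists_rows[where O' = 1 and P = 2 and Q = 0 and p = p and n = n and \<Gamma> = ?G and s = s
          and KOP = "insert n ms" and KOQ = "insert n ((\<lambda>k. n - k) ` ks)" and KPQ = "insert n ((\<lambda>k. n - k) ` ls)"
          and gOP = g12 and gOQ = g01 and gPQ = g02 and dP = "gcd g12 g02" and dQ = "gcd g01 g02"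
          and u = w and t = "- u" and w = "- t"])
      show "\<not> p dvd g12 div gcd g12 g02" "\<not> p dvd g01 div gcd g01 g02"
        using prime_not_dvd_div_gcd p pos 2 by blast+
      show thesis
        if "\<And>i. i < 3 \<Longrightarrow> fst ` set (r i) \<subseteq> ?G" "\<And>i. i < 3 \<Longrightarrow> no_carry p (r i)"
          "\<And>k. k < 3 \<Longrightarrow> cmp k s + rsum k (r 0) + rsum k (r 1) + rsum k (r 2) = n - 1 + n * esum (r k)" for r
        by (rule rowsI[OF that])
      show "g01 = Gcd (insert n ((\<lambda>k. n - k) ` ks))" "g02 = Gcd (insert n ((\<lambda>k. n - k) ` ls))" by (rule reflect)+
      show "gcd g01 g02 dvd cmp 0 \<gamma>" if "\<gamma> \<in> ?G" for \<gamma> using dvd(2)[OF that] .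
      show "gcd g12 g02 dvd cmp 2 \<gamma>" if "\<gamma> \<in> ?G" for \<gamma> using dvd(4)[OF that] by (simp add: gcd.commute)
      show "int n - 1 - int (cmp 2 s) = int g12 * w - int g02 * (- t)" using uw by simp
      show "int n - 1 - int (cmp 0 s) = int g01 * (- u) + int g02 * (- t)" using u0 by simp
      show "\<exists>\<gamma>\<in>?G. cmp 2 \<gamma> = j \<and> cmp 0 \<gamma> = 0" if "j \<in> insert n ms" for j
        using edge''(1)[OF that] .
      show "\<exists>\<gamma>\<in>?G. cmp 0 \<gamma> = j \<and> cmp 2 \<gamma> = 0" if "j \<in> insert n ((\<lambda>k. n - k) ` ks)" for j
        by (rule reflI[OF that]) (rule corner edge(2); simp)+
      show "\<exists>\<gamma>\<in>?G. cmp 0 \<gamma> = j \<and> cmp 1 \<gamma> = 0" if "j \<in> insert n ((\<lambda>k. n - k) ` ls)" for j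
        by (rule reflI[OF that]) (rule corner edge'(2); simp)+
    qed (assumption | rule p n_pos pure dvd(1) pos s g HOL.refl | simp add: fin)+
  next
    case 3
    show thesis
    proof (rule exists_rows[where O' = 2 and P = 0 and Q = 1 and p = p and n = n and \<Gamma> = ?G and s = s
          and KOP = "insert n ((\<lambda>k. n - k) ` ls)" and KOQ = "insert n ((\<lambda>k. n - k) ` ms)" and KPQ = "insert n ks"
          and gOP = g02 and gOQ = g12 and gPQ = g01 and dP = "gcd g02 g01" and dQ = "gcd g12 g01"
          and u = "- t" and t = "- w" and w = u])
      show "\<not> p dvd g02 div gcd g02 g01" "\<not> p dvd g12 div gcd g12 g01"
        using prime_not_dvd_div_gcd p pos 3 by blast+
      show thesis
        if "\<And>i. i < 3 \<Longrightarrow> fst ` set (r i) \<subseteq> ?G" "\<And>i. i < 3 \<Longrightarrow> no_carry p (r i)"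
          "\<And>k. k < 3 \<Longrightarrow> cmp k s + rsum k (r 0) + rsum k (r 1) + rsum k (r 2) = n - 1 + n * esum (r k)" for r
        by (rule rowsI[OF that])
      show "g02 = Gcd (insert n ((\<lambda>k. n - k) ` ls))" "g12 = Gcd (insert n ((\<lambda>k. n - k) ` ms))" by (rule reflect)+
      show "gcd g02 g01 dvd cmp 0 \<gamma>" if "\<gamma> \<in> ?G" for \<gamma> using dvd(2)[OF that] by (simp add: gcd.commute)
      show "gcd g12 g01 dvd cmp 1 \<gamma>" if "\<gamma> \<in> ?G" for \<gamma> using dvd(3)[OF that] by (simp add: gcd.commute)
      show "int n - 1 - int (cmp 0 s) = int g02 * (- t) - int g01 * u" using u0 by simp
      show "int n - 1 - int (cmp 1 s) = int g12 * (- w) + int g01 * u" using uw by simp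
      show "\<exists>\<gamma>\<in>?G. cmp 0 \<gamma> = j \<and> cmp 1 \<gamma> = 0" if "j \<in> insert n ((\<lambda>k. n - k) ` ls)" for j
        by (rule reflI[OF that]) (rule corner edge'(2); simp)+
      show "\<exists>\<gamma>\<in>?G. cmp 1 \<gamma> = j \<and> cmp 0 \<gamma> = 0" if "j \<in> insert n ((\<lambda>k. n - k) ` ms)" for j
        by (rule reflI[OF that]) (rule corner edge''(2); simp)+
      show "\<exists>\<gamma>\<in>?G. cmp 1 \<gamma> = j \<and> cmp 2 \<gamma> = 0" if "j \<in> insert n ks" for j
        using edge(1)[OF that] .
    qed (assumption | rule p n_pos pure dvd(1) pos s g HOL.refl | simp add: fin)+
  qed
qed

theorem core_subset_F:
  assumes inf: "infinite (UNIV :: 'k::field set)"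
  shows "core (ideal.span (mon ` edges n ks ls ms)) \<subseteq> (F D :: 'k poly3 set)"
proof
  let ?G = "edges n ks ls ms"
  fix f :: "'k poly3" assume f: "f \<in> core (ideal.span (mon ` ?G))"
  have "s \<in> Fx D" if s: "s \<in> supp f" for s
  proof (rule ccontr)
    assume "s \<notin> Fx D"
    then have om: "om s < D" by (simp add: Fx_def)
    obtain i j l where ijl: "s = (i, j, l)" by (cases s)
    \<comment> \<open>Multiplication by \<open>mon m\<close> brings \<open>s\<close> to total degree
      \<open>3n - 3\<close>, with exponents of \<open>y\<close> and \<open>z\<close> congruent to -1
      modulo \<open>b\<close> and \<open>c\<close>, as \<open>edges_rows\<close> needs. The
      condition \<open>om s < D\<close> leaves exactly the room for this.\<close>
    define m where "m = (D - 1 - om s, b - 1 - j mod b, c - 1 - l mod c)"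
    define f' where "f' = prj {u. tdeg u = 3 * n - 3} (mon m * f)"
    have jb: "j = b * (j div b) + j mod b" "j mod b < b" and lc: "l = c * (l div c) + l mod c" "l mod c < c"
      using b_pos c_pos by simp_all
    have "tdeg (m + s) = (D - 1 - om s) + (b - 1 - j mod b) + (c - 1 - l mod c) + (i + j + l)"
      by (simp add: m_def ijl tdeg_add)
    also have "\<dots> = 3 * n - 3"
    proof -
      have *: "(D - 1 - (i + x + y)) + (b - 1 - j') + (c - 1 - l') + (i + (x + j') + (y + l')) = 3 * n - 3"
        if "i + x + y < D" "j' < b" "l' < c" for x y j' l' :: nat
      proof -
        define e1 e2 e3 where "e1 = D - Suc (i + x + y)" and "e2 = b - Suc j'" and "e3 = c - Suc l'"
        then have e: "D = i + x + y + Suc e1" "b = j' + Suc e2" "c = l' + Suc e3"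
          using that by simp_all
        have "D + b + c = 3 * n" using b_le c_le by (simp add: D_def)
        then have "e1 + e2 + e3 + (i + (x + j') + (y + l')) = 3 * n - 3" using e by linarith
        then show ?thesis by (simp add: e1_def e2_def e3_def)
      qed
      show ?thesis
        using *[of "b * (j div b)" "c * (l div c)" "j mod b" "l mod c"] om jb(2) lc(2) by (simp add: ijl)
    qed
    finally have deg: "tdeg (m + s) = 3 * n - 3" .
    have cs: "coef f' (m + s) \<noteq> 0"
      using s deg by (simp add: f'_def coef_mon_mult in_keys_iff)
    \<comment> \<open>In characteristic 0 any prime serves, since \<open>of_nat q = 0\<close> forces
      \<open>q = 0\<close>.\<close>
    define p where "p = (if CHAR('k) = 0 then 2 else CHAR('k))"
    have p: "prime p" using prime_CHAR_semidom[where 'a = 'k] by (auto simp: p_def)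
    have p0: "p dvd q" if "of_nat q = (0 :: 'k)" for q
      using that by (auto simp: p_def of_nat_eq_0_iff_char_dvd)
    have 1: "int b dvd int n - 1 - int (cmp 1 (m + s))"
    proof -
      have "int (cmp 1 (m + s)) = int b - 1 + int b * int (j div b)"
      proof -
        have "int j = int b * int (j div b) + int (j mod b)" by (simp flip: of_nat_mult of_nat_add)
        then show ?thesis using jb(2) by (simp add: m_def ijl of_nat_diff)
      qed
      then have eq: "int n - 1 - int (cmp 1 (m + s)) = int n - int b * (1 + int (j div b))"
        by (simp add: distrib_left)
      show ?thesis unfolding eq using b_dvd by (intro dvd_diff) auto
    qed
    have 2: "int c dvd int n - 1 - int (cmp 2 (m + s))"
    proof -
      have "int (cmp 2 (m + s)) = int c - 1 + int c * int (l div c)"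
      proof -
        have "int l = int c * int (l div c) + int (l mod c)" by (simp flip: of_nat_mult of_nat_add)
        then show ?thesis using lc(2) by (simp add: m_def ijl of_nat_diff)
      qed
      then have eq: "int n - 1 - int (cmp 2 (m + s)) = int n - int c * (1 + int (l div c))"
        by (simp add: distrib_left)
      show ?thesis unfolding eq using c_dvd by (intro dvd_diff) auto
    qed
    obtain r where r: "\<And>i. i < 3 \<Longrightarrow> fst ` set (r i) \<subseteq> ?G" "\<And>i. i < 3 \<Longrightarrow> no_carry p (r i)"
      and T: "\<And>k. k < 3 \<Longrightarrow> cmp k (m + s) + rsum k (r 0) + rsum k (r 1) + rsum k (r 2) = n - 1 + n * esum (r k)"
      using edges_rows[OF p deg 1 2] by blast
    define R where "R = (rsum 0 (r 0), rsum 1 (r 0), rsum 2 (r 0)) + (rsum 0 (r 1), rsum 1 (r 1), rsum 2 (r 1))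
      + (rsum 0 (r 2), rsum 1 (r 2), rsum 2 (r 2))"
    \<comment> \<open>The rows act as a shift by \<open>R\<close>, so the coefficient at the target
      is that of \<open>f'\<close> at \<open>m + s\<close> alone.\<close>
    have "f' * rmon (r 0) * rmon (r 1) * rmon (r 2) = mon R * f'"
      unfolding rmon_eq R_def mon_add by (simp add: mult_ac)
    moreover have "target n (esum (r 0), esum (r 1), esum (r 2)) = R + (m + s)"
      using T[of 0] T[of 1] T[of 2] by (cases "m + s") (simp add: R_def)
    ultimately have "coef (f' * rmon (r 0) * rmon (r 1) * rmon (r 2)) (target n (esum (r 0), esum (r 1), esum (r 2))) \<noteq> 0"
      using cs by (simp only: coef_mon_mult not_False_eq_True)
    from residue_nonzero[OF inf p0 r(2) this] obtain h :: "nat \<Rightarrow> 'k poly3" and N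
      where h: "\<forall>i<3. supp (h i) \<subseteq> fst ` set (r i)" and nz: "residue n h N f' \<noteq> 0" by blast
    interpret equigenerated n ?G h
    proof
      show "finite ?G" using fin by (simp add: edges_def)
      show "supp (h i) \<subseteq> ?G" if "i < 3" for i using h r(1) that by blast
    qed (use n_pos edges_dvd(1) in \<open>auto simp: edges_def\<close>)
    have "residue n h N f' = 0"
      unfolding f'_def by (rule residue_core_eq_0[OF inf core_scale[OF f]])
    then show False using nz by simp
  qed
  then show "f \<in> F D" by (auto simp: F_def)
qed

end

section \<open>Identification of S, K and L by exponents\<close>

context weights
begin

lemma mem_subalgebra_iff:
  fixes f :: "'k::field poly3"
  shows "f \<in> subalgebra_gen {X, Y ^ b, Z ^ c} \<longleftrightarrow> supp f \<subseteq> (\<Union>d. Sx d)"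
proof
  assume "f \<in> subalgebra_gen {X, Y ^ b, Z ^ c}"
  then show "supp f \<subseteq> (\<Union>d. Sx d)"
  proof induction
    case (Const u)
    then show ?case by (auto simp: Const_def Sx_def zero_prod_def split: if_splits)
  next
    case (gen f)
    have "supp (X :: 'k poly3) = {(1, 0, 0)}" "supp (Y ^ b :: 'k poly3) = {(0, b, 0)}"
      "supp (Z ^ c :: 'k poly3) = {(0, 0, c)}"
      by (simp_all add: X_def flip: mon_power)
    then show ?case using gen by (auto simp: Sx_def)
  next
    case (add f g)
    then show ?case using keys_add[of f g] by blast
  next
    case (mult f g)
    show ?case
    proof
      fix w assume "w \<in> supp (f * g)"
      from supp_mult_subset[OF this] obtain u v
        where "u \<in> supp f" "v \<in> supp g" and w: "w = u + v" by (elim bexE)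
      then obtain d e where "u \<in> Sx d" "v \<in> Sx e" using mult.IH by blast
      then show "w \<in> (\<Union>d. Sx d)" unfolding w using Sx_add by blast
    qed
  qed
next
  let ?S = "subalgebra_gen {X, Y ^ b, Z ^ c}"
  assume f: "supp f \<subseteq> (\<Union>d. Sx d)"
  have pow: "q ^ m \<in> ?S" if "q \<in> ?S" for q m
    using that subalgebra_gen.Const[of 1] by (induction m) (auto intro: subalgebra_gen.mult)
  have sum: "sum q A \<in> ?S" if "\<And>x. x \<in> A \<Longrightarrow> q x \<in> ?S" for q and A :: "expo set"
    using that subalgebra_gen.Const[of 0]
    by (induction A rule: infinite_finite_induct) (auto intro: subalgebra_gen.add)
  have "Const (coef f u) * mon u \<in> ?S" if us: "u \<in> supp f" for u
  proof -
    obtain i j l where u: "u = (i, j, l)" by (cases u)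
    obtain d where "u \<in> Sx d" using us f by blast
    then have "b dvd j" "c dvd l" by (simp_all add: u Sx_def)
    then obtain j' l' where "j = b * j'" "l = c * l'" by (elim dvdE)
    then have "mon u = X ^ i * (Y ^ b) ^ j' * (Z ^ c) ^ l'"
      by (simp add: u mon_monomial[symmetric] power_mult)
    also have "\<dots> \<in> ?S"
    proof (intro subalgebra_gen.mult)
      show "X ^ i \<in> ?S" "(Y ^ b) ^ j' \<in> ?S" "(Z ^ c) ^ l' \<in> ?S"
        by (rule pow, rule subalgebra_gen.gen, simp)+
    qed
    finally show ?thesis by (intro subalgebra_gen.mult subalgebra_gen.Const)
  qed
  then have "(\<Sum>u\<in>supp f. Const (coef f u) * mon u) \<in> ?S" by (rule sum)
  then show "f \<in> ?S" by (simp only: poly3_sum_monomials[symmetric])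
qed

lemma homogeneous_iff: "homogeneous d f \<longleftrightarrow> supp f \<subseteq> {u. tdeg u = d}"
  by (auto simp: homogeneous_def)

lemma graded_part_eq: "graded_part (subalgebra_gen {X, Y ^ b, Z ^ c}) d = Sd d"
proof -
  have "u \<in> (\<Union>d. Sx d) \<and> tdeg u = d \<longleftrightarrow> u \<in> Sx d" for u
    by (auto simp: Sx_iff simp del: split_paired_All)
  then show ?thesis
    unfolding graded_part_def mem_subalgebra_iff homogeneous_iff Sd_def by blast
qed

lemma span_graded_ge:
  "ideal.span (graded_ge (subalgebra_gen {X, Y ^ b, Z ^ c}) d) = (F d :: 'k::field poly3 set)"
proof
  show "ideal.span (graded_ge (subalgebra_gen {X, Y ^ b, Z ^ c}) d) \<subseteq> (F d :: 'k poly3 set)"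
  proof (rule ideal.span_minimal[OF _ ideal_subspace_F])
    show "graded_ge (subalgebra_gen {X, Y ^ b, Z ^ c}) d \<subseteq> (F d :: 'k poly3 set)"
    proof
      fix x :: "'k poly3" assume "x \<in> graded_ge (subalgebra_gen {X, Y ^ b, Z ^ c}) d"
      then obtain E f where x: "x = (\<Sum>e\<in>E. f e)" "E \<subseteq> {d..}" "\<forall>e\<in>E. f e \<in> Sd e"
        unfolding graded_ge_def graded_part_eq by blast
      have "f e \<in> F d" if "e \<in> E" for e
        using x that Sd_subset_F[of e] by (fastforce simp: F_def Fx_def)
      then show "x \<in> F d" unfolding x(1) by (rule ideal.subspace_sum[OF ideal_subspace_F])
    qed
  qed
  have "(mon u :: 'k poly3) \<in> graded_ge (subalgebra_gen {X, Y ^ b, Z ^ c}) d" if "u \<in> Sx e" "d \<le> e" for u e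
    unfolding graded_ge_def graded_part_eq
    using that by (intro CollectI exI[of _ "{e}"] exI[of _ "\<lambda>_. mon u"]) (simp add: Sd_def)
  then show "(F d :: 'k poly3 set) \<subseteq> ideal.span (graded_ge (subalgebra_gen {X, Y ^ b, Z ^ c}) d)"
    unfolding F_eq_span by (intro ideal.span_mono) auto
qed

lemma span_monomials_of_degree:
  "ideal.span (monomials_of_degree d \<inter> subalgebra_gen {X, Y ^ b, Z ^ c}) = (ideal.span (mon ` Sx d) :: 'k::field poly3 set)"
proof -
  have "monomials_of_degree d \<inter> subalgebra_gen {X, Y ^ b, Z ^ c} = (mon ` Sx d :: 'k poly3 set)"
    unfolding monomials_of_degree_def mon_monomial
    by (auto simp: mem_subalgebra_iff Sx_def image_iff)
  then show ?thesis by simp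
qed

lemma pure_reductions:
  "is_reduction (ideal.span (mon ` pure n ` {..<3})) (ideal.span (mon ` Sx n) :: 'k::field poly3 set)"
  "is_reduction (ideal.span (mon ` pure n ` {..<3})) (F n :: 'k poly3 set)"
proof -
  have pure: "pure n ` {..<3} \<subseteq> Sx n"
    using b_dvd c_dvd by (auto simp: lessThan_3 pure_0 pure_1 pure_2 Sx_def)
  show "is_reduction (ideal.span (mon ` pure n ` {..<3})) (ideal.span (mon ` Sx n) :: 'k poly3 set)"
    by (rule pure_reduction[OF n_pos finite_Sx pure]) (simp add: Sx_iff)
  \<comment> \<open>A finite generating set, as \<open>pure_reduction\<close> requires: a monomial
    with an exponent above \<open>n\<close> is divisible by a pure power.\<close>
  define M where "M = (\<Union>e\<in>{n..}. Sx e) \<inter> {0..n} \<times> {0..n} \<times> {0..n}"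
  have pureM: "pure n ` {..<3} \<subseteq> M"
    using pure by (auto simp: M_def lessThan_3 pure_0 pure_1 pure_2)
  have "F n = (ideal.span (mon ` M) :: 'k poly3 set)"
  proof
    show "(ideal.span (mon ` M) :: 'k poly3 set) \<subseteq> F n"
      unfolding F_eq_span by (intro ideal.span_mono) (auto simp: M_def)
    show "F n \<subseteq> (ideal.span (mon ` M) :: 'k poly3 set)"
      unfolding F_eq_span
    proof (rule ideal.span_minimal)
      have "\<exists>m\<in>M. \<exists>v. u = v + m" if "u \<in> Sx e" "n \<le> e" for u e
      proof (cases "u \<in> M")
        case True
        then show ?thesis by (intro bexI[of _ u] exI[of _ 0]) simp_all
      next
        case False
        obtain i j l where u: "u = (i, j, l)" by (cases u)
        have "i > n \<or> j > n \<or> l > n" using False that by (auto simp: M_def u)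
        then consider "i > n" | "j > n" | "l > n" by blast
        then show ?thesis
        proof cases
          case 1
          then have "u = (i - n, j, l) + pure n 0" by (simp add: u pure_0)
          then show ?thesis using pureM by (intro bexI[of _ "pure n 0"] exI) auto
        next
          case 2
          then have "u = (i, j - n, l) + pure n 1" by (simp add: u pure_1)
          then show ?thesis using pureM by (intro bexI[of _ "pure n 1"] exI) auto
        next
          case 3
          then have "u = (i, j, l - n) + pure n 2" by (simp add: u pure_2)
          then show ?thesis using pureM by (intro bexI[of _ "pure n 2"] exI) auto
        qed
      qed
      then show "mon ` (\<Union>e\<in>{n..}. Sx e) \<subseteq> (ideal.span (mon ` M) :: 'k poly3 set)"
        unfolding image_subset_iff mem_monomial_ideal_iff supp_mon by blast
    qed simp
  qed
  moreover have "is_reduction (ideal.span (mon ` pure n ` {..<3})) (ideal.span (mon ` M) :: 'k poly3 set)"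
    by (rule pure_reduction[OF n_pos _ pureM]) (auto simp: M_def Sx_iff simp del: split_paired_All)
  ultimately show "is_reduction (ideal.span (mon ` pure n ` {..<3})) (F n :: 'k poly3 set)" by simp
qed

end

theorem theorem7p7:
  fixes n a b c :: nat
    and ks ls ms :: "nat list"
    and I S K L :: "'k::field poly3 set"
  assumes "infinite (UNIV :: 'k set)"
    and "set ks \<subseteq> {0..n}" and "set ls \<subseteq> {0..n}" and "set ms \<subseteq> {0..n}"
    and "I = ideal.span ({X ^ n, Y ^ n, Z ^ n}
               \<union> {X ^ (n - k) * Y ^ k | k. k \<in> set ks}
               \<union> {X ^ (n - l) * Z ^ l | l. l \<in> set ls}
               \<union> {Y ^ (n - m) * Z ^ m | m. m \<in> set ms})"
    and "I \<noteq> UNIV"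
    and "a = Gcd ({n} \<union> set ks \<union> set ls)"
    and "b = Gcd ({n} \<union> set ks \<union> set ms)"
    and "c = Gcd ({n} \<union> set ls \<union> set ms)"
    and "S = subalgebra_gen {X ^ a, Y ^ b, Z ^ c}"
    and "gcd a (gcd b c) = 1"
    and "a \<le> b" and "b \<le> c"
    and "K = ideal.span (monomials_of_degree n \<inter> S)"
    and "L = ideal.span (graded_ge S n)"
    and "a = 1"
  shows "core I = core K \<and> core K = core L \<and> core L = ideal.span (graded_ge S (3 * n - b - c))"
proof -
  let ?G = "edges n (set ks) (set ls) (set ms)"
  have "n > 0"
  proof (rule ccontr)
    assume "\<not> n > 0"
    then have "1 \<in> I" unfolding assms(5) by (intro ideal.span_base) simp
    then have "f * 1 \<in> I" for f unfolding assms(5) by (rule ideal.span_scale)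
    then show False using assms(6) by auto
  qed
  note ctx = this finite_set finite_set finite_set assms(2-4) assms(7)[symmetric, unfolded \<open>a = 1\<close>] assms(8,9)
  interpret weights n b c by (rule weights[OF ctx])
  have "X ^ (n - k) * Y ^ k = (mon (n - k, k, 0) :: 'k poly3)" "X ^ (n - k) * Z ^ k = (mon (n - k, 0, k) :: 'k poly3)"
    "Y ^ (n - k) * Z ^ k = (mon (0, n - k, k) :: 'k poly3)" for k
    by (simp_all add: mon_monomial[symmetric])
  then have "{X ^ n, Y ^ n, Z ^ n} \<union> {X ^ (n - k) * Y ^ k | k. k \<in> set ks} \<union> {X ^ (n - l) * Z ^ l | l. l \<in> set ls}
      \<union> {Y ^ (n - m) * Z ^ m | m. m \<in> set ms} = (mon ` ?G :: 'k poly3 set)"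
    by (simp add: edges_def image_Un image_image lessThan_3 pure_0 pure_1 pure_2 mon_power setcompr_eq_image)
  then have I: "I = ideal.span (mon ` ?G)" using assms(5) by simp
  have K: "K = ideal.span (mon ` Sx n)" and L: "L = F n"
    and rhs: "ideal.span (graded_ge S (3 * n - b - c)) = F D"
    unfolding assms(14,15) assms(10) \<open>a = 1\<close> D_def
    by (simp_all only: power_one_right span_monomials_of_degree span_graded_ge)
  have "gcd (Gcd (insert n (set ks))) (Gcd (insert n (set ms))) = b"
    "gcd (Gcd (insert n (set ls))) (Gcd (insert n (set ms))) = c"
    unfolding assms(8,9) by (simp_all add: Gcd_union_nat gcd.commute gcd.left_commute)
  then have "?G \<subseteq> Sx n"
  proof (intro subsetI)
    fix \<gamma> assume eq: "gcd (Gcd (insert n (set ks))) (Gcd (insert n (set ms))) = b"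
      "gcd (Gcd (insert n (set ls))) (Gcd (insert n (set ms))) = c" and "\<gamma> \<in> ?G"
    from edges_dvd[OF ctx this(3), unfolded eq] show "\<gamma> \<in> Sx n"
      by (cases \<gamma>) (simp add: Sx_def)
  qed
  then have IK: "I \<subseteq> K" unfolding I K by (intro ideal.span_mono image_mono)
  have KL: "K \<subseteq> L" unfolding K L F_eq_span by (intro ideal.span_mono) auto
  have pureI: "ideal.span (mon ` pure n ` {..<3}) \<subseteq> I"
    unfolding I edges_def by (intro ideal.span_mono image_mono) blast
  have "is_reduction I K"
    by (rule is_reduction_middle[OF _ pureI IK]) (use pure_reductions(1) in \<open>simp_all add: K I\<close>)
  moreover have "is_reduction K L"
    by (rule is_reduction_middle[OF _ order_trans[OF pureI IK] KL]) (use pure_reductions(2) in \<open>simp_all add: K L\<close>)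
  ultimately have "core L \<subseteq> core K" "core K \<subseteq> core I"
    by (simp_all add: core_antimono)
  moreover have "core I \<subseteq> F D"
    unfolding I by (rule core_subset_F[OF ctx assms(1)])
  moreover have "F D \<subseteq> core L"
    unfolding core_def L using reduction_contains_F[OF assms(1)] by blast
  ultimately show ?thesis unfolding rhs by blast
qed

end
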